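(* For every integer $r \geq 3$, \[ \frac{1}{r^{3/2}} n^{3/2} - o(n^{3/2}) \;\leq\; \mathrm{ex}_r\bigl(n, \{C_2, C_3, K_{2,2r-3}\}\bigr) \;\leq\; \frac{\sqrt{2r-4}}{r(r-1)}\, n^{3/2} + \frac{n}{r}, \] where the $o(n^{3/2})$ term is as $n \to \infty$ with $r$ fixed.
   Context: Let $G$ be a multigraph and $\mathcal{F}$ a hypergraph. $\mathcal{F}$ is a Berge-$G$ if there is a bijection $f: E(G) \to E(\mathcal{F})$ with $e \subseteq f(e)$ for every $e \in E(G)$. For a family $\mathcal{G}$ of multigraphs, a hypergraph $\mathcal{H}$ is $\mathcal{G}$-free if for every $G \in \mathcal{G}$, $\mathcal{H}$ contains no subhypergraph isomorphic to a Berge-$G$. $\mathrm{ex}_r(n,\mathcal{G})$ denotes the maximum number of edges in an $n$-vertex $r$-uniform $\mathcal{G}$-free hypergraph. Here $C_2$ is the multigraph consisting of two vertices joined by two parallel edges (so $C_2$-free is equivalent to linear: two distinct edges share at most one vertex), $C_3$ is the triangle, and $K_{2,t}$ is the complete bipartite graph with parts of sizes $2$ and $t$. *)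

theory Defs
  imports Complex_Main "HOL-Library.Landau_Symbols"
begin

text \<open>A multigraph is given by a vertex set V, an edge (index) set E, and an
  endpoint map ends assigning to each edge a 2-element set of vertices
  (parallel edges are distinct indices with equal endpoints).\<close>

definition contains_Berge ::
  "'a set set \<Rightarrow> 'v set \<Rightarrow> 'e set \<Rightarrow> ('e \<Rightarrow> 'v set) \<Rightarrow> bool" where
  "contains_Berge H V E ends \<longleftrightarrow>
     (\<exists>(phi :: 'v \<Rightarrow> 'a) (f :: 'e \<Rightarrow> 'a set).
        inj_on phi V \<and> inj_on f E \<and> f ` E \<subseteq> H \<and>
        (\<forall>e\<in>E. phi ` ends e \<subseteq> f e))"

definition C2_V :: "nat set" where "C2_V = {0, 1}"
definition C2_E :: "nat set" where "C2_E = {0, 1}"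
definition C2_ends :: "nat \<Rightarrow> nat set" where "C2_ends e = {0, 1}"

definition C3_V :: "nat set" where "C3_V = {0, 1, 2}"
definition C3_E :: "nat set" where "C3_E = {0, 1, 2}"
definition C3_ends :: "nat \<Rightarrow> nat set" where
  "C3_ends e = (if e = 0 then {0, 1} else if e = 1 then {1, 2} else {0, 2})"

definition K2t_V :: "nat \<Rightarrow> nat set" where "K2t_V t = {0, 1} \<union> {2..<t+2}"
definition K2t_E :: "nat \<Rightarrow> (nat \<times> nat) set" where "K2t_E t = {0, 1} \<times> {2..<t+2}"
definition K2t_ends :: "nat \<times> nat \<Rightarrow> nat set" where "K2t_ends e = {fst e, snd e}"

definition uniform_hg :: "nat \<Rightarrow> nat \<Rightarrow> nat set set \<Rightarrow> bool" where
  "uniform_hg r n H \<longleftrightarrow> (\<forall>e\<in>H. e \<subseteq> {..<n} \<and> card e = r)"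

definition free_C2_C3_K2t :: "nat \<Rightarrow> nat set set \<Rightarrow> bool" where
  "free_C2_C3_K2t t H \<longleftrightarrow>
     \<not> contains_Berge H C2_V C2_E C2_ends \<and>
     \<not> contains_Berge H C3_V C3_E C3_ends \<and>
     \<not> contains_Berge H (K2t_V t) (K2t_E t) K2t_ends"

definition ex_C2_C3_K2t :: "nat \<Rightarrow> nat \<Rightarrow> nat \<Rightarrow> nat" where
  "ex_C2_C3_K2t r t n = Max {card H | H. uniform_hg r n H \<and> free_C2_C3_K2t t H}"

end

theory Submission
  imports Defs "HOL-Complex_Analysis.Complex_Analysis" "HOL-Number_Theory.Prime_Powers" "HOL-Real_Asymp.Real_Asymp"
begin

text \<open>
  Upper bound: if \<open>H\<close> is \<open>{C\<^sub>2, C\<^sub>3}\<close>-free and two vertices have \<open>t\<close> common neighbours (each via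
  two different edges), then the \<open>2 t\<close> edges used are automatically distinct and form a Berge
  \<open>K\<^sub>2\<^sub>,\<^sub>t\<close>. Counting the pairs of neighbours of each vertex that lie in different edges, the
  Cauchy--Schwarz inequality bounds the average degree.

  Lower bound: for an odd prime \<open>p \<ge> r\<close>, the \<open>p\<^sup>3\<close> edges
  \<open>{(i, x + i y, z + i y\<^sup>2) | i < r}\<close> (\<open>x\<close>, \<open>y\<close>, \<open>z\<close> modulo \<open>p\<close>) on \<open>r p\<^sup>2\<close> vertices are free of the
  forbidden configurations: two vertices of different parts in a common edge determine its
  parameter \<open>y\<close>, a triangle forces equal parameters by
  \<open>(a + b) (a x\<^sup>2 + b y\<^sup>2) - (a x + b y)\<^sup>2 = a b (x - y)\<^sup>2\<close>, and a common neighbour in a given third part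
  corresponds to a root of a nonzero quadratic polynomial, so there are at most \<open>2 (r - 2)\<close> of them;
  two vertices of the same part have at most one common neighbour in each of the \<open>r - 1\<close> other parts.

  To have such a \<open>p\<close> with \<open>r p\<^sup>2 \<sim> n\<close> for every large \<open>n\<close>, one needs a prime in
  \<open>(x, (1 + \<epsilon>) x]\<close> for all large \<open>x\<close>. Newman's contour argument, applied to the
  Dirichlet series with coefficients \<open>(\<theta>(n) - n) / n\<close>, shows that
  \<open>\<Sum> (\<theta>(n) - n) / n\<^sup>2\<close> converges, since \<open>\<zeta>\<close> has no zero with real part at least \<open>1\<close>; on a long interval without primes \<open>\<theta>\<close> is constant, and
  the sum over one of the two ends of the interval would stay bounded away from \<open>0\<close>.
\<close>

section \<open>Newman's Tauberian theorem\<close>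

lemma powr_diff_mvt:
  fixes a b p :: real
  assumes "0 < a" "a < b"
  shows "\<exists>x. a < x \<and> x < b \<and> b powr p - a powr p = (b - a) * (p * x powr (p - 1))"
  using assms by (intro MVT2 allI impI) (auto intro!: derivative_eq_intros simp: powr_diff)

text \<open>By the mean value theorem each term is at most a difference of consecutive values of
  \<open>f\<close>, so the tail is dominated by a telescoping series. This controls the remainder of
  the Dirichlet series to the right of the imaginary axis.\<close>

lemma powr_tail:
  assumes "x > 0" "N \<ge> (1::nat)"
  shows "summable (\<lambda>n. real (n + N + 1) powr (-1-x))"
    and "(\<Sum>n. real (n + N + 1) powr (-1-x)) \<le> real N powr (-x) / x"
proof -
  define f where "f n = real (n + N) powr (-x) / x" for n
  have le: "real (n + N + 1) powr (-1-x) \<le> f n - f (Suc n)" for n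
  proof -
    have "\<exists>t. real (n+N) < t \<and> t < real (n+N+1) \<and> real (n+N+1) powr (-x) - real (n+N) powr (-x)
        = (real (n+N+1) - real (n+N)) * (-x * t powr (-x-1))"
      using assms by (intro powr_diff_mvt) auto
    then obtain t where t: "real (n+N) < t" "t < real (n+N+1)"
        and eq: "real (n+N+1) powr (-x) - real (n+N) powr (-x) = -x * t powr (-x-1)"
      by auto
    have "real (n+N+1) powr (-x-1) \<le> t powr (-x-1)"
      using t assms by (intro powr_mono2') auto
    moreover have "f n - f (Suc n) = t powr (-x-1)"
      using eq assms by (simp add: f_def field_simps)
    moreover have "-x-1 = -1-x" by simp
    ultimately show ?thesis by metis
  qed
  have f0: "f \<longlonglongrightarrow> 0" unfolding f_def using assms by real_asymp
  have sf: "(\<lambda>n. f n - f (Suc n)) sums f 0"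
    using telescope_sums'[OF f0] by simp
  show s: "summable (\<lambda>n. real (n + N + 1) powr (-1-x))"
    by (rule summable_comparison_test'[OF sums_summable[OF sf], of 0]) (use le in auto)
  have "(\<Sum>n. real (n + N + 1) powr (-1-x)) \<le> f 0"
    using suminf_le[OF le s sums_summable[OF sf]] sums_unique[OF sf] by simp
  thus "(\<Sum>n. real (n + N + 1) powr (-1-x)) \<le> real N powr (-x) / x"
    by (simp add: f_def)
qed

text \<open>Comparison with telescoping differences of t^y / y; its direction depends on whether
  t^(y - 1) grows or decays. In the growing case the last term is kept apart, which accounts for the
  summand 1 / N. This bounds the partial sums to the left of the imaginary axis.\<close>

lemma sum_powr_le:
  fixes y :: real
  assumes "y > 0" "N \<ge> (1::nat)"
  shows "(\<Sum>n<N. real (Suc n) powr (y-1)) \<le> real N powr y * (1 / real N + 1 / y)"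
proof -
  have mvt: "\<exists>t. real n < t \<and> t < real (Suc n) \<and> real (Suc n) powr y - real n powr y = y * t powr (y-1)"
    if "n \<ge> 1" for n
    using powr_diff_mvt[of "real n" "real (Suc n)" y] that by auto
  have "(\<Sum>n<N. real (Suc n) powr (y-1)) \<le> real N powr (y-1) + real N powr y / y"
  proof (cases "y \<ge> 1")
    case True
    show ?thesis using assms(2)
    proof (induction N rule: dec_induct)
      case base
      show ?case using assms by simp
    next
      case (step n)
      obtain t where t: "real n < t" "t < real (Suc n)" "real (Suc n) powr y - real n powr y = y * t powr (y-1)"
        using mvt step by blast
      have "real n powr (y-1) \<le> t powr (y-1)"
        using t True by (intro powr_mono2) auto
      also have "\<dots> = real (Suc n) powr y / y - real n powr y / y"
        using t assms by (simp add: field_simps)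
      finally show ?case using step by simp
    qed
  next
    case False
    have "(\<Sum>n<N. real (Suc n) powr (y-1)) \<le> real N powr y / y"
      using assms(2)
    proof (induction N rule: dec_induct)
      case base
      show ?case using assms False by simp
    next
      case (step n)
      obtain t where t: "real n < t" "t < real (Suc n)" "real (Suc n) powr y - real n powr y = y * t powr (y-1)"
        using mvt step by blast
      have "real (Suc n) powr (y-1) \<le> t powr (y-1)"
        using t False by (intro powr_mono2') auto
      also have "\<dots> = real (Suc n) powr y / y - real n powr y / y"
        using t assms by (simp add: field_simps)
      finally show ?case using step by simp
    qed
    thus ?thesis by (smt (verit) powr_ge_zero)
  qed
  also have "real N powr (y-1) = real N powr y / real N"
    using assms by (simp add: powr_diff)
  finally show ?thesis by (simp add: algebra_simps)
qed

text \<open>\<open>circlepath\<close> runs through the angles 0 to 2 pi, whereas the right half arc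
  runs from -pi/2 to pi/2, so the fourth quadrant has to be moved by a full turn.\<close>

lemma contour_integral_circlepath_halves:
  fixes f :: "complex \<Rightarrow> complex"
  assumes "continuous_on (sphere 0 R) f" "R > 0"
  shows "contour_integral (circlepath 0 R) f =
    contour_integral (part_circlepath 0 R (-pi/2) (pi/2)) f +
    contour_integral (part_circlepath 0 R (pi/2) (3*pi/2)) f"
proof -
  define h where "h t = f (0 + of_real R * cis t) * of_real R * \<i> * cis t" for t
  have "continuous_on UNIV (\<lambda>t. f (of_real R * cis t))"
    by (rule continuous_on_compose2[OF assms(1)])
       (use assms(2) in \<open>auto intro!: continuous_intros simp: norm_mult\<close>)
  hence "continuous_on UNIV h"
    unfolding h_def by (auto intro!: continuous_intros)
  hence int: "h integrable_on {s..t}" for s t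
    by (intro integrable_continuous_real) (auto intro: continuous_on_subset)
  have ci: "contour_integral (part_circlepath 0 R s t) f = integral {s..t} h" if "s < t" for s t
    using contour_integral_part_circlepath_eq[OF that, of 0 R f] unfolding h_def by simp
  have "part_circlepath 0 R (3*pi/2) (2*pi) = part_circlepath 0 R (-pi/2) 0"
  proof
    fix x :: real
    have l: "linepath (3*pi/2) (2*pi) x = linepath (-pi/2) 0 x + 2*pi"
      by (simp add: linepath_def field_simps)
    have "exp (\<i> * complex_of_real (y + 2*pi)) = exp (\<i> * complex_of_real y)" for y
      by (simp add: distrib_left exp_add mult.commute)
    thus "part_circlepath 0 R (3*pi/2) (2*pi) x = part_circlepath 0 R (-pi/2) 0 x"
      unfolding part_circlepath_def l by simp
  qed
  hence e: "integral {3*pi/2..2*pi} h = integral {-pi/2..0} h"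
    using ci[of "3*pi/2" "2*pi"] ci[of "-pi/2" 0] by simp
  have "integral {0..2*pi} h = integral {0..pi/2} h + integral {pi/2..2*pi} h"
    by (rule Henstock_Kurzweil_Integration.integral_combine[symmetric]) (auto intro: int)
  also have "integral {pi/2..2*pi} h = integral {pi/2..3*pi/2} h + integral {3*pi/2..2*pi} h"
    by (rule Henstock_Kurzweil_Integration.integral_combine[symmetric]) (auto intro: int)
  also have "integral {0..pi/2} h + (integral {pi/2..3*pi/2} h + integral {3*pi/2..2*pi} h)
     = (integral {-pi/2..0} h + integral {0..pi/2} h) + integral {pi/2..3*pi/2} h"
    using e by simp
  also have "integral {-pi/2..0} h + integral {0..pi/2} h = integral {-pi/2..pi/2} h"
    by (rule Henstock_Kurzweil_Integration.integral_combine) (auto intro: int)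
  finally show ?thesis
    unfolding circlepath_def by (subst (1 2 3) ci) auto
qed

text \<open>Along the segment Re z falls linearly from 0 to -d, so |exp(L z)| = exp(-d L u), and
  integrating over u gives at most 1 / (d L). With L = ln N this is the part of the error that
  decays like 1 / ln N.\<close>

lemma norm_contour_integral_segment_exp_le:
  assumes b: "Re b = 0" and "d > 0" "L > 0"
    and k: "continuous_on (closed_segment b (of_real (-d))) k"
    and M: "\<And>z. z \<in> closed_segment b (of_real (-d)) \<Longrightarrow> norm (k z) \<le> M"
  shows "norm (contour_integral (linepath b (of_real (-d))) (\<lambda>z. k z * exp (of_real L * z)))
          \<le> M * norm (of_real (-d) - b) / (d * L)"
proof -
  let ?c = "of_real (-d) :: complex"
  have M0: "M \<ge> 0" using M[of b] norm_ge_zero[of "k b"] by (meson ends_in_segment(1) order_trans)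
  have "((\<lambda>u. exp (- d * L * u)) has_integral (exp (-d*L*1)/(-d*L) - exp (-d*L*0)/(-d*L))) {0..1}"
    using assms
    by (intro fundamental_theorem_of_calculus)
       (auto intro!: derivative_eq_intros simp: has_real_derivative_iff_has_vector_derivative[symmetric])
  note hi = has_integral_mult_right[OF this, of "M * norm (?c - b)"]
  have "contour_integral (linepath b ?c) (\<lambda>z. k z * exp (of_real L * z)) =
     integral {0..1} (\<lambda>x. k (linepath b ?c x) * exp (of_real L * linepath b ?c x) * (?c - b))"
    by (simp add: contour_integral_integral)
  also have "norm \<dots> \<le> integral {0..1} (\<lambda>u. M * norm (?c - b) * exp (- d * L * u))"
  proof (rule integral_norm_bound_integral)
    have "(\<lambda>z. k z * exp (of_real L * z)) contour_integrable_on linepath b ?c"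
      by (intro contour_integrable_continuous_linepath continuous_intros k)
    thus "(\<lambda>x. k (linepath b ?c x) * exp (of_real L * linepath b ?c x) * (?c - b)) integrable_on {0..1}"
      by (simp add: contour_integrable_on)
    show "(\<lambda>u. M * norm (?c - b) * exp (- d * L * u)) integrable_on {0..1}"
      using hi by blast
    fix u :: real assume u: "u \<in> {0..1}"
    have "linepath b ?c u \<in> closed_segment b ?c"
      using u by (simp add: linepath_in_path)
    hence "norm (k (linepath b ?c u)) \<le> M" by (rule M)
    moreover have "norm (exp (of_real L * linepath b ?c u)) = exp (-d*L*u)"
      using b by (simp add: linepath_def algebra_simps)
    ultimately have "norm (k (linepath b ?c u)) * norm (exp (of_real L * linepath b ?c u)) * norm (?c - b)
       \<le> M * exp (-d*L*u) * norm (?c - b)"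
      using M0 by (intro mult_mono) auto
    thus "norm (k (linepath b ?c u) * exp (of_real L * linepath b ?c u) * (?c - b))
           \<le> M * norm (?c - b) * exp (-d*L*u)"
      by (simp only: norm_mult mult_ac)
  qed
  also have "\<dots> = M * norm (?c - b) * (exp (-d*L*1)/(-d*L) - exp (-d*L*0)/(-d*L))"
    using hi by blast
  also have "\<dots> \<le> M * norm (?c - b) * (1/(d*L))"
    using assms M0 by (intro mult_left_mono) (auto simp: field_simps)
  finally show ?thesis by simp
qed

text \<open>Cauchy's formula gives the partial sum at 0 as an integral of S(z) N^z (1 + z^2/R^2) / z
  over |z| = R. On the right arc S is replaced by g at the cost of the tail, and the part with g is
  moved into the left half plane, where it is O(1 / ln N). On the left arc S is estimated directly.
  Tail and left arc together account for A (2 / R + 1 / N).\<close>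

lemma newman_aux:
  fixes a :: "nat \<Rightarrow> complex"
  assumes A: "\<And>n. norm (a n) \<le> A" and "d > 0" "R > 0"
    and g: "g holomorphic_on {z. Re z > -d \<and> \<bar>Im z\<bar> < R + d}" and g0: "g 0 = 0"
    and sums: "\<And>z. Re z > 0 \<Longrightarrow> (\<lambda>n. a n * of_nat (Suc n) powr (-1-z)) sums g z"
  shows "\<exists>C. \<forall>N\<ge>2. norm (\<Sum>n<N. a n / of_nat (Suc n)) \<le> A * (2 / R + 1 / real N) + C / ln (real N)"
proof -
  define D where "D = {z. Re z > -d \<and> \<bar>Im z\<bar> < R + d}"
  have D_eq: "D = {z. Re z > -d} \<inter> ({z. Im z < R + d} \<inter> {z. Im z > - (R+d)})"
    by (auto simp: D_def abs_less_iff)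
  have openD: "open D" and convD: "convex D"
    unfolding D_eq
    by (intro open_Int open_halfspace_Re_gt open_halfspace_Im_lt open_halfspace_Im_gt
        convex_Int convex_halfspace_Re_gt convex_halfspace_Im_lt convex_halfspace_Im_gt)+
  \<comment> \<open>As g vanishes at 0, \<open>h\<close> is the holomorphic continuation of g(z) /
    z. Replacing S by g thus removes the pole of the kernel, and the contour can be shifted without
    a residue.\<close>
  define h where "h = (\<lambda>z. if z = 0 then deriv g 0 else (g z - g 0) / (z - 0))"
  have holh: "h holomorphic_on D"
    unfolding h_def by (rule pole_lemma_open[OF g[folded D_def] openD])
  have gh: "g z = z * h z" for z by (simp add: h_def g0)
  define \<delta> where "\<delta> = d / 2"
  have \<delta>: "\<delta> > 0" "\<delta> < d" using assms by (auto simp: \<delta>_def)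
  define c where "c = complex_of_real (-\<delta>)"
  define k where "k z = h z * (1 + z\<^sup>2 / of_real (R\<^sup>2))" for z
  have holk: "k holomorphic_on D" unfolding k_def using \<open>R > 0\<close>
    by (intro holomorphic_intros holh) auto
  have pts: "\<i> * R \<in> D" "- \<i> * R \<in> D" "c \<in> D"
    using assms \<delta> by (auto simp: D_def c_def)
  have seg: "closed_segment (\<i> * R) c \<subseteq> D" "closed_segment (- \<i> * R) c \<subseteq> D"
    by (intro closed_segment_subset pts convD)+
  have contk: "continuous_on D k" using holk by (rule holomorphic_on_imp_continuous_on)
  obtain M1 where M1: "\<And>z. z \<in> closed_segment (\<i> * R) c \<Longrightarrow> norm (k z) \<le> M1"
    using compact_imp_bounded[OF compact_continuous_image[OF continuous_on_subset[OF contk seg(1)] compact_segment]]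
    by (auto simp: bounded_iff)
  obtain M2 where M2: "\<And>z. z \<in> closed_segment (- \<i> * R) c \<Longrightarrow> norm (k z) \<le> M2"
    using compact_imp_bounded[OF compact_continuous_image[OF continuous_on_subset[OF contk seg(2)] compact_segment]]
    by (auto simp: bounded_iff)
  define Cp where "Cp = part_circlepath 0 R (-pi/2) (pi/2)"
  define Cm where "Cm = part_circlepath 0 R (pi/2) (3*pi/2)"
  have pip: "norm z = R \<and> Re z \<ge> 0" if "z \<in> path_image Cp" for z
  proof -
    obtain t where "-pi/2 \<le> t" "t \<le> pi/2" "z = R * cis t"
      using \<open>z \<in> path_image Cp\<close> by (auto simp: Cp_def path_image_part_circlepath cis_conv_exp)
    thus ?thesis
      using \<open>R > 0\<close> cos_ge_zero[of t] by (auto simp: norm_mult)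
  qed
  have pim: "norm z = R \<and> Re z \<le> 0" if "z \<in> path_image Cm" for z
  proof -
    obtain t where t: "pi/2 \<le> t" "t \<le> 3*pi/2" "z = R * cis t"
      using \<open>z \<in> path_image Cm\<close> by (auto simp: Cm_def path_image_part_circlepath cis_conv_exp)
    have "cos t = - cos (t - pi)" by (simp add: cos_diff)
    moreover have "cos (t - pi) \<ge> 0" using t by (intro cos_ge_zero) auto
    ultimately show ?thesis
      using \<open>R > 0\<close> t(3) by (auto simp: norm_mult mult_nonneg_nonpos)
  qed
  have CpD: "path_image Cp \<subseteq> D"
    unfolding D_def using \<open>d > 0\<close> pip by (fastforce intro: le_less_trans[OF abs_Im_le_cmod])
  have A0: "A \<ge> 0" using A[of 0] norm_ge_zero order_trans by blast
  define C where "C = (M1 * norm (c - \<i> * R) / \<delta> + M2 * norm (c - (- \<i> * R)) / \<delta>) / (2 * pi)"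
  have "norm (\<Sum>n<N. a n / of_nat (Suc n)) \<le> A * (2 / R + 1 / real N) + C / ln (real N)"
    if N: "N \<ge> 2" for N
  proof -
    define L where "L = ln (real N)"
    have L: "L > 0" using N by (auto simp: L_def)
    have expL: "exp (L * x) = real N powr x" for x
      using N by (simp add: L_def powr_def mult.commute)
    define S where "S z = (\<Sum>n<N. a n * of_nat (Suc n) powr (-1-z))" for z
    have S0: "S 0 = (\<Sum>n<N. a n / of_nat (Suc n))"
      unfolding S_def by (intro sum.cong refl) (simp add: powr_minus field_simps del: of_nat_Suc)
    have holS: "S holomorphic_on B" for B
      unfolding S_def by (intro holomorphic_intros) (simp del: of_nat_Suc)
    define E :: "complex \<Rightarrow> complex" where "E z = exp (of_real L * z) * (1 + z\<^sup>2 / of_real (R\<^sup>2))" for z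
    have holE: "E holomorphic_on B" for B
      unfolding E_def using \<open>R > 0\<close> by (intro holomorphic_intros) auto
    \<comment> \<open>On the circle R^2 = z * cnj z, hence 1 + z^2/R^2 = 2 z Re z / R^2. The factor
      |Re z| compensates the 1 / |Re z| in both estimates for the Dirichlet series.\<close>
    have normE: "norm (E z / z) = real N powr Re z * (2 * \<bar>Re z\<bar> / R\<^sup>2)" if "norm z = R" for z
    proof -
      have z0: "z \<noteq> 0" using that \<open>R > 0\<close> by auto
      have "z * cnj z = of_real (R\<^sup>2)" using that by (simp add: complex_norm_square[symmetric])
      hence "1 + z\<^sup>2 / of_real (R\<^sup>2) = z * (cnj z + z) / of_real (R\<^sup>2)"
        using \<open>R > 0\<close> by (simp add: field_simps power2_eq_square)
      hence "E z / z = exp (of_real L * z) * ((cnj z + z) / of_real (R\<^sup>2))"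
        using z0 by (simp add: E_def)
      also have "cnj z + z = of_real (2 * Re z)"
        by (simp add: complex_eq_iff)
      finally show ?thesis using \<open>R > 0\<close>
        by (simp add: norm_mult norm_divide expL norm_power)
    qed
    have cSE: "continuous_on (sphere 0 R) (\<lambda>z. S z * E z / z)"
      using \<open>R > 0\<close> by (intro holomorphic_on_imp_continuous_on holomorphic_intros holS holE) auto
    have "((\<lambda>u. (S u * E u) / (u - 0)) has_contour_integral (2 * of_real pi * \<i> * (S 0 * E 0))) (circlepath 0 R)"
      by (rule Cauchy_integral_circlepath_simple) (auto intro!: holomorphic_intros holS holE \<open>R > 0\<close>)
    hence full: "contour_integral (circlepath 0 R) (\<lambda>u. S u * E u / u) = 2 * of_real pi * \<i> * S 0"
      using contour_integral_unique by (simp add: E_def)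
    have halves: "2 * of_real pi * \<i> * S 0 = contour_integral Cp (\<lambda>u. S u * E u / u) + contour_integral Cm (\<lambda>u. S u * E u / u)"
      using contour_integral_circlepath_halves[OF cSE \<open>R > 0\<close>] full unfolding Cp_def Cm_def by simp
    have cC: "(\<lambda>u. S u * E u / u) contour_integrable_on Cp" "(\<lambda>u. S u * E u / u) contour_integrable_on Cm"
      unfolding Cp_def Cm_def
      by (intro contour_integrable_continuous_part_circlepath continuous_on_subset[OF cSE];
          use pip pim \<open>R > 0\<close> in \<open>auto simp: Cp_def Cm_def\<close>)+
    \<comment> \<open>\<open>g u * E u / u = k u * exp (L u)\<close> is holomorphic on the convex set \<open>D\<close>, so the integral over
      the right arc equals the one over two segments reaching into the left half plane.\<close>
    define F where "F z = k z * exp (of_real L * z)" for z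
    have gF: "g u * E u / u = F u" if "u \<noteq> 0" for u
      using that by (simp add: gh F_def E_def k_def)
    have holF: "F holomorphic_on D" unfolding F_def by (intro holomorphic_intros holk)
    define \<gamma> where "\<gamma> = linepath (\<i> * R) c +++ linepath c (- \<i> * R)"
    have ends: "pathstart Cp = - \<i> * R" "pathfinish Cp = \<i> * R"
      unfolding Cp_def by (simp_all add: complex_eq_iff Re_exp Im_exp)
    have "(F has_contour_integral 0) (Cp +++ \<gamma>)"
    proof (rule Cauchy_theorem_convex_simple[OF holF convD])
      show "valid_path (Cp +++ \<gamma>)" unfolding \<gamma>_def
        using ends by (auto intro!: valid_path_join simp: Cp_def)
      show "path_image (Cp +++ \<gamma>) \<subseteq> D"
        unfolding \<gamma>_def using CpD seg ends 
        by (auto simp: path_image_join closed_segment_commute)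
      show "pathfinish (Cp +++ \<gamma>) = pathstart (Cp +++ \<gamma>)"
        unfolding \<gamma>_def using ends by simp
    qed
    have contF: "continuous_on D F" using holF by (rule holomorphic_on_imp_continuous_on)
    have iF: "F contour_integrable_on Cp" "F contour_integrable_on linepath (\<i> * R) c"
       "F contour_integrable_on linepath c (- \<i> * R)"
      using CpD seg contF unfolding Cp_def
      by (auto intro!: contour_integrable_continuous_part_circlepath contour_integrable_continuous_linepath
          intro: continuous_on_subset simp: closed_segment_commute)
    have "0 = contour_integral (Cp +++ \<gamma>) F"
      using \<open>(F has_contour_integral 0) (Cp +++ \<gamma>)\<close> by (simp add: contour_integral_unique)
    also have "\<dots> = contour_integral Cp F + (contour_integral (linepath (\<i> * R) c) F + contour_integral (linepath c (- \<i> * R)) F)"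
      unfolding \<gamma>_def using iF ends by (subst contour_integral_join | simp add: Cp_def valid_path_join)+
    also have "contour_integral (linepath c (- \<i> * R)) F = - contour_integral (linepath (- \<i> * R) c) F"
      using contour_integral_reverse_linepath[of "- \<i> * R" c F] contF seg 
      by (simp add: continuous_on_subset contour_integral_reversepath)
    finally have Feq: "contour_integral Cp F = contour_integral (linepath (- \<i> * R) c) F - contour_integral (linepath (\<i> * R) c) F"
      by (simp add: algebra_simps eq_neg_iff_add_eq_0)
    have b1: "norm (contour_integral (linepath (\<i> * R) c) F) \<le> M1 * norm (c - \<i> * R) / (\<delta> * L)"
      unfolding F_def c_def
      by (intro norm_contour_integral_segment_exp_le \<delta> L continuous_on_subset[OF contk])
         (use seg M1 in \<open>auto simp: c_def\<close>)
    have b2: "norm (contour_integral (linepath (- \<i> * R) c) F) \<le> M2 * norm (c - (- \<i> * R)) / (\<delta> * L)"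
      unfolding F_def c_def
      by (intro norm_contour_integral_segment_exp_le \<delta> L continuous_on_subset[OF contk])
         (use seg M2 in \<open>auto simp: c_def\<close>)
    have "norm (contour_integral Cp F) \<le> C * (2 * pi) / L"
    proof -
      have "C * (2 * pi) / L = M1 * norm (c - \<i> * R) / (\<delta> * L) + M2 * norm (c - (- \<i> * R)) / (\<delta> * L)"
      proof -
        have "(x / \<delta> + y / \<delta>) / (2 * pi) * (2 * pi) / L = x / (\<delta> * L) + y / (\<delta> * L)" for x y :: real
          using \<delta> L by (simp add: field_simps)
        thus ?thesis unfolding C_def .
      qed
      thus ?thesis
        unfolding Feq using norm_triangle_ineq4[of "contour_integral (linepath (- \<i> * R) c) F" "contour_integral (linepath (\<i> * R) c) F"]
          b1 b2 by linarith
    qed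
    note bF = this
    \<comment> \<open>Left arc: N^y from the partial sum cancels N^(-y) from the kernel, and y \<le>
      R bounds what remains. Points with Re u = 0 are treated apart: there the kernel vanishes,
      while the bound for S has y in a denominator.\<close>
    have bm: "norm (contour_integral Cm (\<lambda>u. S u * E u / u)) \<le> (A * (2 / R\<^sup>2 + 2 / (R * N))) * R * \<bar>3*pi/2 - pi/2\<bar>"
      unfolding Cm_def
    proof (rule contour_integral_bound_part_circlepath)
      fix u assume "u \<in> path_image (part_circlepath 0 R (pi/2) (3*pi/2))"
      hence u: "norm u = R" "Re u \<le> 0" using pim by (auto simp: Cm_def)
      show "norm (S u * E u / u) \<le> A * (2 / R\<^sup>2 + 2 / (R * N))"
      proof (cases "Re u = 0")
        case True
        hence "norm (E u / u) = 0" using normE[OF u(1)] by simp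
        hence eq0: "S u * E u / u = 0" by auto
        show ?thesis unfolding eq0 using A0 \<open>R > 0\<close> by simp
      next
        case False
        define y where "y = - Re u"
        have y: "y > 0" "y \<le> R" using False u abs_Re_le_cmod[of u] by (auto simp: y_def)
        have "norm (S u) \<le> (\<Sum>n<N. A * real (Suc n) powr (y - 1))"
          unfolding S_def
        proof (rule sum_norm_le)
          fix n
          have "norm (of_nat (Suc n) powr (-1-u) :: complex) = real (Suc n) powr (y - 1)"
            unfolding y_def diff_conv_add_uminus add.commute[of "- Re u"]
            by (simp add: norm_powr_real_powr del: of_nat_Suc)
          thus "norm (a n * of_nat (Suc n) powr (-1-u)) \<le> A * real (Suc n) powr (y-1)"
            using A[of n] by (simp add: norm_mult mult_right_mono del: of_nat_Suc)
        qed
        also have "\<dots> \<le> A * (real N powr y * (1 / real N + 1 / y))"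
          unfolding sum_distrib_left[symmetric] using sum_powr_le[OF y(1), of N] N A0
          by (intro mult_left_mono) auto
        finally have "norm (S u) * norm (E u / u) \<le> A * (real N powr y * (1 / real N + 1 / y)) * (real N powr (-y) * (2 * y / R\<^sup>2))"
        proof (rule mult_mono)
          show "norm (E u / u) \<le> real N powr (-y) * (2 * y / R\<^sup>2)"
            using normE[OF u(1)] u(2) by (simp add: y_def)
          show "0 \<le> A * (real N powr y * (1 / real N + 1 / y))"
            using A0 y by simp
        qed auto
        also have "\<dots> = A * (2 / R\<^sup>2 + y * (2 / (R\<^sup>2 * N)))"
          using y N \<open>R > 0\<close> by (simp add: powr_minus field_simps)
        also have "\<dots> \<le> A * (2 / R\<^sup>2 + R * (2 / (R\<^sup>2 * N)))"
          using y A0 \<open>R > 0\<close> by (intro mult_left_mono add_left_mono mult_right_mono) auto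
        also have "R * (2 / (R\<^sup>2 * N)) = 2 / (R * N)" using \<open>R > 0\<close> by (simp add: power2_eq_square)
        finally show ?thesis by (simp add: norm_mult norm_divide)
      qed
    qed (use cC A0 \<open>R > 0\<close> in \<open>auto simp: Cm_def\<close>)
    \<comment> \<open>Right arc: the tail is at most A N^(-x) / x and the kernel is N^x * 2 x / R^2,
      so the product depends neither on N nor on x.\<close>
    have bp: "norm (contour_integral Cp (\<lambda>u. F u - S u * E u / u)) \<le> (A * (2 / R\<^sup>2)) * R * \<bar>pi/2 - (-pi/2)\<bar>"
      unfolding Cp_def
    proof (rule contour_integral_bound_part_circlepath)
      fix u assume "u \<in> path_image (part_circlepath 0 R (-pi/2) (pi/2))"
      hence u: "norm u = R" "Re u \<ge> 0" using pip by (auto simp: Cp_def)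
      have u0: "u \<noteq> 0" using u \<open>R > 0\<close> by auto
      have eq: "F u - S u * E u / u = (g u - S u) * (E u / u)"
        using gF[OF u0] by (simp add: algebra_simps diff_divide_distrib)
      show "norm (F u - S u * E u / u) \<le> A * (2 / R\<^sup>2)"
      proof (cases "Re u = 0")
        case True
        hence "norm (E u / u) = 0" using normE[OF u(1)] by simp
        thus ?thesis unfolding eq norm_mult using A0 \<open>R > 0\<close> by (metis divide_nonneg_nonneg mult_nonneg_nonneg mult_zero_right zero_le_numeral zero_le_power2)
      next
        case False
        define x where "x = Re u"
        have x: "x > 0" using False u by (auto simp: x_def)
        have sm: "(\<lambda>n. a n * of_nat (Suc n) powr (-1-u)) sums g u" using sums[of u] x by (simp add: x_def)
        have tl: "(\<lambda>n. a (n+N) * of_nat (Suc (n+N)) powr (-1-u)) sums (g u - S u)"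
          unfolding S_def using sums_split_initial_segment[OF sm, of N] by simp
        have le: "norm (a (n+N) * of_nat (Suc (n+N)) powr (-1-u)) \<le> A * real (n+N+1) powr (-1-x)" for n
        proof -
          have "norm (of_nat (Suc (n+N)) powr (-1-u) :: complex) = real (n+N+1) powr (-1-x)"
            by (simp add: x_def norm_powr_real_powr del: of_nat_Suc)
          thus ?thesis
            using A[of "n+N"] by (simp add: norm_mult mult_right_mono del: of_nat_Suc)
        qed
        have sm2: "summable (\<lambda>n. A * real (n+N+1) powr (-1-x))"
          using powr_tail(1)[OF x, of N] N by (intro summable_mult) auto
        have "norm (g u - S u) \<le> (\<Sum>n. A * real (n+N+1) powr (-1-x))"
          using norm_suminf_le[OF le sm2] sums_unique[OF tl] by simp
        also have "\<dots> = A * (\<Sum>n. real (n+N+1) powr (-1-x))"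
          using powr_tail(1)[OF x, of N] N by (intro suminf_mult) auto
        also have "\<dots> \<le> A * (real N powr (-x) / x)"
          using powr_tail(2)[OF x, of N] N A0 by (intro mult_left_mono) auto
        finally have "norm (g u - S u) * norm (E u / u) \<le> A * (real N powr (-x) / x) * (real N powr x * (2 * x / R\<^sup>2))"
        proof (rule mult_mono)
          show "norm (E u / u) \<le> real N powr x * (2 * x / R\<^sup>2)"
            using normE[OF u(1)] u(2) by (simp add: x_def)
          show "0 \<le> A * (real N powr (-x) / x)"
            using A0 x by simp
        qed auto
        also have "\<dots> = A * (2 / R\<^sup>2)"
          using x N \<open>R > 0\<close> by (simp add: powr_minus field_simps)
        finally show ?thesis unfolding eq norm_mult .
      qed
    qed (use cC iF A0 \<open>R > 0\<close> in \<open>auto simp: Cp_def intro!: contour_integrable_diff\<close>)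
    have "contour_integral Cp (\<lambda>u. F u - S u * E u / u) = contour_integral Cp F - contour_integral Cp (\<lambda>u. S u * E u / u)"
      using iF cC by (intro contour_integral_diff) auto
    hence "2 * of_real pi * \<i> * S 0 = contour_integral Cp F - contour_integral Cp (\<lambda>u. F u - S u * E u / u) + contour_integral Cm (\<lambda>u. S u * E u / u)"
      using halves by simp
    hence "norm (2 * of_real pi * \<i> * S 0) \<le> norm (contour_integral Cp F) + norm (contour_integral Cp (\<lambda>u. F u - S u * E u / u)) + norm (contour_integral Cm (\<lambda>u. S u * E u / u))"
      by (metis (no_types, lifting) add_mono_thms_linordered_semiring(3) norm_triangle_ineq norm_triangle_ineq4 order_trans)
    also have "\<dots> \<le> C * (2 * pi) / L + (A * (2 / R\<^sup>2)) * R * pi + (A * (2 / R\<^sup>2 + 2 / (R * N))) * R * pi"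
    proof -
      have "\<bar>pi/2 - (-pi/2)\<bar> = pi" "\<bar>3*pi/2 - pi/2\<bar> = pi" by auto
      thus ?thesis using bF bp bm by simp
    qed
    also have "\<dots> = 2 * pi * (A * (2 / R + 1 / real N) + C / L)"
      using \<open>R > 0\<close> N L by (simp add: field_simps power2_eq_square)
    finally have "2 * pi * norm (S 0) \<le> 2 * pi * (A * (2 / R + 1 / real N) + C / L)"
      by (simp add: norm_mult)
    hence "norm (S 0) \<le> A * (2 / R + 1 / real N) + C / L" by simp
    thus ?thesis unfolding S0 L_def .
  qed
  thus ?thesis by blast
qed


text \<open>Since 1 to any power is 1, changing the coefficient at n = 0 by \<open>g 0\<close>
  subtracts the constant \<open>g 0\<close> from the sum; this reduces to a function vanishing at 0.
  The radius R is chosen first, to make A' / R small, and N afterwards.\<close>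

theorem newman_tauberian:
  fixes a :: "nat \<Rightarrow> complex"
  assumes A: "\<And>n. norm (a n) \<le> A"
    and \<Omega>: "open \<Omega>" "{z. Re z \<ge> 0} \<subseteq> \<Omega>" and g: "g holomorphic_on \<Omega>"
    and sums: "\<And>z. Re z > 0 \<Longrightarrow> (\<lambda>n. a n * of_nat (Suc n) powr (-1-z)) sums g z"
  shows "(\<lambda>n. a n / of_nat (Suc n)) sums g 0"
proof -
  define a' where "a' n = a n - (if n = 0 then g 0 else 0)" for n
  define g' where "g' z = g z - g 0" for z
  define A' where "A' = A + norm (g 0)"
  have A': "norm (a' n) \<le> A'" for n
  proof -
    have "norm (a' n) \<le> norm (a n) + norm (g 0)"
      unfolding a'_def using norm_triangle_ineq4[of "a n" "g 0"] by auto
    thus ?thesis using A[of n] by (simp add: A'_def)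
  qed
  have A'0: "A' \<ge> 0" using A'[of 0] norm_ge_zero order_trans by blast
  have sums': "(\<lambda>n. a' n * of_nat (Suc n) powr (-1-z)) sums g' z" if "Re z > 0" for z
  proof -
    have "(\<lambda>n. a n * of_nat (Suc n) powr (-1-z) - (if n = 0 then g 0 else 0)) sums (g z - g 0)"
      using sums_diff[OF sums[OF that] sums_single[of 0 "\<lambda>_. g 0"]] by simp
    moreover have "a n * of_nat (Suc n) powr (-1-z) - (if n = 0 then g 0 else 0) = a' n * of_nat (Suc n) powr (-1-z)" for n
      by (simp add: a'_def)
    ultimately show ?thesis by (simp add: g'_def)
  qed
  have partial: "(\<Sum>n<N. a' n / of_nat (Suc n)) = (\<Sum>n<N. a n / of_nat (Suc n)) - g 0" if "N \<ge> 1" for N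
  proof -
    have "(\<Sum>n<N. a' n / of_nat (Suc n)) = (\<Sum>n<N. a n / of_nat (Suc n)) - (\<Sum>n<N. if n = 0 then g 0 else 0)"
      unfolding sum_subtractf[symmetric] by (intro sum.cong) (auto simp: a'_def)
    also have "(\<Sum>n<N. if n = 0 then g 0 else 0) = g 0" using that by simp
    finally show ?thesis .
  qed
  have "(\<lambda>N. (\<Sum>n<N. a n / of_nat (Suc n)) - g 0) \<longlonglongrightarrow> 0"
  proof (rule LIMSEQ_I)
    fix e :: real assume e: "e > 0"
    \<comment> \<open>Makes 2 A' / R at most e / 2; the added 1 keeps R positive when A' =
      0.\<close>
    define R where "R = 4 * (A' + 1) / e"
    have R: "R > 0" using e A'0 by (simp add: R_def)
    have "compact (closed_segment (-\<i> * (R+1)) (\<i> * (R+1)))" by simp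
    moreover have seg: "closed_segment (-\<i> * (R+1)) (\<i> * (R+1)) \<subseteq> \<Omega>"
    proof
      fix z assume "z \<in> closed_segment (-\<i> * (R+1)) (\<i> * (R+1))"
      hence "Re z = 0" by (auto simp: in_segment)
      thus "z \<in> \<Omega>" using \<Omega> by auto
    qed
    ultimately obtain \<epsilon> where \<epsilon>: "\<epsilon> > 0" "(\<Union>x\<in>closed_segment (-\<i> * (R+1)) (\<i> * (R+1)). ball x \<epsilon>) \<subseteq> \<Omega>"
      using compact_subset_open_imp_ball_epsilon_subset \<Omega>(1) by metis
    \<comment> \<open>\<open>\<Omega>\<close> need not contain a uniform strip to the left of the
      imaginary axis, but compactness gives one along a bounded segment. The bound 1 keeps |Im z| <
      R + d within that segment.\<close>
    define d where "d = min \<epsilon> 1"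
    have d: "d > 0" using \<epsilon> by (simp add: d_def)
    have "{z. Re z > -d \<and> \<bar>Im z\<bar> < R + d} \<subseteq> \<Omega>"
    proof
      fix z assume "z \<in> {z. Re z > -d \<and> \<bar>Im z\<bar> < R + d}"
      hence z: "Re z > -d" "\<bar>Im z\<bar> < R + d" by auto
      show "z \<in> \<Omega>"
      proof (cases "Re z \<ge> 0")
        case True
        thus ?thesis using \<Omega> by auto
      next
        case False
        define w where "w = \<i> * Im z"
        have "z - w = of_real (Re z)" by (simp add: w_def complex_eq_iff)
        hence "norm (w - z) = \<bar>Re z\<bar>" by (metis norm_minus_commute norm_of_real)
        hence "z \<in> ball w \<epsilon>" using z False by (simp add: dist_norm d_def)
        moreover have "w \<in> closed_segment (-\<i> * (R+1)) (\<i> * (R+1))"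
        proof -
          define u where "u = (Im z + (R+1)) / (2 * (R+1))"
          have "0 \<le> u" "u \<le> 1" using z R by (auto simp: u_def d_def)
          moreover have "Im z + (R+1) = u * (2 * (R+1))"
            by (rule nonzero_divide_eq_eq[THEN iffD1, OF _ u_def[symmetric]]) (use R in simp)
          hence "w = (1 - u) *\<^sub>R (-\<i> * (R+1)) + u *\<^sub>R (\<i> * (R+1))"
            by (simp add: complex_eq_iff w_def algebra_simps)
          ultimately show ?thesis by (auto simp: in_segment)
        qed
        ultimately have "z \<in> (\<Union>x\<in>closed_segment (-\<i> * (R+1)) (\<i> * (R+1)). ball x \<epsilon>)"
          by blast
        thus ?thesis using \<epsilon>(2) by blast
      qed
    qed
    hence "g' holomorphic_on {z. Re z > -d \<and> \<bar>Im z\<bar> < R + d}"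
      unfolding g'_def by (intro holomorphic_intros holomorphic_on_subset[OF g])
    from newman_aux[OF A' d R this _ sums'] obtain C where
      C: "\<And>N. N \<ge> 2 \<Longrightarrow> norm (\<Sum>n<N. a' n / of_nat (Suc n)) \<le> A' * (2 / R + 1 / real N) + C / ln (real N)"
      by (auto simp: g'_def)
    have "(\<lambda>N. A' * (1 / real N) + C / ln (real N)) \<longlonglongrightarrow> 0" by real_asymp
    hence "\<forall>\<^sub>F N in sequentially. A' * (1 / real N) + C / ln (real N) < e / 2"
      using e by (intro order_tendstoD(2)) auto
    hence "\<forall>\<^sub>F N in sequentially. norm ((\<Sum>n<N. a n / of_nat (Suc n)) - g 0 - 0) < e"
      using eventually_ge_at_top[of 2]
    proof eventually_elim
      case (elim N)
      have "A' * 2 / R \<le> e / 2"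
        using e A'0 by (simp add: R_def field_simps)
      moreover have "A' * (2 / R + 1 / real N) = A' * 2 / R + A' * (1 / real N)"
        by (simp add: distrib_left)
      moreover have "norm ((\<Sum>n<N. a n / of_nat (Suc n)) - g 0) \<le> A' * (2 / R + 1 / real N) + C / ln (real N)"
        using C[of N] partial[of N] elim by simp
      ultimately have "norm ((\<Sum>n<N. a n / of_nat (Suc n)) - g 0) < e"
        using elim(1) by linarith
      thus ?case by simp
    qed
    thus "\<exists>no. \<forall>n\<ge>no. norm ((\<Sum>n<n. a n / of_nat (Suc n)) - g 0 - 0) < e"
      by (simp add: eventually_sequentially)
  qed
  thus ?thesis unfolding sums_def by (simp add: LIM_zero_iff)
qed

section \<open>Dirichlet series\<close>

text \<open>Weierstrass's theorem in the form used below: a summable majorant near every point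
  suffices, and the third conclusion provides the termwise differentiation that leads to the
  derivative of zeta.\<close>

lemma holomorphic_on_suminf:
  fixes f :: "nat \<Rightarrow> complex \<Rightarrow> complex"
  assumes "open S" and hol: "\<And>n. f n holomorphic_on S"
    and bound: "\<And>x. x \<in> S \<Longrightarrow> \<exists>d h. d > 0 \<and> summable h \<and> (\<forall>n. \<forall>y\<in>ball x d \<inter> S. norm (f n y) \<le> h n)"
  shows "(\<lambda>z. \<Sum>n. f n z) holomorphic_on S"
    and "\<And>z. z \<in> S \<Longrightarrow> (\<lambda>n. f n z) sums (\<Sum>n. f n z)"
    and "\<And>z. z \<in> S \<Longrightarrow> (\<lambda>n. deriv (f n) z) sums deriv (\<lambda>z. \<Sum>n. f n z) z"
proof -
  have der: "(f n has_field_derivative deriv (f n) x) (at x)" if "x \<in> S" for n x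
    using holomorphic_derivI[OF hol \<open>open S\<close> that] .
  have "\<exists>g g'. \<forall>x \<in> S. ((\<lambda>n. f n x) sums g x) \<and> ((\<lambda>n. deriv (f n) x) sums g' x) \<and> (g has_field_derivative g' x) (at x)"
    by (rule series_and_derivative_comparison_local[OF \<open>open S\<close> der])
       (use bound in \<open>force intro: always_eventually\<close>)+
  then obtain g g' where gg: "\<And>x. x \<in> S \<Longrightarrow> (\<lambda>n. f n x) sums g x"
    "\<And>x. x \<in> S \<Longrightarrow> (\<lambda>n. deriv (f n) x) sums g' x"
    "\<And>x. x \<in> S \<Longrightarrow> (g has_field_derivative g' x) (at x)" by blast
  have eq: "(\<Sum>n. f n x) = g x" if "x \<in> S" for x using gg(1)[OF that] by (simp add: sums_iff)
  have der': "((\<lambda>z. \<Sum>n. f n z) has_field_derivative g' x) (at x)" if "x \<in> S" for x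
    by (rule has_field_derivative_transform_within_open[OF gg(3)[OF that] \<open>open S\<close> that]) (simp add: eq)
  show "(\<lambda>z. \<Sum>n. f n z) holomorphic_on S"
    using der' \<open>open S\<close> by (auto simp: holomorphic_on_open)
  show "(\<lambda>n. f n z) sums (\<Sum>n. f n z)" if "z \<in> S" for z using gg(1)[OF that] eq[OF that] by simp
  show "(\<lambda>n. deriv (f n) z) sums deriv (\<lambda>z. \<Sum>n. f n z) z" if "z \<in> S" for z
    using gg(2)[OF that] DERIV_imp_deriv[OF der'[OF that]] by simp
qed

text \<open>The coefficient \<open>c n\<close> belongs to the integer n + 1, so that no term has
  base 0.\<close>

definition dirichlet :: "(nat \<Rightarrow> complex) \<Rightarrow> complex \<Rightarrow> complex" where
  "dirichlet c s = (\<Sum>n. c n * of_nat (Suc n) powr (-s))"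

lemma norm_dirichlet_term: "norm (c * of_nat (Suc n) powr (-s)) = norm c * real (Suc n) powr (- Re s)"
  for c :: complex
  by (simp add: norm_mult norm_powr_real_powr del: of_nat_Suc)

text \<open>A ball around x whose radius is half the distance to the line Re s =
  \<open>\<sigma>0\<close> stays to the right of the abscissa \<open>\<sigma>0 + d\<close>, so the
  absolutely convergent series at that abscissa is a majorant.\<close>

lemma dirichlet_holomorphic:
  assumes sm: "\<And>\<sigma>. \<sigma> > \<sigma>0 \<Longrightarrow> summable (\<lambda>n. norm (c n) * real (Suc n) powr (-\<sigma>))"
  shows "dirichlet c holomorphic_on {s. Re s > \<sigma>0}"
    and "\<And>s. Re s > \<sigma>0 \<Longrightarrow> (\<lambda>n. c n * of_nat (Suc n) powr (-s)) sums dirichlet c s"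
    and "\<And>s. Re s > \<sigma>0 \<Longrightarrow> (\<lambda>n. - of_real (ln (real (Suc n))) * c n * of_nat (Suc n) powr (-s)) sums deriv (dirichlet c) s"
proof -
  let ?f = "\<lambda>n s. c n * of_nat (Suc n) powr (-s) :: complex"
  have der: "(?f n has_field_derivative - of_real (ln (real (Suc n))) * c n * of_nat (Suc n) powr (-s)) (at s)" for n s
  proof -
    have "((\<lambda>s. of_nat (Suc n) powr (-s)) has_field_derivative (Ln (of_nat (Suc n)) * of_nat (Suc n) powr (-s)) * (-1)) (at s)"
      by (rule DERIV_chain2[OF has_field_derivative_powr_right])
         (auto intro!: derivative_eq_intros simp del: of_nat_Suc)
    from DERIV_cmult[OF this, of "c n"] show ?thesis
      by (simp add: Ln_of_nat mult_ac del: of_nat_Suc)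
  qed
  have hol: "?f n holomorphic_on S" for n S by (intro holomorphic_intros) (simp del: of_nat_Suc)
  have open': "open {s. Re s > \<sigma>0}" by (rule open_halfspace_Re_gt)
  have b: "\<exists>d h. d > 0 \<and> summable h \<and> (\<forall>n. \<forall>y\<in>ball x d \<inter> {s. Re s > \<sigma>0}. norm (?f n y) \<le> h n)"
    if "x \<in> {s. Re s > \<sigma>0}" for x
  proof -
    define d where "d = (Re x - \<sigma>0) / 2"
    have "d > 0" using that by (simp add: d_def)
    moreover have "summable (\<lambda>n. norm (c n) * real (Suc n) powr (-(\<sigma>0 + d)))"
      by (rule sm) (use \<open>d > 0\<close> in simp)
    moreover have "norm (?f n y) \<le> norm (c n) * real (Suc n) powr (-(\<sigma>0 + d))" if "y \<in> ball x d" for n y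
    proof -
      have "\<bar>Re x - Re y\<bar> < d" using that abs_Re_le_cmod[of "x - y"] by (simp add: dist_norm)
      moreover have "\<sigma>0 + d = Re x - d" by (simp add: d_def field_simps)
      ultimately have "- Re y \<le> - (\<sigma>0 + d)" by linarith
      thus ?thesis unfolding norm_dirichlet_term by (intro mult_left_mono powr_mono) auto
    qed
    ultimately show ?thesis by blast
  qed
  note * = holomorphic_on_suminf[OF open' hol b]
  show "dirichlet c holomorphic_on {s. Re s > \<sigma>0}" using *(1) unfolding dirichlet_def .
  show "(\<lambda>n. c n * of_nat (Suc n) powr (-s)) sums dirichlet c s" if "Re s > \<sigma>0" for s
    using *(2)[of s] that unfolding dirichlet_def by simp
  show "(\<lambda>n. - of_real (ln (real (Suc n))) * c n * of_nat (Suc n) powr (-s)) sums deriv (dirichlet c) s"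
    if "Re s > \<sigma>0" for s
    using *(3)[of s] that DERIV_imp_deriv[OF der] unfolding dirichlet_def by simp
qed

text \<open>First-order Taylor expansion along the segment from n to n + 1; because of Re p \<le> 2
  the second derivative p (p - 1) z^(p - 2) is largest in modulus at n. The gain of two powers of n
  later yields convergence beyond the line Re s = 1.\<close>

lemma powr_taylor_bound:
  fixes p :: complex
  assumes "Re p \<le> 2" "n \<ge> (1::nat)"
  shows "norm (of_nat (Suc n) powr p - of_nat n powr p - p * of_nat n powr (p - 1))
    \<le> norm p * norm (p - 1) * real n powr (Re p - 2)"
proof -
  define f where "f i z = (if i = 0 then z powr p else if i = 1 then p * z powr (p-1)
     else p * (p - 1) * z powr (p - 2))" for i :: nat and z :: complex
  let ?S = "closed_segment (of_nat n) (of_nat (Suc n)) :: complex set"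
  have S: "\<exists>x. z = of_real x \<and> real n \<le> x" if "z \<in> ?S" for z
  proof -
    from that obtain u where u: "0 \<le> u" "z = (1 - u) *\<^sub>R of_nat n + u *\<^sub>R of_nat (Suc n)"
      by (auto simp: in_segment)
    have "z = of_real (real n + u)" unfolding u(2) by (simp add: scaleR_conv_of_real algebra_simps)
    thus ?thesis using u by (intro exI[of _ "real n + u"]) auto
  qed
  have nn: "z \<notin> \<real>\<^sub>\<le>\<^sub>0" if "z \<in> ?S" for z
  proof -
    from S[OF that] obtain x where "z = of_real x" "real n \<le> x" by blast
    thus ?thesis using assms(2) by (auto simp: complex_nonpos_Reals_iff)
  qed
  have "norm (f 0 (of_nat (Suc n)) - (\<Sum>i\<le>1. f i (of_nat n) * (of_nat (Suc n) - of_nat n) ^ i / (fact i)))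
    \<le> (norm p * norm (p - 1) * real n powr (Re p - 2)) * norm (of_nat (Suc n) - of_nat n :: complex) ^ (Suc 1) / fact 1"
  proof (rule complex_Taylor[of ?S])
    fix i :: nat and x assume x: "x \<in> ?S" and i: "i \<le> 1"
    note nx = nn[OF x]
    consider "i = 0" | "i = 1" using i by linarith
    thus "(f i has_field_derivative f (Suc i) x) (at x within ?S)"
    proof cases
      case 1
      thus ?thesis unfolding f_def using nx
        by (auto intro!: derivative_eq_intros)
    next
      case 2
      have e: "p - 1 - 1 = p - 2" by simp
      show ?thesis unfolding f_def using nx 2
        by (auto intro!: derivative_eq_intros simp: e)
    qed
  next
    fix x assume x: "x \<in> ?S"
    obtain t where t: "x = of_real t" "real n \<le> t" using S[OF x] by blast
    have "norm (x powr (p - 2)) = t powr (Re p - 2)"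
      using t assms(2) by (simp add: norm_powr_real_powr)
    also have "\<dots> \<le> real n powr (Re p - 2)"
      using t assms by (intro powr_mono2') auto
    finally show "norm (f (Suc 1) x) \<le> norm p * norm (p - 1) * real n powr (Re p - 2)"
      by (simp add: f_def norm_mult mult_left_mono)
  qed auto
  thus ?thesis by (simp add: f_def algebra_simps)
qed


section \<open>The series of zeta and of the von Mangoldt function\<close>

lemma summable_zeta: "\<sigma> > 1 \<Longrightarrow> summable (\<lambda>n. real (Suc n) powr (-\<sigma>))"
  using summable_Suc_iff[of "\<lambda>n. real n powr (-\<sigma>)"] summable_real_powr_iff[of "-\<sigma>"] by simp

lemma summable_ln_zeta:
  assumes "\<sigma> > 1"
  shows "summable (\<lambda>n. ln (real (Suc n)) * real (Suc n) powr (-\<sigma>))"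
proof -
  define e where "e = (\<sigma> - 1) / 2"
  have e: "e > 0" "\<sigma> - e > 1" using assms by (auto simp: e_def field_simps)
  have "summable (\<lambda>n. real (Suc n) powr (-(\<sigma> - e)) / e)"
    by (intro summable_divide summable_zeta e)
  thus ?thesis
  proof (rule summable_comparison_test'[where N = 0], goal_cases)
    case (1 n)
    have "ln (real (Suc n)) \<le> real (Suc n) powr e / e"
      by (rule ln_powr_bound) (use e in auto)
    hence "ln (real (Suc n)) * real (Suc n) powr (-\<sigma>) \<le> real (Suc n) powr e / e * real (Suc n) powr (-\<sigma>)"
      by (intro mult_right_mono) auto
    also have "\<dots> = real (Suc n) powr (-(\<sigma> - e)) / e"
      by (simp add: powr_add[symmetric] del: of_nat_Suc)
    finally show ?case by (simp del: of_nat_Suc)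
  qed
qed

definition zeta_series :: "complex \<Rightarrow> complex" where "zeta_series = dirichlet (\<lambda>_. 1)"
definition mangoldt_series :: "complex \<Rightarrow> complex" where "mangoldt_series = dirichlet (\<lambda>n. mangoldt (Suc n))"

lemma zeta_series_facts:
  shows "zeta_series holomorphic_on {s. Re s > 1}"
    and "\<And>s. Re s > 1 \<Longrightarrow> (\<lambda>n. of_nat (Suc n) powr (-s)) sums zeta_series s"
    and "\<And>s. Re s > 1 \<Longrightarrow> (\<lambda>n. - of_real (ln (real (Suc n))) * of_nat (Suc n) powr (-s)) sums deriv zeta_series s"
proof -
  have "summable (\<lambda>n. norm (1::complex) * real (Suc n) powr (-\<sigma>))" if "\<sigma> > 1" for \<sigma>
    using summable_zeta[OF that] by simp
  note * = dirichlet_holomorphic[of 1 "\<lambda>_. 1", OF this]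
  show "zeta_series holomorphic_on {s. Re s > 1}" unfolding zeta_series_def by (rule *(1))
  show "(\<lambda>n. of_nat (Suc n) powr (-s)) sums zeta_series s" if "Re s > 1" for s
    using *(2)[OF _ that] unfolding zeta_series_def by simp
  show "(\<lambda>n. - of_real (ln (real (Suc n))) * of_nat (Suc n) powr (-s)) sums deriv zeta_series s" if "Re s > 1" for s
    using *(3)[OF _ that] unfolding zeta_series_def by simp
qed

lemma summable_mangoldt:
  assumes "\<sigma> > 1"
  shows "summable (\<lambda>n. mangoldt (Suc n) * real (Suc n) powr (-\<sigma>))"
  by (rule summable_comparison_test'[OF summable_ln_zeta[OF assms], of 0])
     (auto intro!: mult_right_mono mangoldt_le simp: abs_mult mangoldt_nonneg simp del: of_nat_Suc)

lemma mangoldt_series_facts: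
  shows "mangoldt_series holomorphic_on {s. Re s > 1}"
    and "\<And>s. Re s > 1 \<Longrightarrow> (\<lambda>n. mangoldt (Suc n) * of_nat (Suc n) powr (-s)) sums mangoldt_series s"
proof -
  have "summable (\<lambda>n. norm (mangoldt (Suc n) :: complex) * real (Suc n) powr (-\<sigma>))" if "\<sigma> > 1" for \<sigma>
    using summable_mangoldt[OF that] by simp
  note * = dirichlet_holomorphic[of 1 "\<lambda>n. mangoldt (Suc n)", OF this]
  show "mangoldt_series holomorphic_on {s. Re s > 1}" unfolding mangoldt_series_def by (rule *(1))
  show "(\<lambda>n. mangoldt (Suc n) * of_nat (Suc n) powr (-s)) sums mangoldt_series s" if "Re s > 1" for s
    using *(2)[OF _ that] unfolding mangoldt_series_def by simp
qed

text \<open>The Dirichlet convolution of 1 and \<open>mangoldt\<close> is ln, by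
  \<open>mangoldt_sum\<close>. Absolute summability of the double family allows the product of the
  two series to be regrouped according to n = m k.\<close>

lemma deriv_zeta_series:
  assumes s: "Re s > 1"
  shows "deriv zeta_series s = - zeta_series s * mangoldt_series s"
proof -
  let ?z = "\<lambda>m::nat. of_nat m powr (-s) :: complex"
  let ?l = "\<lambda>k::nat. mangoldt k * of_nat k powr (-s) :: complex"
  have rng: "{1..} = range Suc" by (auto simp: image_iff Suc_le_D intro: Suc_pred[symmetric])
  have has: "(f has_sum S) {1..}" if "summable (\<lambda>n. norm (f (Suc n)))" "(\<lambda>n. f (Suc n)) sums S" for f :: "nat \<Rightarrow> complex" and S
    unfolding rng using norm_summable_imp_has_sum[OF that] by (subst has_sum_reindex) (auto simp: o_def)
  have nz: "norm (?z (Suc n)) = real (Suc n) powr (- Re s)" for n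
    by (simp add: norm_powr_real_powr del: of_nat_Suc)
  have hz: "(?z has_sum zeta_series s) {1..}"
    by (rule has[OF _ zeta_series_facts(2)[OF s]]) (use nz summable_zeta[OF s] in simp)
  have hl: "(?l has_sum mangoldt_series s) {1..}"
    by (rule has[OF _ mangoldt_series_facts(2)[OF s]]) (use nz summable_mangoldt[OF s] in \<open>simp add: norm_mult\<close>)
  have hlog: "((\<lambda>n. - of_real (ln (real n)) * of_nat n powr (-s)) has_sum deriv zeta_series s) {1..}"
    by (rule has[OF _ zeta_series_facts(3)[OF s]]) (use nz summable_ln_zeta[OF s] in \<open>simp add: norm_mult del: of_nat_Suc\<close>)
  have az: "(\<lambda>m. norm (?z m)) summable_on {1..}" and al: "(\<lambda>m. norm (?l m)) summable_on {1..}"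
    using hz hl by (auto dest!: has_sum_imp_summable simp: summable_on_iff_abs_summable_on_complex)
  have "(\<lambda>x. norm (case x of (m,k) \<Rightarrow> ?z m * ?l k)) summable_on ({1..} \<times> {1..})"
  proof (rule Infinite_Sum.abs_summable_on_Sigma_iff[THEN iffD2], intro conjI ballI)
    show "(\<lambda>y. norm (case (m, y) of (m, k) \<Rightarrow> ?z m * ?l k)) summable_on {1..}" for m
      using summable_on_cmult_right[OF al, of "norm (?z m)"] by (simp add: norm_mult)
    have "(\<lambda>m. norm (?z m) * infsum (\<lambda>k. norm (?l k)) {1..}) summable_on {1..}"
      by (rule summable_on_cmult_left[OF az])
    moreover have "infsum (\<lambda>k. norm (case (m, k) of (m, k) \<Rightarrow> ?z m * ?l k)) {1..} = norm (?z m) * infsum (\<lambda>k. norm (?l k)) {1..}" for m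
      unfolding prod.case norm_mult[of "?z m"] by (rule infsum_cmult_right') 
    moreover have "norm (infsum (\<lambda>k. norm (case (m, k) of (m, k) \<Rightarrow> ?z m * ?l k)) {1..})
        = infsum (\<lambda>k. norm (case (m, k) of (m, k) \<Rightarrow> ?z m * ?l k)) {1..}" for m
      using infsum_nonneg[of "{1..}" "\<lambda>k. norm (case (m, k) of (m, k) \<Rightarrow> ?z m * ?l k)"] by simp
    ultimately show "(\<lambda>m. norm (infsum (\<lambda>k. norm (case (m, k) of (m, k) \<Rightarrow> ?z m * ?l k)) {1..})) summable_on {1..}"
      by presburger
  qed
  hence sm: "(\<lambda>(m,k). ?z m * ?l k) summable_on ({1..} \<times> {1..})" by (rule Infinite_Sum.abs_summable_summable)
  have prod: "((\<lambda>(m,k). ?z m * ?l k) has_sum (zeta_series s * mangoldt_series s)) ({1..} \<times> {1..})"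
  proof (rule has_sum_SigmaI[OF _ has_sum_cmult_left[OF hz] sm])
    show "((\<lambda>k. case (m, k) of (m, k) \<Rightarrow> ?z m * ?l k) has_sum ?z m * mangoldt_series s) {1..}" for m
      unfolding prod.case by (rule has_sum_cmult_right[OF hl])
  qed
  let ?B = "\<lambda>n::nat. {d. d dvd n}"
  \<comment> \<open>Pairs (m, k) correspond to a number n = m k together with its divisor k.\<close>
  have "((\<lambda>(n,d). ?z (n div d) * ?l d) has_sum (zeta_series s * mangoldt_series s)) (Sigma {1..} ?B) \<longleftrightarrow> ((\<lambda>(m,k). ?z m * ?l k) has_sum (zeta_series s * mangoldt_series s)) ({1..} \<times> {1..})"
    by (rule has_sum_reindex_bij_witness[where i = "\<lambda>(m,k). (m * k, k)" and j = "\<lambda>(n,d). (n div d, d)"])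
       (auto simp: Suc_le_eq dvd_div_eq_0_iff elim!: dvdE intro!: Nat.gr0I)
  with prod have reidx: "((\<lambda>(n,d). ?z (n div d) * ?l d) has_sum (zeta_series s * mangoldt_series s)) (Sigma {1..} ?B)" by simp
  have "((\<lambda>n. of_real (ln (real n)) * of_nat n powr (-s)) has_sum (zeta_series s * mangoldt_series s)) {1..}"
  proof (rule has_sum_SigmaD[OF reidx])
    fix n :: nat assume n: "n \<in> {1..}"
    have "(\<Sum>d\<in>?B n. ?z (n div d) * ?l d) = (\<Sum>d\<in>?B n. mangoldt d * of_nat n powr (-s))"
    proof (rule sum.cong[OF refl])
      fix d assume "d \<in> ?B n"
      then obtain e where e: "n = d * e" by (auto elim: dvdE)
      hence "d > 0" "e > 0" using n by (auto intro!: Nat.gr0I)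
      have "(of_nat n :: complex) powr (-s) = of_nat d powr (-s) * of_nat e powr (-s)"
        using powr_times_real[of "of_nat d" "of_nat e" "-s"] e by simp
      thus "?z (n div d) * ?l d = mangoldt d * of_nat n powr (-s)"
        using \<open>d > 0\<close> e by simp
    qed
    also have "\<dots> = of_real (ln (real n)) * of_nat n powr (-s)"
      unfolding sum_distrib_right[symmetric] using n by (subst mangoldt_sum) auto
    finally have "(\<Sum>d\<in>?B n. ?z (n div d) * ?l d) = of_real (ln (real n)) * of_nat n powr (-s)" .
    moreover have "finite (?B n)" using n by auto
    ultimately show "((\<lambda>d. case (n, d) of (n, d) \<Rightarrow> ?z (n div d) * ?l d) has_sum of_real (ln (real n)) * of_nat n powr (-s)) (?B n)"
      using has_sum_finite[of "?B n" "\<lambda>d. ?z (n div d) * ?l d"] by simp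
  qed
  from has_sum_cmult_right[OF this, of "-1"]
  have "((\<lambda>n. - of_real (ln (real n)) * of_nat n powr (-s)) has_sum - zeta_series s * mangoldt_series s) {1..}"
    by simp
  with hlog show ?thesis by (rule has_sum_unique)
qed

section \<open>The zeta function on the line of real part one\<close>

text \<open>The remainder gains two powers of n, so a weight of order n^q leaves terms of order n^(q
  + b - Re s - 2), summable for Re s > b + q - 1. The instance b = 1, q = 0 continues zeta; b = 0, q
  = 1 handles the error of theta.\<close>

lemma holomorphic_taylor_remainder_series:
  fixes w :: "nat \<Rightarrow> complex" and b q C :: real
  assumes w: "\<And>n. norm (w n) \<le> C * real (Suc n) powr q" and "q \<ge> -1"
  defines "f \<equiv> (\<lambda>n s. w n * (of_nat (Suc (Suc n)) powr (of_real b - s) - of_nat (Suc n) powr (of_real b - s)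
      - (of_real b - s) * of_nat (Suc n) powr (of_real b - s - 1)))"
  shows "(\<lambda>s. \<Sum>n. f n s) holomorphic_on {s. Re s > b + q - 1}"
    and "\<And>s. Re s > b + q - 1 \<Longrightarrow> (\<lambda>n. f n s) sums (\<Sum>n. f n s)"
proof -
  define \<sigma>0 where "\<sigma>0 = b + q - 1"
  have C0: "C \<ge> 0" using w[of 0] norm_ge_zero[of "w 0"] by (simp del: norm_ge_zero)
  have hol: "f n holomorphic_on {s. Re s > \<sigma>0}" for n
    unfolding f_def by (intro holomorphic_intros) (simp_all del: of_nat_Suc)
  have open': "open {s. Re s > \<sigma>0}" by (rule open_halfspace_Re_gt)
  have bd: "\<exists>d h. d > 0 \<and> summable h \<and> (\<forall>n. \<forall>y\<in>ball x d \<inter> {s. Re s > \<sigma>0}. norm (f n y) \<le> h n)"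
    if "x \<in> {s. Re s > \<sigma>0}" for x
  proof -
    define d where "d = (Re x - \<sigma>0) / 2"
    define K where "K = (\<bar>b\<bar> + norm x + d) * (\<bar>b\<bar> + 1 + norm x + d)"
    have "d > 0" using that by (simp add: d_def)
    have "summable (\<lambda>n. C * K * real (Suc n) powr (-(1 + d)))"
      using \<open>d > 0\<close> by (intro summable_mult summable_zeta) auto
    moreover have "norm (f n y) \<le> C * K * real (Suc n) powr (-(1 + d))" if y: "y \<in> ball x d" for n y
    proof -
      have "\<bar>Re x - Re y\<bar> < d" using y abs_Re_le_cmod[of "x - y"] by (simp add: dist_norm)
      moreover have "\<sigma>0 + d = Re x - d" by (simp add: d_def field_simps)
      ultimately have Rey: "Re y \<ge> \<sigma>0 + d" by linarith
      have ny: "norm y \<le> norm x + d" using y norm_triangle_sub[of y x] by (simp add: dist_norm norm_minus_commute)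
      have n1: "norm (of_real b - y) \<le> \<bar>b\<bar> + norm x + d"
        using norm_triangle_ineq4[of "of_real b" y] ny by simp
      have n2: "norm (of_real b - y - 1) \<le> \<bar>b\<bar> + 1 + norm x + d"
        using norm_triangle_ineq4[of "of_real b - y" 1] n1 by simp
      have "norm (f n y) = norm (w n) * norm (of_nat (Suc (Suc n)) powr (of_real b - y) - of_nat (Suc n) powr (of_real b - y)
          - (of_real b - y) * of_nat (Suc n) powr (of_real b - y - 1))"
        by (simp add: f_def norm_mult)
      \<comment> \<open>The Taylor bound asks for Re (b - y) \<le> 2, which follows from Re y > b +
        q - 1 and q \<ge> -1.\<close>
      also have "\<dots> \<le> (C * real (Suc n) powr q) * (norm (of_real b - y) * norm (of_real b - y - 1) * real (Suc n) powr (Re (of_real b - y) - 2))"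
        using Rey assms(2) \<open>d > 0\<close> C0
        by (intro mult_mono w powr_taylor_bound) (auto simp: \<sigma>0_def)
      also have "\<dots> \<le> (C * real (Suc n) powr q) * (K * real (Suc n) powr (b - (\<sigma>0 + d) - 2))"
        unfolding K_def using Rey n1 n2 C0 \<open>d > 0\<close>
        by (intro mult_left_mono mult_mono powr_mono) (auto intro!: mult_nonneg_nonneg add_nonneg_nonneg)
      also have "\<dots> = C * K * (real (Suc n) powr q * real (Suc n) powr (b - (\<sigma>0 + d) - 2))"
        by simp
      also have "real (Suc n) powr q * real (Suc n) powr (b - (\<sigma>0 + d) - 2) = real (Suc n) powr (-(1 + d))"
        unfolding powr_add[symmetric] \<sigma>0_def by (rule arg_cong[of _ _ "(powr) (real (Suc n))"]) simp
      finally show ?thesis .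
    qed
    ultimately show ?thesis using \<open>d > 0\<close> by blast
  qed
  note * = holomorphic_on_suminf[OF open' hol bd]
  show "(\<lambda>s. \<Sum>n. f n s) holomorphic_on {s. Re s > b + q - 1}" using *(1) unfolding \<sigma>0_def .
  show "(\<lambda>n. f n s) sums (\<Sum>n. f n s)" if "Re s > b + q - 1" for s
    using *(2)[of s] that unfolding \<sigma>0_def by simp
qed

text \<open>For \<open>Re s > 1\<close> the differences of \<open>n\<^bsup>1 - s\<^esup>\<close> telescope and leave \<open>(s - 1) \<zeta>(s)\<close>;
  the series itself converges for \<open>Re s > 0\<close>. Multiplying by \<open>s - 1\<close> avoids the pole.\<close>

definition zeta_times :: "complex \<Rightarrow> complex" where
  "zeta_times s = 1 + (\<Sum>n. of_nat (Suc (Suc n)) powr (1 - s) - of_nat (Suc n) powr (1 - s)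
      - (1 - s) * of_nat (Suc n) powr (- s))"

lemma zeta_times_facts:
  shows zeta_times_holomorphic: "zeta_times holomorphic_on {s. Re s > 0}"
    and zeta_times_sums: "\<And>s. Re s > 0 \<Longrightarrow> (\<lambda>n. of_nat (Suc (Suc n)) powr (1 - s) - of_nat (Suc n) powr (1 - s)
      - (1 - s) * of_nat (Suc n) powr (- s)) sums (zeta_times s - 1)"
proof -
  note * = holomorphic_taylor_remainder_series[of "\<lambda>_. 1" 1 0 1, simplified]
  have e: "1 - s - 1 = - s" for s :: complex by simp
  show "zeta_times holomorphic_on {s. Re s > 0}"
    unfolding zeta_times_def using *(1) by (intro holomorphic_intros) (simp add: e)
  show "(\<lambda>n. of_nat (Suc (Suc n)) powr (1 - s) - of_nat (Suc n) powr (1 - s)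
      - (1 - s) * of_nat (Suc n) powr (- s)) sums (zeta_times s - 1)" if "Re s > 0" for s
    using *(2)[OF that] unfolding zeta_times_def by (simp add: e)
qed

lemma zeta_times_1 [simp]: "zeta_times 1 = 1"
  by (simp add: zeta_times_def del: of_nat_Suc)

lemma zeta_times_eq:
  assumes s: "Re s > 1"
  shows "zeta_times s = (s - 1) * zeta_series s"
proof -
  let ?f = "\<lambda>n. of_nat (Suc n) powr (1 - s) :: complex"
  have "?f \<longlonglongrightarrow> 0"
  proof (rule tendsto_norm_zero_cancel)
    have "(\<lambda>n. real (Suc n) powr (1 - Re s)) \<longlonglongrightarrow> 0" using s by real_asymp
    thus "(\<lambda>n. norm (?f n)) \<longlonglongrightarrow> 0" by (simp add: norm_powr_real_powr del: of_nat_Suc)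
  qed
  hence "(\<lambda>n. ?f (Suc n) - ?f n) sums (0 - ?f 0)" by (rule telescope_sums)
  hence "(\<lambda>n. (?f (Suc n) - ?f n) - (1 - s) * of_nat (Suc n) powr (- s)) sums (0 - ?f 0 - (1 - s) * zeta_series s)"
    by (rule sums_diff[OF _ sums_mult[OF zeta_series_facts(2)[OF s]]])
  moreover have "(\<lambda>n. (?f (Suc n) - ?f n) - (1 - s) * of_nat (Suc n) powr (- s)) sums (zeta_times s - 1)"
    using zeta_times_sums[of s] s by simp
  ultimately have "0 - ?f 0 - (1 - s) * zeta_series s = zeta_times s - 1" by (rule sums_unique2)
  thus ?thesis by (simp add: algebra_simps)
qed

section \<open>Non-vanishing for real part at least one\<close>

text \<open>\<open>mangoldt_series\<close> has a primitive G on the half plane, and zeta * exp G has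
  derivative 0. A single zero would make zeta vanish everywhere, also at 2, where it is a sum of
  positive terms.\<close>

lemma zeta_series_nonzero:
  assumes s: "Re s > 1"
  shows "zeta_series s \<noteq> 0"
proof
  assume z: "zeta_series s = 0"
  let ?H = "{s. Re s > 1}"
  have conv: "convex ?H" and op: "open ?H" by (rule convex_halfspace_Re_gt open_halfspace_Re_gt)+
  obtain G where G: "\<And>x. x \<in> ?H \<Longrightarrow> (G has_field_derivative mangoldt_series x) (at x within ?H)"
    using holomorphic_convex_primitive'[OF conv op mangoldt_series_facts(1)] by blast
  have "((\<lambda>x. zeta_series x * exp (G x)) has_field_derivative 0) (at x within ?H)" if x: "x \<in> ?H" for x
  proof -
    have "(zeta_series has_field_derivative (- zeta_series x * mangoldt_series x)) (at x within ?H)"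
      using holomorphic_derivI[OF zeta_series_facts(1) op x] deriv_zeta_series x by (simp add: has_field_derivative_at_within)
    thus ?thesis by (auto intro!: derivative_eq_intros G[OF x])
  qed
  from has_field_derivative_zero_constant[OF conv this]
  obtain c where c: "\<And>x. x \<in> ?H \<Longrightarrow> zeta_series x * exp (G x) = c" by auto
  have "c = 0" using c[of s] z s by simp
  hence "zeta_series 2 = 0" using c[of 2] by simp
  moreover have "(\<lambda>n. Re (of_nat (Suc n) powr (-2))) sums Re (zeta_series 2)"
    by (rule sums_Re[OF zeta_series_facts(2)]) simp
  moreover have "Re (of_nat (Suc n) powr (-2)) = real (Suc n) powr (-2)" for n
    using powr_of_real[of "real (Suc n)" "-2"] by (simp del: of_nat_Suc)
  ultimately have "(\<lambda>n. real (Suc n) powr (-2)) sums 0" by simp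
  moreover from this have "0 < (\<Sum>n. real (Suc n) powr (-2))"
    by (intro suminf_pos) (auto simp: sums_iff)
  ultimately show False by (simp add: sums_iff)
qed

text \<open>Termwise from 3 + 4 cos \<theta> + cos 2\<theta> = 2 (1 + cos \<theta>)^2 with \<theta>
  = t ln n, as the values of \<open>mangoldt\<close> are nonnegative.\<close>

lemma Re_mangoldt_series_combination_nonneg:
  assumes x: "x > 1"
  shows "Re (3 * mangoldt_series (of_real x) + 4 * mangoldt_series (of_real x + \<i> * of_real t) + mangoldt_series (of_real x + \<i> * of_real (2 * t))) \<ge> 0"
proof -
  define r where "r n u = mangoldt (Suc n) * (exp (- x * ln (Suc n)) * cos (u * ln (Suc n)))" for n :: nat and u :: real
  have s: "(\<lambda>n. r n u) sums Re (mangoldt_series (of_real x + \<i> * of_real u))" for u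
  proof -
    have "(\<lambda>n. Re (mangoldt (Suc n) * of_nat (Suc n) powr (-(of_real x + \<i> * of_real u)))) sums Re (mangoldt_series (of_real x + \<i> * of_real u))"
      by (rule sums_Re[OF mangoldt_series_facts(2)]) (use x in simp)
    moreover have "Re (mangoldt (Suc n) * of_nat (Suc n) powr (-(of_real x + \<i> * of_real u))) = r n u" for n
      by (simp add: r_def powr_def Ln_of_nat Re_exp algebra_simps del: of_nat_Suc)
    ultimately show ?thesis by simp
  qed
  have sm3: "(\<lambda>n. 3 * r n 0 + 4 * r n t + r n (2 * t)) sums
     (3 * Re (mangoldt_series (of_real x + \<i> * of_real 0)) + 4 * Re (mangoldt_series (of_real x + \<i> * of_real t)) + Re (mangoldt_series (of_real x + \<i> * of_real (2 * t))))"
    by (intro sums_add sums_mult s)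
  have "3 * r n 0 + 4 * r n t + r n (2 * t) \<ge> 0" for n
  proof -
    have "3 * r n 0 + 4 * r n t + r n (2 * t) = mangoldt (Suc n) * exp (- x * ln (Suc n)) * (2 * (1 + cos (t * ln (Suc n)))\<^sup>2)"
    proof -
      have "cos (2 * t * ln (Suc n)) = 2 * (cos (t * ln (Suc n)))\<^sup>2 - 1"
        using cos_double_cos[of "t * ln (Suc n)"] by (simp only: mult.assoc)
      moreover have "3 * (m * (E * 1)) + 4 * (m * (E * c)) + m * (E * (2 * c\<^sup>2 - 1)) = m * E * (2 * (1 + c)\<^sup>2)"
        for m E c :: real by (simp add: power2_eq_square algebra_simps)
      ultimately show ?thesis unfolding r_def by (simp del: of_nat_Suc)
    qed
    also have "\<dots> \<ge> 0" by (intro mult_nonneg_nonneg) (auto simp: mangoldt_nonneg)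
    finally show ?thesis .
  qed
  from sums_le[OF this sums_zero sm3] have "0 \<le> 3 * Re (mangoldt_series (of_real x + \<i> * of_real 0)) + 4 * Re (mangoldt_series (of_real x + \<i> * of_real t)) + Re (mangoldt_series (of_real x + \<i> * of_real (2 * t)))"
    .
  thus ?thesis by simp
qed

lemma zeta_times_line_nonzero:
  assumes "t \<noteq> 0"
  shows "zeta_times (1 + \<i> * of_real t) \<noteq> 0"
proof (rule notI)
  assume zero: "zeta_times (1 + \<i> * of_real t) = 0"
  \<comment> \<open>\<open>\<bar>\<Phi>\<bar>\<^sup>2\<close> decreases on \<open>(1, 2]\<close> because \<open>3 + 4 cos \<theta> + cos 2\<theta> \<ge> 0\<close>, whereas the fourth-order zero
    would beat the third-order pole and force \<open>\<Phi> \<longlongrightarrow> 0\<close> at \<open>1\<close>.\<close>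
  define \<Phi> where "\<Phi> z = zeta_series z ^ 3 * zeta_series (z + \<i> * of_real t) ^ 4 * zeta_series (z + \<i> * of_real (2 * t))" for z
  define D where "D z = 3 * mangoldt_series z + 4 * mangoldt_series (z + \<i> * of_real t) + mangoldt_series (z + \<i> * of_real (2 * t))" for z
  have dz: "((\<lambda>z. zeta_series (z + c)) has_field_derivative (- zeta_series (x + c) * mangoldt_series (x + c))) (at x)"
    if "Re x > 1" "Re c = 0" for x c
  proof -
    have "(zeta_series has_field_derivative (- zeta_series (x + c) * mangoldt_series (x + c))) (at (x + c))"
      using holomorphic_derivI[OF zeta_series_facts(1) open_halfspace_Re_gt, of "x + c"] deriv_zeta_series[of "x + c"] that by simp
    from DERIV_shift[THEN iffD1, OF this] show ?thesis .
  qed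
  have d\<Phi>: "(\<Phi> has_field_derivative (- \<Phi> z * D z)) (at z)" if "Re z > 1" for z
    unfolding \<Phi>_def using that
    by (auto intro!: derivative_eq_intros dz dz[where c = 0, simplified] simp: D_def)
       (simp add: algebra_simps power2_eq_square power3_eq_cube power4_eq_xxxx)
  define V where "V x = (Re (\<Phi> (of_real x)))\<^sup>2 + (Im (\<Phi> (of_real x)))\<^sup>2" for x
  have dV: "\<exists>y. (V has_real_derivative y) (at x) \<and> y \<le> 0" if x: "x > 1" for x
  proof -
    have dsq: "((\<lambda>x. (f x)\<^sup>2 + (g x)\<^sup>2) has_real_derivative (2 * f x * a + 2 * g x * b)) (at x)"
      if "(f has_real_derivative a) (at x)" "(g has_real_derivative b) (at x)" for f g :: "real \<Rightarrow> real" and a b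
      using that by (auto intro!: derivative_eq_intros)
    let ?d = "- \<Phi> (of_real x) * D (of_real x)"
    have "((\<lambda>x. \<Phi> (of_real x)) has_vector_derivative ?d) (at x)"
      by (rule has_vector_derivative_real_field[OF d\<Phi>]) (use x in simp)
    hence "((\<lambda>x. Re (\<Phi> (of_real x))) has_real_derivative Re ?d) (at x)"
      "((\<lambda>x. Im (\<Phi> (of_real x))) has_real_derivative Im ?d) (at x)"
      unfolding has_real_derivative_iff_has_vector_derivative
      by (rule bounded_linear.has_vector_derivative[OF bounded_linear_Re]
          bounded_linear.has_vector_derivative[OF bounded_linear_Im])+
    hence "(V has_real_derivative (2 * Re (\<Phi> (of_real x)) * Re ?d + 2 * Im (\<Phi> (of_real x)) * Im ?d)) (at x)"
      unfolding V_def by (rule dsq)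
    moreover have "2 * Re (\<Phi> (of_real x)) * Re ?d + 2 * Im (\<Phi> (of_real x)) * Im ?d = - (2 * V x * Re (D (of_real x)))"
      by (simp add: V_def power2_eq_square algebra_simps)
    moreover have "\<dots> \<le> 0"
      using Re_mangoldt_series_combination_nonneg[OF x, of t] unfolding D_def V_def by simp
    ultimately show ?thesis by metis
  qed
  have mono: "V 2 \<le> V x" if "1 < x" "x \<le> 2" for x
  proof (rule DERIV_nonpos_imp_nonincreasing[OF \<open>x \<le> 2\<close>])
    fix u assume "x \<le> u" "u \<le> 2"
    show "\<exists>y. (V has_real_derivative y) (at u) \<and> y \<le> 0"
      by (rule dV) (use \<open>x \<le> u\<close> \<open>1 < x\<close> in linarith)
  qed
  have normV: "V x = norm (\<Phi> (of_real x)) ^ 2" for x by (simp add: V_def cmod_power2)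
  have V2: "V 2 > 0"
    unfolding normV \<Phi>_def by (simp add: zeta_series_nonzero)
  define z0 where "z0 = 1 + \<i> * of_real t"
  have dE: "(zeta_times has_field_derivative deriv zeta_times z0) (at z0)"
    by (rule holomorphic_derivI[OF zeta_times_holomorphic open_halfspace_Re_gt]) (simp add: z0_def)
  have contE: "isCont zeta_times z" if "Re z > 0" for z
    using holomorphic_on_imp_continuous_on[OF zeta_times_holomorphic] that
    by (simp add: continuous_on_eq_continuous_at open_halfspace_Re_gt)
  \<comment> \<open>\<open>\<Phi>\<close> written through \<open>zeta_times\<close>: the triple pole
    costs (z - 1)^3, and the fourth power of the zero supplies (z - 1)^4 times difference quotients
    that tend to the derivative. One factor z - 1 survives, hence the 1 - 1 in the limit.\<close>
  have lim: "((\<lambda>z. (z - 1) * zeta_times z ^ 3 * (zeta_times (z0 + (z - 1)) / (z - 1)) ^ 4 *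
      zeta_times (z + \<i> * of_real (2 * t)) / ((z - 1 + \<i> * of_real t) ^ 4 * (z - 1 + \<i> * of_real (2 * t)))) \<longlongrightarrow>
      (1 - 1) * zeta_times 1 ^ 3 * (deriv zeta_times z0) ^ 4 * zeta_times (1 + \<i> * of_real (2 * t)) / ((1 - 1 + \<i> * of_real t) ^ 4 * (1 - 1 + \<i> * of_real (2 * t)))) (at 1)"
  proof (intro tendsto_intros)
    show "(zeta_times \<longlongrightarrow> zeta_times 1) (at 1)" using contE[of 1] by (simp add: isCont_def)
    have "isCont (\<lambda>z. zeta_times (z + \<i> * of_real (2 * t))) 1"
      by (rule isCont_o2[OF _ contE]) (auto intro!: continuous_intros)
    thus "((\<lambda>z. zeta_times (z + \<i> * of_real (2 * t))) \<longlongrightarrow> zeta_times (1 + \<i> * of_real (2 * t))) (at 1)"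
      by (simp add: isCont_def)
    have "((\<lambda>h. zeta_times (z0 + h) / h) \<longlongrightarrow> deriv zeta_times z0) (at 0)"
      using dE zero unfolding has_field_derivative_def DERIV_def z0_def by (simp add: DERIV_def has_field_derivative_def[symmetric])
    thus "((\<lambda>z. zeta_times (z0 + (z - 1)) / (z - 1)) \<longlongrightarrow> deriv zeta_times z0) (at 1)"
      by (subst (asm) LIM_offset_zero_iff[symmetric, where f = "\<lambda>z. zeta_times (z0 + (z - 1)) / (z - 1)" and a = 1, simplified]) simp_all
  qed (use assms in auto)
  have lim0: "((\<lambda>x. \<Phi> (of_real x)) \<longlongrightarrow> 0) (at_right (1::real))"
  proof -
    have "filterlim (\<lambda>x. complex_of_real x) (at 1) (at_right (1::real))"
      by (rule filterlim_atI) (auto intro!: tendsto_eq_intros simp: eventually_at_filter)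
    from filterlim_compose[OF lim this] have
      "((\<lambda>x. (of_real x - 1) * zeta_times (of_real x) ^ 3 * (zeta_times (z0 + (of_real x - 1)) / (of_real x - 1)) ^ 4 *
      zeta_times (of_real x + \<i> * of_real (2 * t)) / ((of_real x - 1 + \<i> * of_real t) ^ 4 * (of_real x - 1 + \<i> * of_real (2 * t)))) \<longlongrightarrow> 0) (at_right (1::real))"
      by simp
    moreover have "\<forall>\<^sub>F x in at_right (1::real). (of_real x - 1) * zeta_times (of_real x) ^ 3 * (zeta_times (z0 + (of_real x - 1)) / (of_real x - 1)) ^ 4 *
      zeta_times (of_real x + \<i> * of_real (2 * t)) / ((of_real x - 1 + \<i> * of_real t) ^ 4 * (of_real x - 1 + \<i> * of_real (2 * t))) = \<Phi> (of_real x)"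
    proof (rule eventually_at_right_less[THEN eventually_mono])
      fix x :: real assume x: "1 < x"
      define y where "y = complex_of_real x - 1"
      have ne: "y \<noteq> 0" "y + \<i> * of_real t \<noteq> 0" "y + \<i> * of_real (2 * t) \<noteq> 0"
        using x by (auto simp: y_def complex_eq_iff)
      have z0x: "z0 + y = of_real x + \<i> * of_real t" by (simp add: z0_def y_def)
      have e: "zeta_times (of_real x) = y * zeta_series (of_real x)"
        "zeta_times (of_real x + \<i> * of_real t) = (y + \<i> * of_real t) * zeta_series (of_real x + \<i> * of_real t)"
        "zeta_times (of_real x + \<i> * of_real (2*t)) = (y + \<i> * of_real (2*t)) * zeta_series (of_real x + \<i> * of_real (2*t))"
        using x by (subst zeta_times_eq; simp add: y_def)+
      show "(of_real x - 1) * zeta_times (of_real x) ^ 3 * (zeta_times (z0 + (of_real x - 1)) / (of_real x - 1)) ^ 4 *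
        zeta_times (of_real x + \<i> * of_real (2 * t)) / ((of_real x - 1 + \<i> * of_real t) ^ 4 * (of_real x - 1 + \<i> * of_real (2 * t))) = \<Phi> (of_real x)"
      proof -
        have "y * (y * A) ^ 3 * (v * B / y) ^ 4 * (w * C) / (v ^ 4 * w) = A ^ 3 * B ^ 4 * C"
          if "y \<noteq> 0" "v \<noteq> 0" "w \<noteq> 0" for y v w A B C :: complex
          using that by (simp add: power_mult_distrib power_divide power3_eq_cube power4_eq_xxxx)
        from this[OF ne] show ?thesis
          unfolding y_def[symmetric] unfolding z0x e \<Phi>_def by simp
      qed
    qed
    ultimately show ?thesis using tendsto_cong by fast
  qed
  have "((\<lambda>x. V x) \<longlongrightarrow> 0) (at_right 1)"
    unfolding normV using tendsto_power[OF tendsto_norm[OF lim0], of 2] by simp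
  hence "\<forall>\<^sub>F x in at_right 1. V x < V 2" using V2 by (intro order_tendstoD(2))
  moreover have "\<forall>\<^sub>F x in at_right (1::real). 1 < x \<and> x \<le> 2"
    by (auto simp: eventually_at_right_field intro!: exI[of _ 2])
  ultimately have "\<forall>\<^sub>F x in at_right (1::real). False"
    by eventually_elim (use mono in force)
  thus False by simp
qed

text \<open>With Z = (s - 1) zeta, the difference -zeta'/zeta - zeta equals -Z'/Z - (Z - 1) / (s -
  1). Since Z(1) = 1, the last quotient extends holomorphically to \<open>Q\<close>, and Z has no
  zero with Re s \<ge> 1.\<close>

lemma mangoldt_series_minus_zeta_series:
  "\<exists>\<Omega> g. open \<Omega> \<and> {s. Re s \<ge> 1} \<subseteq> \<Omega> \<and> g holomorphic_on \<Omega> \<and> (\<forall>s. Re s > 1 \<longrightarrow> g s = mangoldt_series s - zeta_series s)"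
proof -
  define \<Omega> where "\<Omega> = {s. Re s > 0} \<inter> zeta_times -` (- {0})"
  define Q where "Q = (\<lambda>z. if z = 1 then deriv zeta_times 1 else (zeta_times z - zeta_times 1) / (z - 1))"
  define g where "g s = - deriv zeta_times s / zeta_times s - Q s" for s
  have op: "open \<Omega>" unfolding \<Omega>_def
    by (rule continuous_open_preimage[OF holomorphic_on_imp_continuous_on[OF zeta_times_holomorphic]])
       (auto simp: open_halfspace_Re_gt)
  have nz: "zeta_times s \<noteq> 0" if "Re s \<ge> 1" for s
  proof (cases "Re s = 1")
    case True
    hence s: "s = 1 + \<i> * of_real (Im s)" by (simp add: complex_eq_iff)
    show ?thesis using zeta_times_line_nonzero[of "Im s"] s by (cases "Im s = 0") auto
  next
    case False
    hence "Re s > 1" using that by simp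
    thus ?thesis using zeta_times_eq[of s] zeta_series_nonzero[of s] by auto
  qed
  have "g holomorphic_on \<Omega>"
  proof -
    have "zeta_times holomorphic_on \<Omega>" "deriv zeta_times holomorphic_on \<Omega>" "Q holomorphic_on \<Omega>"
      unfolding Q_def
      by (rule holomorphic_on_subset[of _ "{s. Re s > 0}"];
          simp add: \<Omega>_def holomorphic_deriv zeta_times_holomorphic open_halfspace_Re_gt pole_lemma_open del: zeta_times_1)+
    thus ?thesis unfolding g_def
      by (intro holomorphic_on_diff holomorphic_on_divide holomorphic_on_minus) (auto simp: \<Omega>_def)
  qed
  moreover have "g s = mangoldt_series s - zeta_series s" if s: "Re s > 1" for s
  proof -
    have s1: "s \<noteq> 1" using s by auto
    have "(zeta_series has_field_derivative (- zeta_series s * mangoldt_series s)) (at s)"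
      using holomorphic_derivI[OF zeta_series_facts(1) open_halfspace_Re_gt, of s] deriv_zeta_series[OF s] s by simp
    hence "((\<lambda>z. (z - 1) * zeta_series z) has_field_derivative (zeta_series s + (s - 1) * (- zeta_series s * mangoldt_series s))) (at s)"
      by (auto intro!: derivative_eq_intros)
    hence "(zeta_times has_field_derivative (zeta_series s + (s - 1) * (- zeta_series s * mangoldt_series s))) (at s)"
      by (rule has_field_derivative_transform_within_open[OF _ open_halfspace_Re_gt[of 1]])
         (use s zeta_times_eq in auto)
    hence d: "deriv zeta_times s = zeta_series s + (s - 1) * (- zeta_series s * mangoldt_series s)" by (rule DERIV_imp_deriv)
    show ?thesis
    proof -
      have "- (Z + y * (- Z * l)) / (y * Z) - (y * Z - 1) / y = l - Z" if "y \<noteq> 0" "Z \<noteq> 0" for y Z l :: complex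
        using that by (simp add: field_simps)
      from this[of "s - 1" "zeta_series s" "mangoldt_series s"] show ?thesis
        unfolding g_def Q_def d zeta_times_eq[OF s] using s1 zeta_series_nonzero[OF s] by simp
    qed
  qed
  moreover have "{s. Re s \<ge> 1} \<subseteq> \<Omega>" using nz by (auto simp: \<Omega>_def)
  ultimately show ?thesis using op by blast
qed

section \<open>Chebyshev bounds\<close>

lemma prod_primes_dvd:
  fixes N :: nat
  assumes "finite P" "\<And>p. p \<in> P \<Longrightarrow> prime p \<and> p dvd N"
  shows "\<Prod>P dvd N"
  using assms
proof (induction P rule: finite_induct)
  case (insert p P)
  have "coprime p (\<Prod>P)"
    using insert by (intro prod_coprime_right) (auto intro!: primes_coprime)
  thus ?case using insert by (simp add: divides_mult)
qed auto

definition theta :: "nat \<Rightarrow> real" where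
  "theta n = (\<Sum>p | prime p \<and> p \<le> n. ln (real p))"

lemma theta_Suc: "theta (Suc n) = theta n + (if prime (Suc n) then ln (real (Suc n)) else 0)"
proof -
  have "{p. prime p \<and> p \<le> Suc n} = (if prime (Suc n) then insert (Suc n) {p. prime p \<and> p \<le> n} else {p. prime p \<and> p \<le> n})"
    by (auto simp: le_Suc_eq)
  thus ?thesis by (auto simp: theta_def simp del: of_nat_Suc)
qed

lemma theta_0 [simp]: "theta 0 = 0"
  unfolding theta_def by (rule sum.neutral) (auto dest: prime_gt_0_nat)

lemma theta_nonneg: "theta n \<ge> 0"
  unfolding theta_def by (intro sum_nonneg) (auto dest: prime_ge_1_nat)

text \<open>All primes in (m + 1, 2 m + 1] divide the binomial coefficient of 2 m + 1 over m, hence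
  so does their product. That coefficient occurs twice in a row with sum 2 * 4^m and is therefore at
  most 4^m.\<close>

lemma theta_odd: "theta (2 * m + 1) \<le> theta (m + 1) + real m * ln 4"
proof -
  define P where "P = {p. prime p \<and> m + 1 < p \<and> p \<le> 2 * m + 1}"
  have fin: "finite P" by (rule finite_subset[of _ "{..2*m+1}"]) (auto simp: P_def)
  have un: "{p. prime p \<and> p \<le> 2 * m + 1} = {p. prime p \<and> p \<le> m + 1} \<union> P"
    by (auto simp: P_def)
  have "theta (2 * m + 1) = theta (m + 1) + (\<Sum>p\<in>P. ln (real p))"
    unfolding theta_def un by (rule sum.union_disjoint) (auto simp: fin, auto simp: P_def)
  also have "(\<Sum>p\<in>P. ln (real p)) = ln (real (\<Prod>P))"
    unfolding of_nat_prod using fin by (subst ln_prod) (auto simp: P_def dest: prime_gt_0_nat)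
  also have "\<dots> \<le> ln (4 ^ m)"
  proof -
    have "p dvd (2 * m + 1 choose m)" if "p \<in> P" for p
    proof -
      have p: "prime p" "m + 1 < p" "p \<le> 2 * m + 1" using that by (auto simp: P_def)
      have "fact m * fact (m + 1) * (2 * m + 1 choose m) = (fact (2 * m + 1) :: nat)"
        using binomial_fact_lemma[of m "2 * m + 1"] by simp
      moreover have "p dvd fact (2 * m + 1)" using p by (simp only: prime_dvd_fact_iff)
      ultimately have "p dvd fact m * fact (m + 1) * (2 * m + 1 choose m)" by metis
      moreover have "\<not> p dvd fact m" "\<not> p dvd fact (m + 1)"
        using p by (simp_all only: prime_dvd_fact_iff)
      ultimately show ?thesis using p(1) by (metis prime_dvd_multD)
    qed
    hence "\<Prod>P dvd (2 * m + 1 choose m)"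
      by (intro prod_primes_dvd fin) (auto simp: P_def)
    hence "\<Prod>P \<le> (2 * m + 1 choose m)" by (rule dvd_imp_le) simp
    also have "(2 * m + 1 choose m) \<le> 4 ^ m"
    proof -
      have "(2 * m + 1 choose m) + (2 * m + 1 choose (m + 1)) = (\<Sum>k\<in>{m, m + 1}. 2 * m + 1 choose k)" by simp
      also have "\<dots> \<le> (\<Sum>k\<le>2 * m + 1. 2 * m + 1 choose k)" by (intro sum_mono2) auto
      also have "\<dots> = 2 ^ (2 * m + 1)" by (rule choose_row_sum)
      also have "\<dots> = 2 * 4 ^ m" by (simp add: power_mult)
      finally have "(2 * m + 1 choose m) + (2 * m + 1 choose (m + 1)) \<le> 2 * 4 ^ m" .
      moreover have "(2 * m + 1 choose m) = (2 * m + 1 choose (m + 1))"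
        using binomial_symmetric[of m "2 * m + 1"] by simp
      ultimately show ?thesis by simp
    qed
    finally have "real (\<Prod>P) \<le> 4 ^ m" by (metis of_nat_le_iff of_nat_numeral of_nat_power)
    moreover have "real (\<Prod>P) > 0" using fin by (auto simp: P_def intro!: prod_pos dest: prime_gt_0_nat)
    ultimately show ?thesis by simp
  qed
  also have "ln (4 ^ m) = real m * ln 4" by (simp add: ln_realpow)
  finally show ?thesis by simp
qed

text \<open>Strong induction: an even n > 2 is not prime and reduces to n - 1, an odd n = 2 m + 1
  reduces to m + 1 by \<open>theta_odd\<close>.\<close>

lemma theta_le: "theta n \<le> real n * ln 4"
proof (induction n rule: less_induct)
  case (less n)
  show ?case
  proof (cases "n \<le> 2")
    case True
    then consider "n = 0" | "n = 1" | "n = 2" by linarith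
    thus ?thesis
    proof cases
      case 3
      have "theta 2 = ln 2" using theta_Suc[of 0] theta_Suc[of 1] two_is_prime_nat
        by (simp add: numeral_2_eq_2)
      also have "\<dots> \<le> 2 * ln 4" using ln_less_cancel_iff[of "2::real" 4] ln_ge_zero[of "4::real"] by linarith
      finally show ?thesis using 3 by simp
    qed (use theta_Suc[of 0] in auto)
  next
    case False
    show ?thesis
    proof (cases "even n")
      case True
      hence "\<not> prime n" using False prime_odd_nat[of n] by auto
      moreover obtain k where k: "n = Suc k" using False by (cases n) auto
      ultimately have "theta n = theta k" by (simp add: theta_Suc)
      also have "\<dots> \<le> real k * ln 4" using less k by simp
      also have "\<dots> \<le> real n * ln 4" using k by (intro mult_right_mono) auto
      finally show ?thesis .
    next
      case odd: False
      then obtain m where m: "n = 2 * m + 1" by (elim oddE)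
      have "theta (m + 1) \<le> real (m + 1) * ln 4" using False m by (intro less) auto
      with theta_odd[of m] have "theta n \<le> (real (m + 1) + real m) * ln 4"
        unfolding m distrib_right by linarith
      also have "real (m + 1) + real m = real n" using m by simp
      finally show ?thesis .
    qed
  qed
qed

text \<open>A prime power p^k with k \<ge> 2 has the form a^2 b^3 with b = 1 or b = p, according to
  the parity of k. The sum is thus dominated by the product of a series over a with exponent 2
  \<tau> and one over b with exponent 3 \<tau>, both exponents exceeding 1.\<close>

lemma summable_proper_prime_powers:
  assumes \<sigma>: "\<sigma> > 1 / 2"
  shows "summable (\<lambda>n. (if prime (Suc n) then 0 else mangoldt (Suc n)) * real (Suc n) powr (-\<sigma>))"
proof -
  \<comment> \<open>Half of the room above 1/2: the logarithm is absorbed into n^e / e, and the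
    remaining exponent \<open>\<tau>\<close> still exceeds 1/2.\<close>
  define e where "e = (\<sigma> - 1 / 2) / 2"
  define \<tau> where "\<tau> = \<sigma> - e"
  have e: "e > 0" "\<tau> > 1 / 2" using \<sigma> by (auto simp: e_def \<tau>_def field_simps)
  define c where "c n = (if prime n then 0 else mangoldt n :: real)" for n :: nat
  have c0: "c n \<ge> 0" for n by (simp add: c_def mangoldt_nonneg)
  define A where "A = (\<Sum>n. real (Suc n) powr (-(2 * \<tau>)))"
  define B where "B = (\<Sum>n. real (Suc n) powr (-(3 * \<tau>)))"
  have smA: "summable (\<lambda>n. real (Suc n) powr (-(2 * \<tau>)))" and smB: "summable (\<lambda>n. real (Suc n) powr (-(3 * \<tau>)))"
    using e summable_zeta[of "2 * \<tau>"] summable_zeta[of "3 * \<tau>"] by simp_all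
  have shape: "\<exists>a b. n = a\<^sup>2 * b ^ 3 \<and> 1 \<le> a \<and> a \<le> n \<and> 1 \<le> b \<and> b \<le> n" if "c n \<noteq> 0" for n
  proof -
    have "primepow n" "\<not> prime n" using that by (auto simp: c_def mangoldt_def split: if_splits)
    then obtain p k where pk: "prime p" "k > 0" "n = p ^ k" by (auto simp: primepow_def prime_elem_nat_iff)
    have "k \<noteq> 1" using pk \<open>\<not> prime n\<close> by auto
    have n0: "n > 0" using pk by (simp add: prime_gt_0_nat)
    have "\<exists>a b. n = a\<^sup>2 * b ^ 3"
    proof (cases "even k")
      case True
      then obtain j where "k = 2 * j" by (elim evenE)
      hence "n = (p ^ j)\<^sup>2 * 1 ^ 3" using pk by (simp add: power_mult[symmetric] mult.commute)
      thus ?thesis by blast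
    next
      case False
      then obtain j where "k = 2 * j + 1" by (elim oddE)
      moreover from this \<open>k \<noteq> 1\<close> obtain i where "j = Suc i" by (cases j) auto
      ultimately have "k = 2 * i + 3" by simp
      hence "n = (p ^ i)\<^sup>2 * p ^ 3" using pk by (simp add: power_add power_mult[symmetric] mult.commute)
      thus ?thesis by blast
    qed
    then obtain a b where ab: "n = a\<^sup>2 * b ^ 3" by blast
    have "a dvd n" "b dvd n" unfolding ab by (auto simp: power2_eq_square power3_eq_cube)
    moreover from this n0 have "a > 0" "b > 0" by (auto intro!: Nat.gr0I)
    moreover from calculation n0 have "a \<le> n" "b \<le> n" by (auto intro: dvd_imp_le)
    ultimately show ?thesis using ab by (intro exI[of _ a] exI[of _ b] conjI) auto
  qed
  have bound: "(\<Sum>n<N. c (Suc n) * real (Suc n) powr (-\<sigma>)) \<le> A * B / e" for N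
  proof -
    define f where "f = (\<lambda>(i,j). (Suc i)\<^sup>2 * Suc j ^ 3 - 1)"
    define h where "h n = real (Suc n) powr (-\<tau>) / e" for n
    have h0: "h n \<ge> 0" for n using e by (simp add: h_def)
    have "(\<Sum>n<N. c (Suc n) * real (Suc n) powr (-\<sigma>)) \<le> (\<Sum>n\<in>{n. n < N \<and> c (Suc n) \<noteq> 0}. h n)"
    proof -
      have "(\<Sum>n<N. c (Suc n) * real (Suc n) powr (-\<sigma>)) = (\<Sum>n\<in>{n. n < N \<and> c (Suc n) \<noteq> 0}. c (Suc n) * real (Suc n) powr (-\<sigma>))"
        by (rule sum.mono_neutral_right) auto
      also have "\<dots> \<le> (\<Sum>n\<in>{n. n < N \<and> c (Suc n) \<noteq> 0}. h n)"
      proof (rule sum_mono)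
        fix n
        have "c (Suc n) \<le> ln (real (Suc n))" 
          using mangoldt_le[of "Suc n"] by (auto simp: c_def simp del: of_nat_Suc)
        also have "\<dots> \<le> real (Suc n) powr e / e" by (rule ln_powr_bound) (use e in auto)
        finally have "c (Suc n) * real (Suc n) powr (-\<sigma>) \<le> real (Suc n) powr e / e * real (Suc n) powr (-\<sigma>)"
          by (intro mult_right_mono) auto
        also have "\<dots> = h n" by (simp add: h_def \<tau>_def powr_add[symmetric] del: of_nat_Suc)
        finally show "c (Suc n) * real (Suc n) powr (-\<sigma>) \<le> h n" .
      qed
      finally show ?thesis .
    qed
    also have "\<dots> \<le> sum h (f ` ({..<N} \<times> {..<N}))"
    proof (rule sum_mono2)
      show "{n. n < N \<and> c (Suc n) \<noteq> 0} \<subseteq> f ` ({..<N} \<times> {..<N})"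
      proof
        fix n assume "n \<in> {n. n < N \<and> c (Suc n) \<noteq> 0}"
        hence n: "n < N" "c (Suc n) \<noteq> 0" by auto
        obtain a b where ab: "Suc n = a\<^sup>2 * b ^ 3" "1 \<le> a" "a \<le> Suc n" "1 \<le> b" "b \<le> Suc n"
          using shape[OF n(2)] by blast
        have "n = f (a - 1, b - 1)" using ab by (simp add: f_def flip: ab(1))
        thus "n \<in> f ` ({..<N} \<times> {..<N})" using ab n by (intro image_eqI[of _ _ "(a-1,b-1)"]) auto
      qed
    qed (auto simp: h0)
    \<comment> \<open>A number may have several representations a^2 b^3; as \<open>h\<close> is
      nonnegative, counting all of them only enlarges the sum.\<close>
    also have "\<dots> \<le> (\<Sum>x\<in>{..<N} \<times> {..<N}. (h \<circ> f) x)"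
      by (rule sum_image_le) (auto simp: h0)
    also have "\<dots> = (\<Sum>i<N. \<Sum>j<N. real (Suc i) powr (-(2*\<tau>)) * real (Suc j) powr (-(3*\<tau>))) / e"
      unfolding sum.cartesian_product sum_divide_distrib
    proof (rule sum.cong[OF refl], clarify)
      fix i j :: nat
      have "Suc (f (i, j)) = (Suc i)\<^sup>2 * Suc j ^ 3" by (simp add: f_def)
      hence "real (Suc (f (i, j))) powr (-\<tau>) = (real (Suc i) ^ 2) powr (-\<tau>) * (real (Suc j) ^ 3) powr (-\<tau>)"
        by (simp add: powr_mult del: of_nat_Suc)
      also have "\<dots> = real (Suc i) powr (-(2*\<tau>)) * real (Suc j) powr (-(3*\<tau>))"
        by (simp add: powr_powr flip: powr_numeral del: of_nat_Suc)
      finally show "(h \<circ> f) (i, j) = real (Suc i) powr (-(2*\<tau>)) * real (Suc j) powr (-(3*\<tau>)) / e"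
        by (simp add: h_def)
    qed
    also have "(\<Sum>i<N. \<Sum>j<N. real (Suc i) powr (-(2*\<tau>)) * real (Suc j) powr (-(3*\<tau>))) =
       (\<Sum>i<N. real (Suc i) powr (-(2*\<tau>))) * (\<Sum>j<N. real (Suc j) powr (-(3*\<tau>)))"
      by (simp add: sum_product)
    also have "\<dots> \<le> A * B"
      unfolding A_def B_def by (intro mult_mono sum_le_suminf smA smB sum_nonneg suminf_nonneg) auto
    finally show ?thesis using e by (simp add: divide_right_mono)
  qed
  have "summable (\<lambda>n. c (Suc n) * real (Suc n) powr (-\<sigma>))"
    by (rule bounded_imp_summable[of _ "A * B / e"])
       (use c0 bound in \<open>auto simp: lessThan_Suc_atMost[symmetric] simp del: sum.lessThan_Suc\<close>)
  thus ?thesis by (simp add: c_def)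
qed

section \<open>Primes in short intervals\<close>

text \<open>Newman's theorem for the coefficients W(n) / n with W(n) = theta(n) - n. Abel summation
  evaluates the sum of W(n) (n^(-s) - (n + 1)^(-s)) through the series of \<open>mangoldt\<close>,
  \<open>pp\<close> and zeta. Replacing the difference of powers by s n^(-s - 1) adds
  \<open>T\<close>, which is holomorphic for Re s > 0, and division by s gives the continuation
  \<open>G\<close>.\<close>

lemma summable_theta_error:
  "summable (\<lambda>n. (theta (Suc n) - real (Suc n)) / (real (Suc n))\<^sup>2)"
proof -
  define W where "W n = theta n - real n" for n
  define K where "K = ln 4 + (1::real)"
  have K: "K > 0" unfolding K_def using ln_ge_zero[of "4::real"] by linarith
  have W: "\<bar>W n\<bar> \<le> K * real n" for n
    using theta_le[of n] theta_nonneg[of n] unfolding W_def K_def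
    by (simp add: algebra_simps)
  \<comment> \<open>The terms that distinguish \<open>mangoldt\<close> from the increments of
    \<open>theta\<close>; their series is holomorphic for Re s > 1/2, hence harmless on the line Re
    s = 1.\<close>
  define pp where "pp n = (if prime (Suc n) then 0 else mangoldt (Suc n) :: complex)" for n
  have "summable (\<lambda>n. norm (pp n) * real (Suc n) powr (-\<sigma>))" if "\<sigma> > 1 / 2" for \<sigma>
    using summable_proper_prime_powers[OF that] by (simp add: pp_def if_distrib cong: if_cong)
  note pp = dirichlet_holomorphic[of "1/2" pp, OF this]
  obtain \<Omega> g where \<Omega>: "open \<Omega>" "{s. Re s \<ge> 1} \<subseteq> \<Omega>" and g: "g holomorphic_on \<Omega>"
    and geq: "\<And>s. Re s > 1 \<Longrightarrow> g s = mangoldt_series s - zeta_series s"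
    using mangoldt_series_minus_zeta_series by blast
  define T where "T s = (\<Sum>n. complex_of_real (W (Suc n)) * (of_nat (Suc (Suc n)) powr (of_real 0 - s) - of_nat (Suc n) powr (of_real 0 - s)
      - (of_real 0 - s) * of_nat (Suc n) powr (of_real 0 - s - 1)))" for s
  have "norm (complex_of_real (W (Suc n))) \<le> K * real (Suc n) powr 1" for n
    using W[of "Suc n"] by simp
  note T = holomorphic_taylor_remainder_series[where w = "\<lambda>n. complex_of_real (W (Suc n))" and b = 0, OF this, simplified, folded T_def[simplified]]
  have Wsum: "(\<lambda>n. of_real (W (Suc n)) * (of_nat (Suc n) powr (-s) - of_nat (Suc (Suc n)) powr (-s))) sums (g s - dirichlet pp s)"
    if s: "Re s > 1" for s :: complex
  proof -
    let ?u = "\<lambda>n. of_nat (Suc n) powr (-s) :: complex"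
    have "(\<lambda>n. mangoldt (Suc n) * ?u n - pp n * ?u n - ?u n) sums (mangoldt_series s - dirichlet pp s - zeta_series s)"
      using s by (intro sums_diff mangoldt_series_facts(2) zeta_series_facts(2) pp(2)) auto
    also have "mangoldt_series s - dirichlet pp s - zeta_series s = g s - dirichlet pp s" using geq[OF s] by simp
    also have "(\<lambda>n. mangoldt (Suc n) * ?u n - pp n * ?u n - ?u n) = (\<lambda>n. of_real (W (Suc n) - W n) * ?u n)"
      by (auto simp: fun_eq_iff pp_def W_def theta_Suc algebra_simps simp del: of_nat_Suc) (simp_all add: algebra_simps)
    finally have sm: "(\<lambda>n. of_real (W (Suc n) - W n) * ?u n) sums (g s - dirichlet pp s)" .
    \<comment> \<open>Summation by parts starting from W(0) = 0; the boundary term tends to 0 by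
      |W(N)| \<le> K N and Re s > 1.\<close>
    have abel: "(\<Sum>n<N. of_real (W (Suc n) - W n) * ?u n) = of_real (W N) * ?u N + (\<Sum>n<N. of_real (W (Suc n)) * (?u n - ?u (Suc n)))" for N
      by (induction N) (simp_all add: W_def algebra_simps)
    have "(\<lambda>N. of_real (W N) * ?u N) \<longlonglongrightarrow> 0"
    proof (rule tendsto_norm_zero_cancel, rule tendsto_sandwich[OF _ _ tendsto_const])
      show "(\<lambda>N. K * real N * real (Suc N) powr (- Re s)) \<longlonglongrightarrow> 0"
        using s by real_asymp
      show "\<forall>\<^sub>F N in sequentially. norm (of_real (W N) * ?u N) \<le> K * real N * real (Suc N) powr (- Re s)"
        unfolding norm_dirichlet_term norm_of_real by (intro always_eventually allI mult_right_mono W) auto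
    qed auto
    from tendsto_diff[OF sm[unfolded sums_def] this] show ?thesis
      unfolding sums_def abel by simp
  qed
  define a where "a n = complex_of_real (W (Suc n) / real (Suc n))" for n
  define G where "G z = (T (1 + z) + (g (1 + z) - dirichlet pp (1 + z))) / (1 + z)" for z
  \<comment> \<open>The shift s = 1 + z moves the line Re s = 1 to the imaginary axis. The condition
    Re s > 1/2 is the domain of the \<open>pp\<close> series and keeps the denominator 1 + z away
    from 0.\<close>
  define \<Omega>' where "\<Omega>' = (\<lambda>z. 1 + z) -` (\<Omega> \<inter> {s. Re s > 1 / 2})"
  have "(\<lambda>n. a n / of_nat (Suc n)) sums G 0"
  proof (rule newman_tauberian)
    show "norm (a n) \<le> K" for n
    proof -
      have "norm (a n) = \<bar>W (Suc n)\<bar> / real (Suc n)"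
        unfolding a_def norm_of_real by (simp add: abs_divide del: of_nat_Suc)
      thus ?thesis using W[of "Suc n"] by (simp add: pos_divide_le_eq del: of_nat_Suc)
    qed
    show "open \<Omega>'" unfolding \<Omega>'_def
      by (intro open_vimage open_Int \<Omega> open_halfspace_Re_gt continuous_intros)
    show "{z. 0 \<le> Re z} \<subseteq> \<Omega>'" unfolding \<Omega>'_def using \<Omega>(2) by force
    have hol: "(\<lambda>z. f (1 + z)) holomorphic_on \<Omega>'" if "f holomorphic_on S" "\<Omega> \<inter> {s. Re s > 1 / 2} \<subseteq> S" for f S
      using holomorphic_on_compose_gen[of "\<lambda>z. 1 + z" \<Omega>' f S] that
      by (force simp: \<Omega>'_def o_def intro!: holomorphic_intros)
    have "(\<lambda>z. T (1 + z)) holomorphic_on \<Omega>'" by (rule hol[OF T(1)]) auto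
    moreover have "(\<lambda>z. g (1 + z)) holomorphic_on \<Omega>'" by (rule hol[OF g]) auto
    moreover have "(\<lambda>z. dirichlet pp (1 + z)) holomorphic_on \<Omega>'" by (rule hol[OF pp(1)]) auto
    ultimately show "G holomorphic_on \<Omega>'" unfolding G_def
      by (intro holomorphic_intros) (auto simp: \<Omega>'_def complex_eq_iff)
    show "(\<lambda>n. a n * of_nat (Suc n) powr (-1 - z)) sums G z" if z: "Re z > 0" for z
    proof -
      define s where "s = 1 + z"
      have s: "Re s > 1" "s \<noteq> 0" using z by (auto simp: s_def complex_eq_iff)
      have e: "-s - 1 = - s + - 1" by simp
      have eq: "of_real (W (Suc n)) * (of_nat (Suc (Suc n)) powr (-s) - of_nat (Suc n) powr (-s) + s * of_nat (Suc n) powr (-s-1))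
         + of_real (W (Suc n)) * (of_nat (Suc n) powr (-s) - of_nat (Suc (Suc n)) powr (-s)) = s * (a n * of_nat (Suc n) powr (-1-z))" for n
      proof -
        have "of_nat (Suc n) powr (-s-1) = of_nat (Suc n) powr (-s) / (of_nat (Suc n) :: complex)"
          by (subst powr_diff) (simp del: of_nat_Suc)
        moreover have "-1-z = -s" by (simp add: s_def)
        ultimately show ?thesis by (simp add: a_def algebra_simps del: of_nat_Suc)
      qed
      have "(\<lambda>n. s * (a n * of_nat (Suc n) powr (-1-z))) sums (T s + (g s - dirichlet pp s))"
        unfolding eq[symmetric] using T(2)[of s] Wsum[OF s(1)] s by (intro sums_add) (simp_all add: T_def)
      from sums_divide[OF this, of s] show ?thesis using s by (simp add: G_def s_def)
    qed
  qed
  hence "(\<lambda>n. Re (a n / of_nat (Suc n))) sums Re (G 0)" by (rule sums_Re)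
  hence "summable (\<lambda>n. Re (a n / of_nat (Suc n)))" by (rule sums_summable)
  moreover have "Re (a n / of_nat (Suc n)) = (theta (Suc n) - real (Suc n)) / (real (Suc n))\<^sup>2" for n
  proof -
    have "a n / of_nat (Suc n) = complex_of_real (W (Suc n) / real (Suc n) / real (Suc n))"
      by (simp add: a_def del: of_nat_Suc)
    thus ?thesis by (simp only: Re_complex_of_real W_def power2_eq_square divide_divide_eq_left)
  qed
  ultimately show ?thesis by simp
qed

lemma theta_cong:
  assumes "m \<le> n" "\<And>p. prime p \<Longrightarrow> m < p \<Longrightarrow> p \<le> n \<Longrightarrow> False"
  shows "theta n = theta m"
proof -
  have "{p. prime p \<and> p \<le> n} = {p. prime p \<and> p \<le> m}"
    using assms by (auto simp: not_le[symmetric])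
  thus ?thesis by (simp add: theta_def)
qed

text \<open>Without a prime in (x, (1 + \<epsilon>) x] the function \<open>theta\<close> has a
  constant value T there. If T is at least the midpoint, theta(n) - n is at least \<epsilon> x / 4
  on the first quarter of the interval; otherwise n - theta(n) is at least that on the last quarter.
  Either block contributes an amount bounded away from 0, against the Cauchy criterion.\<close>

theorem prime_in_short_interval:
  fixes \<epsilon> :: real
  assumes "\<epsilon> > 0"
  shows "\<exists>x0. \<forall>x\<ge>x0. \<exists>p. prime p \<and> x < real p \<and> real p \<le> (1 + \<epsilon>) * x"
proof -
  \<comment> \<open>\<epsilon> \<le> 1 keeps the interval below 2 x; larger values follow from the
    shorter interval for \<open>min \<epsilon> 1\<close>.\<close>
  have main: "\<exists>x0. \<forall>x\<ge>x0. \<exists>p. prime p \<and> x < real p \<and> real p \<le> (1 + \<epsilon>) * x"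
    if \<epsilon>: "\<epsilon> > 0" "\<epsilon> \<le> 1" for \<epsilon> :: real
  proof -
    define f where "f n = (theta (Suc n) - real (Suc n)) / (real (Suc n))\<^sup>2" for n
    \<comment> \<open>The product of \<epsilon> x / 8, a lower bound for the number of terms in a
      block, and \<epsilon> / (16 x), a lower bound for each of them.\<close>
    define c where "c = \<epsilon>\<^sup>2 / 128"
    have c: "c > 0" using \<epsilon> by (simp add: c_def)
    have "summable f" unfolding f_def by (rule summable_theta_error)
    then obtain M where M: "\<And>m n. m \<ge> M \<Longrightarrow> norm (sum f {m..<n}) < c"
      using c unfolding summable_Cauchy by blast
    \<comment> \<open>x \<ge> 16 / \<epsilon> guarantees that a quarter of the interval, after a
      loss of 1 by rounding, still has at least \<epsilon> x / 8 integers; x \<ge> M + 1 puts the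
      blocks beyond the Cauchy threshold.\<close>
    have "\<exists>p. prime p \<and> x < real p \<and> real p \<le> (1 + \<epsilon>) * x" if x: "x \<ge> max (real M + 1) (16 / \<epsilon>)" for x
    proof (rule ccontr)
      assume neg: "\<not> ?thesis"
      have x1: "x \<ge> real M + 1" and x2: "\<epsilon> * x \<ge> 16" using x \<epsilon> by (auto simp: field_simps)
      have x0: "x > 0" using x1 by linarith
      define T where "T = theta (nat \<lfloor>x\<rfloor>)"
      have th: "theta j = T" if "x < real j" "real j \<le> (1 + \<epsilon>) * x" for j
        unfolding T_def
      proof (rule theta_cong)
        show "nat \<lfloor>x\<rfloor> \<le> j" using that x0 by linarith
        fix p assume "prime p" "nat \<lfloor>x\<rfloor> < p" "p \<le> j"
        moreover from this have "x < real p" using x0 by linarith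
        ultimately show False using neg that by (meson le_trans of_nat_le_iff order_trans)
      qed
      have block: "real (card {nat \<lfloor>a\<rfloor>..<nat \<lfloor>b\<rfloor>}) \<ge> \<epsilon> * x / 8 \<and> nat \<lfloor>a\<rfloor> \<ge> M \<and>
          (\<forall>n\<in>{nat \<lfloor>a\<rfloor>..<nat \<lfloor>b\<rfloor>}. a < real (Suc n) \<and> real (Suc n) \<le> b \<and> real (Suc n) \<le> 2 * x \<and> theta (Suc n) = T)"
        if ab: "x \<le> a" "b = a + \<epsilon> / 4 * x" "b \<le> (1 + \<epsilon>) * x" for a b
      proof (intro conjI ballI)
        have "real (nat \<lfloor>b\<rfloor>) > b - 1" "real (nat \<lfloor>a\<rfloor>) \<le> a" using ab x0 \<epsilon> by linarith+
        moreover have "b - 1 - a \<ge> \<epsilon> * x / 8" using ab x2 by (simp add: field_simps)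
        ultimately show "real (card {nat \<lfloor>a\<rfloor>..<nat \<lfloor>b\<rfloor>}) \<ge> \<epsilon> * x / 8" by simp
        show "nat \<lfloor>a\<rfloor> \<ge> M" using ab x1 by linarith
        fix n assume n: "n \<in> {nat \<lfloor>a\<rfloor>..<nat \<lfloor>b\<rfloor>}"
        show 1: "a < real (Suc n)" using n ab x0 by simp linarith
        show 2: "real (Suc n) \<le> b" using n ab x0 by simp linarith
        have "(1 + \<epsilon>) * x \<le> 2 * x" using \<epsilon> x0 by (intro mult_right_mono) auto
        thus "real (Suc n) \<le> 2 * x" using 2 ab by linarith
        show "theta (Suc n) = T" by (rule th) (use 1 2 ab in linarith)+
      qed
      have est: "k / (real (Suc n))\<^sup>2 \<ge> \<epsilon> / (16 * x)" if "k \<ge> \<epsilon> / 4 * x" "real (Suc n) \<le> 2 * x" for k n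
      proof -
        have "\<epsilon> / (16 * x) = (\<epsilon> / 4 * x) / (2 * x)\<^sup>2" using x0 by (simp add: power2_eq_square)
        also have "\<dots> \<le> k / (real (Suc n))\<^sup>2"
          using that x0 \<epsilon> by (intro frac_le power_mono) (auto intro: order_trans[of _ "\<epsilon> / 4 * x"])
        finally show ?thesis .
      qed
      have fin: "real (card A) * (\<epsilon> / (16 * x)) \<ge> c" if "real (card A) \<ge> \<epsilon> * x / 8" for A :: "nat set"
      proof -
        have "c = (\<epsilon> * x / 8) * (\<epsilon> / (16 * x))" using x0 by (simp add: c_def power2_eq_square)
        also have "\<dots> \<le> real (card A) * (\<epsilon> / (16 * x))" using that x0 \<epsilon> by (intro mult_right_mono) auto
        finally show ?thesis .
      qed
      show False
      proof (cases "T \<ge> (1 + \<epsilon> / 2) * x")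
        case True
        let ?A = "{nat \<lfloor>x\<rfloor>..<nat \<lfloor>x + \<epsilon> / 4 * x\<rfloor>}"
        have b: "real (card ?A) \<ge> \<epsilon> * x / 8" "nat \<lfloor>x\<rfloor> \<ge> M"
          "\<And>n. n \<in> ?A \<Longrightarrow> real (Suc n) \<le> x + \<epsilon> / 4 * x \<and> real (Suc n) \<le> 2 * x \<and> theta (Suc n) = T"
          using block[of x "x + \<epsilon> / 4 * x"] x0 \<epsilon> by (auto simp: algebra_simps)
        have "c \<le> real (card ?A) * (\<epsilon> / (16 * x))" by (rule fin[OF b(1)])
        also have "\<dots> \<le> sum f ?A"
        proof (rule sum_bounded_below)
          fix n assume n: "n \<in> ?A"
          show "\<epsilon> / (16 * x) \<le> f n" unfolding f_def
            by (rule est) (use b(3)[OF n] True in \<open>auto simp: algebra_simps\<close>)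
        qed
        finally show False using M[OF b(2), of "nat \<lfloor>x + \<epsilon> / 4 * x\<rfloor>"] by simp
      next
        case False
        define a where "a = (1 + 3 / 4 * \<epsilon>) * x"
        let ?A = "{nat \<lfloor>a\<rfloor>..<nat \<lfloor>a + \<epsilon> / 4 * x\<rfloor>}"
        have ax: "x \<le> a" "a + \<epsilon> / 4 * x \<le> (1 + \<epsilon>) * x" using x0 \<epsilon> by (auto simp: a_def algebra_simps)
        have b: "real (card ?A) \<ge> \<epsilon> * x / 8" "nat \<lfloor>a\<rfloor> \<ge> M"
          "\<And>n. n \<in> ?A \<Longrightarrow> a < real (Suc n) \<and> real (Suc n) \<le> 2 * x \<and> theta (Suc n) = T"
          using block[OF ax(1) refl ax(2)] by auto
        have "c \<le> real (card ?A) * (\<epsilon> / (16 * x))" by (rule fin[OF b(1)])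
        also have "\<dots> \<le> (\<Sum>n\<in>?A. - f n)"
        proof (rule sum_bounded_below)
          fix n assume n: "n \<in> ?A"
          have "- f n = (real (Suc n) - theta (Suc n)) / (real (Suc n))\<^sup>2"
            by (simp add: f_def minus_divide_left del: of_nat_Suc)
          also have "\<dots> \<ge> \<epsilon> / (16 * x)"
            by (rule est) (use b(3)[OF n] False in \<open>auto simp: algebra_simps a_def\<close>)
          finally show "\<epsilon> / (16 * x) \<le> - f n" .
        qed
        finally show False using M[OF b(2), of "nat \<lfloor>a + \<epsilon> / 4 * x\<rfloor>"] by (simp add: sum_negf)
      qed
    qed
    thus ?thesis by blast
  qed
  from main[of "min \<epsilon> 1"] assms obtain x0 where
    x0: "\<And>x. x \<ge> x0 \<Longrightarrow> \<exists>p. prime p \<and> x < real p \<and> real p \<le> (1 + min \<epsilon> 1) * x" by auto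
  show ?thesis
  proof (intro exI[of _ "max x0 0"] allI impI)
    fix x :: real assume "x \<ge> max x0 0"
    moreover from this x0[of x] obtain p where "prime p" "x < real p" "real p \<le> (1 + min \<epsilon> 1) * x" by auto
    moreover have "(1 + min \<epsilon> 1) * x \<le> (1 + \<epsilon>) * x" using calculation by (intro mult_right_mono) auto
    ultimately show "\<exists>p. prime p \<and> x < real p \<and> real p \<le> (1 + \<epsilon>) * x" by (auto intro!: exI[of _ p])
  qed
qed

section \<open>The upper bound\<close>

lemma C2_free_imp_linear:
  assumes "\<not> contains_Berge H C2_V C2_E C2_ends" "e \<in> H" "f \<in> H" "{x, y} \<subseteq> e \<inter> f" "x \<noteq> y"
  shows "e = f"
proof (rule ccontr)
  assume "e \<noteq> f"
  hence "contains_Berge H C2_V C2_E C2_ends"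
    unfolding contains_Berge_def C2_V_def C2_E_def C2_ends_def using assms
    by (intro exI[of _ "\<lambda>i. if i = 0 then x else y"] exI[of _ "\<lambda>i. if i = 0 then e else f"])
       (auto simp: inj_on_def)
  thus False using assms by blast
qed

lemma C3_free_no_triangle:
  assumes "\<not> contains_Berge H C3_V C3_E C3_ends"
    and "e1 \<in> H" "e2 \<in> H" "e3 \<in> H" "e1 \<noteq> e2" "e2 \<noteq> e3" "e1 \<noteq> e3"
    and "{x, y} \<subseteq> e1" "{y, z} \<subseteq> e2" "{x, z} \<subseteq> e3" "x \<noteq> y" "y \<noteq> z" "x \<noteq> z"
  shows False
proof -
  have "contains_Berge H C3_V C3_E C3_ends"
    unfolding contains_Berge_def C3_V_def C3_E_def C3_ends_def using assms(2-)
    by (intro exI[of _ "\<lambda>i. if i = 0 then x else if i = 1 then y else z"]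
        exI[of _ "\<lambda>i. if i = 0 then e1 else if i = 1 then e2 else e3"])
       (auto simp: inj_on_def)
  thus False using assms by blast
qed

text \<open>Endpoint pairs of the paths of length two with centre v. They are ordered, and the two
  edges must differ because a Berge K_{2,t} needs separate edges from v to x and to y.\<close>

definition cherries :: "'a set set \<Rightarrow> 'a \<Rightarrow> ('a \<times> 'a) set" where
  "cherries H v = {(x, y). \<exists>e\<in>H. \<exists>f\<in>H. e \<noteq> f \<and> v \<in> e \<and> v \<in> f \<and> x \<in> e - {v} \<and> y \<in> f - {v}}"

text \<open>The 2 t edges are automatically distinct. If E v = E w, this edge together with F v and
  F w forms a triangle on v, w, y, and symmetrically for F. If E v = F w, this edge shares v and y
  with F v, against linearity.\<close>

lemma card_common_neighbours_le:
  assumes C2: "\<not> contains_Berge H C2_V C2_E C2_ends" and C3: "\<not> contains_Berge H C3_V C3_E C3_ends"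
    and K: "\<not> contains_Berge H (K2t_V t) (K2t_E t) K2t_ends"
    and "x \<noteq> y" "t > 0"
  shows "card {v \<in> A. (x, y) \<in> cherries H v} \<le> t - 1"
proof (rule ccontr)
  assume "\<not> ?thesis"
  hence "t \<le> card {v \<in> A. (x, y) \<in> cherries H v}" by simp
  then obtain S where S: "S \<subseteq> {v \<in> A. (x, y) \<in> cherries H v}" "card S = t" "finite S"
    by (rule obtain_subset_with_card_n)
  have "\<forall>v\<in>S. \<exists>e f. e \<in> H \<and> f \<in> H \<and> e \<noteq> f \<and> v \<in> e \<and> v \<in> f \<and> x \<in> e - {v} \<and> y \<in> f - {v}"
  proof
    fix v assume "v \<in> S"
    hence "(x, y) \<in> cherries H v" using S(1) by auto
    thus "\<exists>e f. e \<in> H \<and> f \<in> H \<and> e \<noteq> f \<and> v \<in> e \<and> v \<in> f \<and> x \<in> e - {v} \<and> y \<in> f - {v}"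
      unfolding cherries_def by auto
  qed
  then obtain E F where EF: "\<And>v. v \<in> S \<Longrightarrow> E v \<in> H \<and> F v \<in> H \<and> E v \<noteq> F v \<and> v \<in> E v \<and> v \<in> F v \<and> x \<in> E v - {v} \<and> y \<in> F v - {v}"
    by metis
  note lin = C2_free_imp_linear[OF C2]
  have injE: "E v \<noteq> E w" if "v \<in> S" "w \<in> S" "v \<noteq> w" for v w
  proof
    assume eq: "E v = E w"
    have "F v \<noteq> F w" using lin[of "E v" "F v" v w] EF[OF that(1)] EF[OF that(2)] that eq by auto
    thus False
      using C3_free_no_triangle[OF C3, of "E v" "F w" "F v" v w y] EF[OF that(1)] EF[OF that(2)] that eq by auto
  qed
  have injF: "F v \<noteq> F w" if "v \<in> S" "w \<in> S" "v \<noteq> w" for v w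
  proof
    assume eq: "F v = F w"
    have "E v \<noteq> E w" using lin[of "E v" "F v" v w] EF[OF that(1)] EF[OF that(2)] that eq by auto
    thus False
      using C3_free_no_triangle[OF C3, of "F v" "E w" "E v" v w x] EF[OF that(1)] EF[OF that(2)] that eq by auto
  qed
  have dist: "E v \<noteq> F w" if "v \<in> S" "w \<in> S" for v w
    using lin[of "E v" "F v" y v] EF[OF that(1)] EF[OF that(2)] by auto
  obtain g where g: "bij_betw g {2..<t+2} S"
    using finite_same_card_bij[of "{2..<t+2}" S] S by auto
  have gS: "g k \<in> S" if "k \<in> {2..<t+2}" for k using g that by (auto simp: bij_betw_def)
  have ginj: "g k = g l \<longleftrightarrow> k = l" if "k \<in> {2..<t+2}" "l \<in> {2..<t+2}" for k l
    using g that by (auto simp: bij_betw_def inj_on_def)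
  have xy: "x \<notin> S" "y \<notin> S" using EF by auto
  define phi where "phi k = (if k = 0 then x else if k = 1 then y else g k)" for k :: nat
  define f where "f e = (if fst e = 0 then E (g (snd e)) else F (g (snd e)))" for e :: "nat \<times> nat"
  have "inj_on phi (K2t_V t)"
  proof (rule inj_onI)
    fix k l assume "k \<in> K2t_V t" "l \<in> K2t_V t" "phi k = phi l"
    thus "k = l"
      using gS[of k] gS[of l] ginj[of k l] xy \<open>x \<noteq> y\<close>
      by (auto simp: K2t_V_def phi_def split: if_splits)
  qed
  moreover have "inj_on f (K2t_E t)"
  proof (rule inj_onI)
    fix a b assume ab: "a \<in> K2t_E t" "b \<in> K2t_E t" "f a = f b"
    obtain i k j l where eq: "a = (i, k)" "b = (j, l)" by (cases a; cases b) auto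
    have ij: "i = 0 \<or> i = 1" "j = 0 \<or> j = 1" "k \<in> {2..<t+2}" "l \<in> {2..<t+2}"
      using ab by (auto simp: K2t_E_def eq)
    have "i = j"
      using ij ab(3) dist[of "g k" "g l"] dist[of "g l" "g k"] gS[OF ij(3)] gS[OF ij(4)]
      by (auto simp: f_def eq)
    moreover have "g k = g l"
    proof (rule ccontr)
      assume "g k \<noteq> g l"
      thus False
        using ij(1) ab(3) \<open>i = j\<close> injE[OF gS[OF ij(3)] gS[OF ij(4)]] injF[OF gS[OF ij(3)] gS[OF ij(4)]]
        by (auto simp: f_def eq)
    qed
    ultimately show "a = b" using ginj[OF ij(3,4)] by (simp add: eq)
  qed
  moreover have "f ` K2t_E t \<subseteq> H" using EF gS by (auto simp: f_def K2t_E_def)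
  moreover have "\<forall>e\<in>K2t_E t. phi ` K2t_ends e \<subseteq> f e"
    using EF gS by (auto simp: f_def K2t_E_def K2t_ends_def phi_def)
  ultimately show False using K unfolding contains_Berge_def by blast
qed

text \<open>There are d^2 - d ordered pairs of distinct edges through v, each with (r - 1)^2
  endpoint pairs, and linearity recovers the two edges from v, x and y. The subtraction of natural
  numbers does not truncate, since d \<le> d^2.\<close>

lemma card_cherries:
  assumes C2: "\<not> contains_Berge H C2_V C2_E C2_ends" and "finite H"
    and card: "\<And>e. e \<in> H \<Longrightarrow> finite e \<and> card e = r"
  shows "card (cherries H v) = (card {e \<in> H. v \<in> e})\<^sup>2 * (r - 1)\<^sup>2 - card {e \<in> H. v \<in> e} * (r - 1)\<^sup>2"
proof -
  define Hv where "Hv = {e \<in> H. v \<in> e}"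
  define P where "P = Hv \<times> Hv - (\<lambda>e. (e, e)) ` Hv"
  have memP: "fst q \<in> H \<and> snd q \<in> H \<and> v \<in> fst q \<and> v \<in> snd q \<and> fst q \<noteq> snd q" if "q \<in> P" for q
  proof -
    obtain e f where q: "q = (e, f)" by (cases q)
    have "e \<in> Hv" "f \<in> Hv" "e \<noteq> f" using that unfolding P_def q by blast+
    thus ?thesis by (simp add: q Hv_def)
  qed
  have finHv: "finite Hv" using \<open>finite H\<close> by (simp add: Hv_def)
  have finP: "finite P" using finHv by (simp add: P_def)
  have "card P = card (Hv \<times> Hv) - card ((\<lambda>e. (e, e)) ` Hv)"
    unfolding P_def using finHv by (intro card_Diff_subset) auto
  also have "card ((\<lambda>e. (e, e)) ` Hv) = card Hv" by (rule card_image) (simp add: inj_on_def)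
  finally have cardP: "card P = (card Hv)\<^sup>2 - card Hv" by (simp add: card_cartesian_product power2_eq_square)
  note lin = C2_free_imp_linear[OF C2]
  have inj: "inj_on snd (SIGMA p:P. (fst p - {v}) \<times> (snd p - {v}))"
  proof (rule inj_onI)
    fix a b assume ab: "a \<in> (SIGMA p:P. (fst p - {v}) \<times> (snd p - {v}))"
      "b \<in> (SIGMA p:P. (fst p - {v}) \<times> (snd p - {v}))" "snd a = snd b"
    obtain e f e' f' x y where eq: "a = ((e, f), (x, y))" "b = ((e', f'), (x, y))"
      using ab(3) by (cases a; cases b) auto
    show "a = b"
      using ab lin[of e e' x v] lin[of f f' y v] unfolding eq by (auto simp: P_def Hv_def)
  qed
  have "cherries H v = snd ` (SIGMA p:P. (fst p - {v}) \<times> (snd p - {v}))"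
  proof (intro equalityI subsetI)
    fix q assume "q \<in> cherries H v"
    then obtain x y e f where "q = (x, y)" "e \<in> H" "f \<in> H" "e \<noteq> f" "v \<in> e" "v \<in> f" "x \<in> e - {v}" "y \<in> f - {v}"
      unfolding cherries_def by blast
    thus "q \<in> snd ` (SIGMA p:P. (fst p - {v}) \<times> (snd p - {v}))"
      by (intro image_eqI[of _ _ "((e, f), (x, y))"]) (auto simp: P_def Hv_def)
  next
    fix q assume "q \<in> snd ` (SIGMA p:P. (fst p - {v}) \<times> (snd p - {v}))"
    then obtain c where c: "c \<in> (SIGMA p:P. (fst p - {v}) \<times> (snd p - {v}))" "q = snd c" by blast
    obtain e f x y where c': "c = ((e, f), (x, y))" by (metis surj_pair)
    have "(e, f) \<in> P" "x \<in> e - {v}" "y \<in> f - {v}" using c(1) unfolding c' by auto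
    hence "e \<in> H" "f \<in> H" "v \<in> e" "v \<in> f" "e \<noteq> f" using memP[of "(e, f)"] by simp_all
    thus "q \<in> cherries H v"
      using \<open>x \<in> e - {v}\<close> \<open>y \<in> f - {v}\<close> unfolding c(2) c' cherries_def by auto
  qed
  hence "card (cherries H v) = card (snd ` (SIGMA p:P. (fst p - {v}) \<times> (snd p - {v})))"
    by (rule arg_cong)
  also have "\<dots> = card (SIGMA p:P. (fst p - {v}) \<times> (snd p - {v}))"
    by (rule card_image[OF inj])
  also have "\<dots> = (\<Sum>p\<in>P. card ((fst p - {v}) \<times> (snd p - {v})))"
  proof (rule card_SigmaI[OF finP], rule ballI)
    fix q assume "q \<in> P"
    hence "fst q \<in> H" "snd q \<in> H" using memP by blast+
    hence "finite (fst q)" "finite (snd q)" using card by blast+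
    thus "finite ((fst q - {v}) \<times> (snd q - {v}))" by (intro finite_cartesian_product finite_Diff)
  qed
  also have "\<dots> = (\<Sum>p\<in>P. (r - 1)\<^sup>2)"
  proof (rule sum.cong[OF refl])
    fix q assume "q \<in> P"
    hence q: "v \<in> fst q" "v \<in> snd q" "fst q \<in> H" "snd q \<in> H" using memP by blast+
    hence "card (fst q) = r" "card (snd q) = r" using card by blast+
    with q(1,2) show "card ((fst q - {v}) \<times> (snd q - {v})) = (r - 1)\<^sup>2"
      by (simp add: card_cartesian_product power2_eq_square)
  qed
  also have "\<dots> = ((card Hv)\<^sup>2 - card Hv) * (r - 1)\<^sup>2" by (simp add: cardP)
  finally show ?thesis by (simp add: Hv_def diff_mult_distrib)
qed

text \<open>Every ordered pair of distinct vertices lies in at most t - 1 of the sets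
  \<open>cherries H v\<close>, so (r - 1)^2 times the sum of d(v)^2 - d(v) is at most n^2 (t - 1).
  Cauchy-Schwarz passes to the average degree m.\<close>

theorem card_C2_C3_K2t_free_le:
  assumes H: "uniform_hg r n H" and free: "free_C2_C3_K2t t H" and "r \<ge> 2" "t > 0"
  shows "real (card H) \<le> sqrt (real (t - 1)) / (real r * (real r - 1)) * real n powr (3/2) + real n / real r"
proof (cases "n = 0")
  case True
  have "e \<notin> H" for e using H True \<open>r \<ge> 2\<close> by (auto simp: uniform_hg_def)
  hence "H = {}" by blast
  thus ?thesis using True by simp
next
  case False
  have C2: "\<not> contains_Berge H C2_V C2_E C2_ends" and C3: "\<not> contains_Berge H C3_V C3_E C3_ends"
    and K: "\<not> contains_Berge H (K2t_V t) (K2t_E t) K2t_ends"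
    using free by (auto simp: free_C2_C3_K2t_def)
  have "H \<subseteq> Pow {..<n}" using H by (auto simp: uniform_hg_def)
  hence finH: "finite H" by (rule finite_subset) simp
  have card: "finite e \<and> card e = r" if "e \<in> H" for e
    using H that finite_subset[of e "{..<n}"] by (auto simp: uniform_hg_def)
  define d where "d v = card {e \<in> H. v \<in> e}" for v
  have sum_d: "(\<Sum>v<n. d v) = r * card H"
  proof -
    have "(\<Sum>v<n. d v) = (\<Sum>e\<in>H. r)" unfolding d_def
    proof (rule sum_multicount_gen)
      show "\<forall>e\<in>H. card {v \<in> {..<n}. v \<in> e} = r"
      proof
        fix e assume e: "e \<in> H"
        hence "{v \<in> {..<n}. v \<in> e} = e" using H by (auto simp: uniform_hg_def)
        thus "card {v \<in> {..<n}. v \<in> e} = r" using card[OF e] by simp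
      qed
    qed (use finH in auto)
    thus ?thesis by simp
  qed
  have cher: "cherries H v \<subseteq> {..<n} \<times> {..<n} \<inter> {p. fst p \<noteq> snd p}" for v
  proof
    fix p assume "p \<in> cherries H v"
    then obtain x y e f where p: "p = (x, y)" "e \<in> H" "f \<in> H" "e \<noteq> f" "v \<in> e" "v \<in> f" "x \<in> e - {v}" "y \<in> f - {v}"
      by (auto simp: cherries_def)
    moreover have "x \<noteq> y" using C2_free_imp_linear[OF C2, of e f x v] p by auto
    ultimately show "p \<in> {..<n} \<times> {..<n} \<inter> {p. fst p \<noteq> snd p}"
      using H by (auto simp: uniform_hg_def)
  qed
  let ?Q = "{..<n} \<times> {..<n} \<inter> {p. fst p \<noteq> snd p}"
  have finQ: "finite ?Q" by simp
  have "(\<Sum>v<n. card (cherries H v)) = (\<Sum>v<n. card {p \<in> ?Q. p \<in> cherries H v})"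
    using cher by (intro sum.cong refl arg_cong[of _ _ card]) auto
  also have "\<dots> = (\<Sum>p\<in>?Q. card {v \<in> {..<n}. p \<in> cherries H v})"
    by (rule sum_multicount_gen) auto
  also have "\<dots> \<le> (\<Sum>p\<in>?Q. t - 1)"
  proof (rule sum_mono)
    fix p assume "p \<in> ?Q"
    thus "card {v \<in> {..<n}. p \<in> cherries H v} \<le> t - 1"
      using card_common_neighbours_le[OF C2 C3 K _ \<open>t > 0\<close>, of "fst p" "snd p" "{..<n}"] by simp
  qed
  also have "\<dots> = card ?Q * (t - 1)" by simp
  also have "\<dots> \<le> n\<^sup>2 * (t - 1)"
  proof -
    have "card ?Q \<le> card ({..<n} \<times> {..<n})" by (rule card_mono) auto
    thus ?thesis by (simp add: card_cartesian_product power2_eq_square)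
  qed
  finally have "real (\<Sum>v<n. card (cherries H v)) \<le> real (n\<^sup>2 * (t - 1))" by (simp only: of_nat_le_iff)
  moreover have "real (card (cherries H v)) = (real r - 1)\<^sup>2 * ((real (d v))\<^sup>2 - real (d v))" for v
  proof -
    have "d v * (r - 1)\<^sup>2 \<le> (d v)\<^sup>2 * (r - 1)\<^sup>2" 
      unfolding power2_eq_square[of "d v"] by (intro mult_right_mono le_square) simp
    thus ?thesis
      using card_cherries[OF C2 finH card, of v] \<open>r \<ge> 2\<close>
      by (simp add: d_def[symmetric] of_nat_diff algebra_simps)
  qed
  ultimately have ineq: "(real r - 1)\<^sup>2 * ((\<Sum>v<n. (real (d v))\<^sup>2) - (\<Sum>v<n. real (d v))) \<le> (real n)\<^sup>2 * real (t - 1)"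
    by (simp add: sum_distrib_left[symmetric] sum_subtractf)
  define m where "m = real r * real (card H) / real n"
  have sd: "(\<Sum>v<n. real (d v)) = real n * m"
  proof -
    have "(\<Sum>v<n. real (d v)) = real (r * card H)" unfolding sum_d[symmetric] by simp
    thus ?thesis using False by (simp add: m_def)
  qed
  have "(\<Sum>v<n. real (d v))\<^sup>2 \<le> (\<Sum>v<n. (real (d v))\<^sup>2) * real n"
    using sum_squared_le_sum_of_squares[of "\<lambda>v. real (d v)" "{..<n}"] by simp
  hence "real n * m\<^sup>2 \<le> (\<Sum>v<n. (real (d v))\<^sup>2)"
    unfolding sd using False by (simp add: power2_eq_square mult_ac)
  hence "(real r - 1)\<^sup>2 * (real n * m\<^sup>2 - real n * m) \<le> (real r - 1)\<^sup>2 * ((\<Sum>v<n. (real (d v))\<^sup>2) - (\<Sum>v<n. real (d v)))"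
    unfolding sd by (intro mult_left_mono) auto
  with ineq have "real n * ((real r - 1)\<^sup>2 * (m\<^sup>2 - m)) \<le> real n * (real n * real (t - 1))"
    by (simp add: algebra_simps power2_eq_square)
  hence quad: "(real r - 1)\<^sup>2 * (m\<^sup>2 - m) \<le> real n * real (t - 1)" using False by simp
  have "m \<le> sqrt (real (t - 1)) * sqrt (real n) / (real r - 1) + 1"
  proof (cases "m \<le> 1")
    case True
    moreover have "0 \<le> sqrt (real (t - 1)) * sqrt (real n) / (real r - 1)"
      using \<open>r \<ge> 2\<close> by simp
    ultimately show ?thesis by linarith
  next
    case False
    \<comment> \<open>Weakening m^2 - m to (m - 1)^2 avoids solving the quadratic inequality; the
      resulting summand 1 in the bound for m becomes the term n / r.\<close>
    hence "(m - 1)\<^sup>2 \<le> m\<^sup>2 - m" by (simp add: power2_eq_square algebra_simps)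
    hence "((real r - 1) * (m - 1))\<^sup>2 \<le> (real r - 1)\<^sup>2 * (m\<^sup>2 - m)"
      unfolding power_mult_distrib by (rule mult_left_mono) simp
    also note quad
    finally have "(real r - 1) * (m - 1) \<le> sqrt (real n * real (t - 1))" by (rule real_le_rsqrt)
    thus ?thesis using \<open>r \<ge> 2\<close> by (simp add: real_sqrt_mult field_simps)
  qed
  hence "m * real n / real r \<le> (sqrt (real (t - 1)) * sqrt (real n) / (real r - 1) + 1) * real n / real r"
    by (intro divide_right_mono mult_right_mono) auto
  also have "m * real n / real r = real (card H)" using False \<open>r \<ge> 2\<close> by (simp add: m_def)
  also have "real n powr (3/2) = real n * sqrt (real n)"
    using powr_add[of "real n" 1 "1/2"] False by (simp add: powr_half_sqrt)
  hence "(sqrt (real (t - 1)) * sqrt (real n) / (real r - 1) + 1) * real n / real r =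
     sqrt (real (t - 1)) / (real r * (real r - 1)) * real n powr (3/2) + real n / real r"
    using \<open>r \<ge> 2\<close> by (simp add: field_simps)
  finally show ?thesis .
qed

section \<open>The construction\<close>

locale parabola_hypergraph =
  fixes r p :: nat
  assumes prime_p: "prime p" and odd_p: "odd p" and r_le_p: "r \<le> p" and r_ge: "r \<ge> 3"
begin

text \<open>Mixed-radix code of the vertex (i, s, t) with part i < r and first coordinate s < p. The
  last digit is unbounded, so \<open>part\<close>, \<open>fc\<close> and \<open>sc\<close> decode
  every natural number; the vertices of the construction are those with
  \<open>sc u < p\<close>.\<close>

definition enc :: "nat \<Rightarrow> nat \<Rightarrow> nat \<Rightarrow> nat" where "enc i s t = i + r * (s + p * t)"
definition part :: "nat \<Rightarrow> nat" where "part u = u mod r"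
definition fc :: "nat \<Rightarrow> nat" where "fc u = u div r mod p"
definition sc :: "nat \<Rightarrow> nat" where "sc u = u div r div p"

lemma enc_decode [simp]:
  assumes "i < r" "s < p"
  shows "part (enc i s t) = i" "fc (enc i s t) = s" "sc (enc i s t) = t"
  using assms r_ge by (simp_all add: enc_def part_def fc_def sc_def)

lemma decode_enc: "enc (part u) (fc u) (sc u) = u"
  by (simp add: enc_def part_def fc_def sc_def)

definition edge :: "nat \<times> nat \<times> nat \<Rightarrow> nat set" where
  "edge = (\<lambda>(x, y, z). (\<lambda>i. enc i ((x + i * y) mod p) ((z + i * y\<^sup>2) mod p)) ` {..<r})"

definition hyp :: "nat set set" where "hyp = edge ` ({..<p} \<times> {..<p} \<times> {..<p})"

text \<open>The relation between two vertices of an edge with parameter y, from which x and z have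
  cancelled: the coordinate differences are the part difference times (y, y^2) modulo p. Integers
  are used so that differences make sense.\<close>

definition joined :: "nat \<Rightarrow> nat \<Rightarrow> nat \<Rightarrow> bool" where
  "joined u v y \<longleftrightarrow> part u \<noteq> part v \<and> part u < r \<and> part v < r \<and> sc u < p \<and> sc v < p
     \<and> int p dvd (int (fc u) - int (fc v)) - (int (part u) - int (part v)) * int y
     \<and> int p dvd (int (sc u) - int (sc v)) - (int (part u) - int (part v)) * (int y)\<^sup>2"

lemma p_pos: "p > 0" using prime_p by (simp add: prime_gt_0_nat)

lemma prime_int: "prime (int p)" using prime_p by simp

lemma fc_less: "fc u < p" using p_pos by (simp add: fc_def)

lemma dvd_diff_small:
  assumes "int p dvd int a - int b" "a < p" "b < p"
  shows "a = b"
proof (rule ccontr)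
  assume "a \<noteq> b"
  hence "\<bar>int p\<bar> \<le> \<bar>int a - int b\<bar>" using assms by (intro dvd_imp_le_int) auto
  thus False using assms by linarith
qed

text \<open>Two parts below r \<le> p differ by less than p; this makes part differences cancellable
  modulo p.\<close>

lemma not_dvd_part_diff:
  assumes "part u \<noteq> part v" "part u < r" "part v < r"
  shows "\<not> int p dvd int (part u) - int (part v)"
  using dvd_diff_small[of "part u" "part v"] assms r_le_p by auto

lemma mem_edge:
  assumes "u \<in> edge (x, y, z)"
  shows "part u < r" "fc u = (x + part u * y) mod p" "sc u = (z + part u * y\<^sup>2) mod p"
  using assms p_pos by (auto simp: edge_def)

lemma dvd_mod_diff: "int p dvd int (a mod p) - int a"
  by (simp add: zmod_int mod_eq_dvd_iff[symmetric])

lemma mem_edge_dvd: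
  assumes "u \<in> edge (x, y, z)"
  shows "int p dvd int (fc u) - (int x + int (part u) * int y)"
    and "int p dvd int (sc u) - (int z + int (part u) * (int y)\<^sup>2)"
  using dvd_mod_diff[of "x + part u * y"] dvd_mod_diff[of "z + part u * y\<^sup>2"]
  by (simp_all add: mem_edge(2,3)[OF assms])

lemma sc_less: "u \<in> edge (x, y, z) \<Longrightarrow> sc u < p"
  using mem_edge(3) p_pos by simp

lemma edge_joined:
  assumes "u \<in> edge (x, y, z)" "v \<in> edge (x, y, z)" "u \<noteq> v"
  shows "joined u v y"
proof -
  have "part u \<noteq> part v"
    using mem_edge[OF assms(1)] mem_edge[OF assms(2)] decode_enc[of u] decode_enc[of v] assms(3) by metis
  moreover have "int p dvd (int (fc u) - int (fc v)) - (int (part u) - int (part v)) * int y"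
    using dvd_diff[OF mem_edge_dvd(1)[OF assms(1)] mem_edge_dvd(1)[OF assms(2)]]
    by (simp add: algebra_simps)
  moreover have "int p dvd (int (sc u) - int (sc v)) - (int (part u) - int (part v)) * (int y)\<^sup>2"
    using dvd_diff[OF mem_edge_dvd(2)[OF assms(1)] mem_edge_dvd(2)[OF assms(2)]]
    by (simp add: algebra_simps)
  ultimately show ?thesis
    using mem_edge(1)[OF assms(1)] mem_edge(1)[OF assms(2)] sc_less assms by (auto simp: joined_def)
qed

lemma joined_unique:
  assumes "joined u v y" "joined u v y'"
  shows "int p dvd int y - int y'"
proof -
  have "int p dvd (int (part u) - int (part v)) * (int y - int y')"
    using assms dvd_diff[of "int p" "(int (fc u) - int (fc v)) - (int (part u) - int (part v)) * int y'"
        "(int (fc u) - int (fc v)) - (int (part u) - int (part v)) * int y"]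
    unfolding joined_def by (simp add: algebra_simps)
  thus ?thesis
    using prime_dvd_multD[OF prime_int] not_dvd_part_diff assms unfolding joined_def by blast
qed

text \<open>Once y is known, any one vertex of the edge gives x and z back modulo p.\<close>

lemma edge_determined:
  assumes "u \<in> edge (x, y, z)" "u \<in> edge (x', y', z')" "int p dvd int y - int y'"
    and "x < p" "y < p" "z < p" "x' < p" "y' < p" "z' < p"
  shows "x = x' \<and> y = y' \<and> z = z'"
proof -
  have y: "y = y'" using dvd_diff_small[OF assms(3)] assms by simp
  have "int p dvd int x - int x'" "int p dvd int z - int z'"
    using dvd_diff[OF mem_edge_dvd(1)[OF assms(2)] mem_edge_dvd(1)[OF assms(1)]]
      dvd_diff[OF mem_edge_dvd(2)[OF assms(2)] mem_edge_dvd(2)[OF assms(1)]]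
    by (simp_all add: y)
  thus ?thesis using y dvd_diff_small assms by blast
qed

lemma vertex_eqI:
  assumes "part u = part v" "int p dvd int (fc u) - int (fc v)" "int p dvd int (sc u) - int (sc v)" "sc u < p" "sc v < p"
  shows "u = v"
proof -
  have "fc u = fc v" "sc u = sc v"
    using dvd_diff_small[OF assms(2)] dvd_diff_small[OF assms(3)] fc_less assms by blast+
  hence "enc (part u) (fc u) (sc u) = enc (part v) (fc v) (sc v)" using assms(1) by (simp only:)
  thus ?thesis by (simp only: decode_enc)
qed

lemma hyp_joined:
  assumes "e \<in> hyp" "u \<in> e" "v \<in> e" "u \<noteq> v"
  obtains x y z where "e = edge (x, y, z)" "x < p" "y < p" "z < p" "joined u v y"
proof -
  from assms(1) obtain x y z where e: "e = edge (x, y, z)" "x < p" "y < p" "z < p"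
    unfolding hyp_def by auto
  moreover have "joined u v y" using assms e edge_joined by blast
  ultimately show ?thesis using that by blast
qed

lemma uniform_hyp:
  assumes "r * p\<^sup>2 \<le> n"
  shows "uniform_hg r n hyp"
  unfolding uniform_hg_def
proof
  fix e assume "e \<in> hyp"
  then obtain x y z where e: "e = edge (x, y, z)" unfolding hyp_def by auto
  have "card e = r"
  proof -
    have "inj_on (\<lambda>i. enc i ((x + i * y) mod p) ((z + i * y\<^sup>2) mod p)) {..<r}"
    proof (rule inj_onI)
      fix i j assume "i \<in> {..<r}" "j \<in> {..<r}"
        "enc i ((x + i * y) mod p) ((z + i * y\<^sup>2) mod p) = enc j ((x + j * y) mod p) ((z + j * y\<^sup>2) mod p)"
      thus "i = j" using p_pos by (metis enc_decode(1) lessThan_iff mod_less_divisor)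
    qed
    thus ?thesis unfolding e edge_def by (simp add: card_image)
  qed
  moreover have "e \<subseteq> {..<n}"
  proof
    fix u assume u: "u \<in> e"
    have "part u < r" "sc u < p" "fc u < p" using mem_edge(1) sc_less fc_less u e by auto
    have "fc u + p * sc u \<le> (p - 1) + p * (p - 1)"
      using \<open>sc u < p\<close> \<open>fc u < p\<close> by (intro add_mono mult_mono) auto
    also have "\<dots> < p * p" using p_pos by (cases p) auto
    finally have "fc u + p * sc u < p * p" .
    hence "Suc (fc u + p * sc u) * r \<le> p * p * r" by (intro mult_right_mono) auto
    hence "enc (part u) (fc u) (sc u) < r * (p * p)"
      using \<open>part u < r\<close> unfolding enc_def by (simp add: algebra_simps)
    thus "u \<in> {..<n}" using assms by (simp add: decode_enc power2_eq_square)
  qed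
  ultimately show "e \<subseteq> {..<n} \<and> card e = r" by blast
qed

lemma hyp_linear:
  assumes "e \<in> hyp" "f \<in> hyp" "u \<noteq> v" "{u, v} \<subseteq> e" "{u, v} \<subseteq> f"
  shows "e = f"
proof -
  obtain x y z where e: "e = edge (x, y, z)" "x < p" "y < p" "z < p" "joined u v y"
    using hyp_joined[of e u v] assms by auto
  obtain x' y' z' where f: "f = edge (x', y', z')" "x' < p" "y' < p" "z' < p" "joined u v y'"
    using hyp_joined[of f u v] assms by auto
  show ?thesis
    using edge_determined[of u x y z x' y' z'] joined_unique[OF e(5) f(5)] e f assms by auto
qed

lemma card_hyp: "card hyp = p ^ 3"
proof -
  have "inj_on edge ({..<p} \<times> {..<p} \<times> {..<p})"
  proof (rule inj_onI)
    fix a b assume ab: "a \<in> {..<p} \<times> {..<p} \<times> {..<p}" "b \<in> {..<p} \<times> {..<p} \<times> {..<p}" "edge a = edge b"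
    obtain x y z x' y' z' where a: "a = (x, y, z)" and b: "b = (x', y', z')"
      by (cases a; cases b) auto
    have *: "x < p" "y < p" "z < p" "x' < p" "y' < p" "z' < p" using ab by (auto simp: a b)
    have eq: "edge (x, y, z) = edge (x', y', z')" using ab(3) by (simp add: a b)
    \<comment> \<open>The vertices of the edge in parts 0 and 1: two vertices suffice to recover the
      parameter y, and with it the edge.\<close>
    define u where "u = enc 0 ((x + 0 * y) mod p) ((z + 0 * y\<^sup>2) mod p)"
    define v where "v = enc 1 ((x + 1 * y) mod p) ((z + 1 * y\<^sup>2) mod p)"
    have uv: "u \<in> edge (x, y, z)" "v \<in> edge (x, y, z)"
      unfolding edge_def prod.case u_def v_def using r_ge by (intro imageI; simp)+
    have "part u = 0" "part v = 1"
      unfolding u_def v_def using r_ge p_pos by simp_all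
    hence "u \<noteq> v" by auto
    hence "joined u v y" "joined u v y'"
      using edge_joined[OF uv] edge_joined[OF uv[unfolded eq]] by blast+
    hence "int p dvd int y - int y'" by (rule joined_unique)
    from edge_determined[OF uv(1) uv(1)[unfolded eq] this] *
    show "a = b" unfolding a b by blast
  qed
  thus ?thesis unfolding hyp_def by (simp add: card_image card_cartesian_product power3_eq_cube)
qed

section \<open>Absence of the forbidden configurations\<close>

lemma C2_free: "\<not> contains_Berge hyp C2_V C2_E C2_ends"
proof
  assume "contains_Berge hyp C2_V C2_E C2_ends"
  then obtain phi f where pf: "inj_on phi C2_V" "inj_on f C2_E" "f ` C2_E \<subseteq> hyp"
    "\<forall>e\<in>C2_E. phi ` C2_ends e \<subseteq> f e" unfolding contains_Berge_def by blast
  have "phi 0 \<noteq> phi 1" "f 0 \<noteq> f 1" using pf(1,2) by (auto simp: inj_on_def C2_V_def C2_E_def)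
  moreover have "f 0 = f 1"
    by (rule hyp_linear[of "f 0" "f 1" "phi 0" "phi 1"])
       (use pf \<open>phi 0 \<noteq> phi 1\<close> in \<open>auto simp: C2_E_def C2_ends_def\<close>)
  ultimately show False by blast
qed

text \<open>The equality case of Cauchy-Schwarz modulo q: by the two congruences (a + b) (a x^2 + b
  y^2) - (a x + b y)^2 becomes (a + b)^2 z^2 - (a + b)^2 z^2 = 0, while identically it is a b (x -
  y)^2.\<close>

lemma triangle_identity:
  fixes a b x y z q :: int
  assumes q: "prime q" and "q dvd (a * x + b * y) - (a + b) * z" "q dvd (a * x\<^sup>2 + b * y\<^sup>2) - (a + b) * z\<^sup>2"
    and "\<not> q dvd a" "\<not> q dvd b"
  shows "q dvd x - y"
proof -
  obtain k where k: "a * x + b * y = (a + b) * z + q * k" using assms(2) by (metis dvdE diff_eq_eq add.commute)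
  obtain l where l: "a * x\<^sup>2 + b * y\<^sup>2 = (a + b) * z\<^sup>2 + q * l" using assms(3) by (metis dvdE diff_eq_eq add.commute)
  have "a * b * (x - y)\<^sup>2 = (a + b) * (a * x\<^sup>2 + b * y\<^sup>2) - (a * x + b * y)\<^sup>2"
    by (simp add: algebra_simps power2_eq_square)
  also have "\<dots> = q * ((a + b) * l - 2 * (a + b) * z * k - q * k\<^sup>2)"
    unfolding k l by (simp add: algebra_simps power2_eq_square)
  finally have "q dvd a * b * (x - y)\<^sup>2" by simp
  thus ?thesis using assms by (auto dest!: prime_dvd_multD[OF q] prime_dvd_power[OF q])
qed

text \<open>Going round the triangle u, v, w, the relation of the third edge minus those of the
  first two gives the congruences of \<open>triangle_identity\<close>, with part differences as
  weights. Hence the two edges through v have the same parameter and coincide.\<close>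

lemma C3_free: "\<not> contains_Berge hyp C3_V C3_E C3_ends"
proof
  assume "contains_Berge hyp C3_V C3_E C3_ends"
  then obtain phi f where pf: "inj_on phi C3_V" "inj_on f C3_E" "f ` C3_E \<subseteq> hyp"
    "\<forall>e\<in>C3_E. phi ` C3_ends e \<subseteq> f e" unfolding contains_Berge_def by blast
  define u v w where "u = phi 0" and "v = phi 1" and "w = phi 2"
  have ne: "u \<noteq> v" "v \<noteq> w" "u \<noteq> w" using pf(1) by (auto simp: inj_on_def C3_V_def u_def v_def w_def)
  have fne: "f 0 \<noteq> f 1" using pf(2) by (auto simp: inj_on_def C3_E_def)
  have fin: "f 0 \<in> hyp" "f 1 \<in> hyp" "f 2 \<in> hyp" using pf(3) by (auto simp: C3_E_def)
  have mem: "u \<in> f 0" "v \<in> f 0" "v \<in> f 1" "w \<in> f 1" "u \<in> f 2" "w \<in> f 2"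
    using pf(4) by (auto simp: C3_E_def C3_ends_def u_def v_def w_def)
  obtain x1 y1 z1 where e1: "f 0 = edge (x1, y1, z1)" "x1 < p" "y1 < p" "z1 < p" "joined u v y1"
    using hyp_joined[OF fin(1) mem(1,2) ne(1)] by blast
  obtain x2 y2 z2 where e2: "f 1 = edge (x2, y2, z2)" "x2 < p" "y2 < p" "z2 < p" "joined v w y2"
    using hyp_joined[OF fin(2) mem(3,4) ne(2)] by blast
  obtain x3 y3 z3 where e3: "joined u w y3"
    using hyp_joined[OF fin(3) mem(5,6) ne(3)] by blast
  let ?a = "int (part u) - int (part v)" and ?b = "int (part v) - int (part w)"
  have "int p dvd int y1 - int y2"
  proof (rule triangle_identity[OF prime_int])
    show "int p dvd (?a * int y1 + ?b * int y2) - (?a + ?b) * int y3"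
      using dvd_diff[OF dvd_diff[of "int p" "(int (fc u) - int (fc w)) - (int (part u) - int (part w)) * int y3"
          "(int (fc u) - int (fc v)) - ?a * int y1"], of "(int (fc v) - int (fc w)) - ?b * int y2"]
        e1(5) e2(5) e3 unfolding joined_def by (simp add: algebra_simps)
    show "int p dvd (?a * (int y1)\<^sup>2 + ?b * (int y2)\<^sup>2) - (?a + ?b) * (int y3)\<^sup>2"
      using dvd_diff[OF dvd_diff[of "int p" "(int (sc u) - int (sc w)) - (int (part u) - int (part w)) * (int y3)\<^sup>2"
          "(int (sc u) - int (sc v)) - ?a * (int y1)\<^sup>2"], of "(int (sc v) - int (sc w)) - ?b * (int y2)\<^sup>2"]
        e1(5) e2(5) e3 unfolding joined_def by (simp add: algebra_simps)
    show "\<not> int p dvd ?a" "\<not> int p dvd ?b"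
      using e1(5) e2(5) not_dvd_part_diff unfolding joined_def by blast+
  qed
  hence "f 0 = f 1"
    using edge_determined[of v x1 y1 z1 x2 y2 z2] e1 e2 mem by auto
  thus False using fne by blast
qed

text \<open>All four part differences equal D. Comparing u with w through v and through v' gives a -
  b = c - d and a^2 - b^2 = c^2 - d^2 modulo p. Since u and w differ, a - b is invertible, so a + b
  = c + d and 2 a = 2 c; as p is odd, a = c and thus v = v'.\<close>

lemma same_part_unique:
  assumes "part u = part w" "u \<noteq> w" "part v = part v'"
    and j: "joined u v a" "joined w v b" "joined u v' c" "joined w v' d"
  shows "v = v'"
proof -
  define D where "D = int (part u) - int (part v)"
  have D: "\<not> int p dvd D" using j(1) not_dvd_part_diff by (auto simp: D_def joined_def)
  have D': "int (part w) - int (part v) = D" "int (part u) - int (part v') = D" "int (part w) - int (part v') = D"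
    using assms by (auto simp: D_def)
  note jd = j[unfolded joined_def D' D_def[symmetric]]
  obtain k1 where k1: "int (fc u) - int (fc v) = D * int a + int p * k1" using jd by (metis dvdE diff_eq_eq add.commute)
  obtain k2 where k2: "int (fc w) - int (fc v) = D * int b + int p * k2" using jd by (metis dvdE diff_eq_eq add.commute)
  obtain k3 where k3: "int (fc u) - int (fc v') = D * int c + int p * k3" using jd by (metis dvdE diff_eq_eq add.commute)
  obtain k4 where k4: "int (fc w) - int (fc v') = D * int d + int p * k4" using jd by (metis dvdE diff_eq_eq add.commute)
  obtain l1 where l1: "int (sc u) - int (sc v) = D * (int a)\<^sup>2 + int p * l1" using jd by (metis dvdE diff_eq_eq add.commute)
  obtain l2 where l2: "int (sc w) - int (sc v) = D * (int b)\<^sup>2 + int p * l2" using jd by (metis dvdE diff_eq_eq add.commute)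
  obtain l3 where l3: "int (sc u) - int (sc v') = D * (int c)\<^sup>2 + int p * l3" using jd by (metis dvdE diff_eq_eq add.commute)
  obtain l4 where l4: "int (sc w) - int (sc v') = D * (int d)\<^sup>2 + int p * l4" using jd by (metis dvdE diff_eq_eq add.commute)
  note pd = prime_dvd_multD[OF prime_int]
  have "D * ((int a - int b) - (int c - int d)) = int p * (k3 - k4 - k1 + k2)"
    using k1 k2 k3 k4 by (simp add: algebra_simps)
  hence "int p dvd D * ((int a - int b) - (int c - int d))" by simp
  hence d1: "int p dvd (int a - int b) - (int c - int d)" using pd D by blast
  have "D * (((int a)\<^sup>2 - (int b)\<^sup>2) - ((int c)\<^sup>2 - (int d)\<^sup>2)) = int p * (l3 - l4 - l1 + l2)"
    using l1 l2 l3 l4 by (simp add: algebra_simps)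
  hence "int p dvd D * (((int a)\<^sup>2 - (int b)\<^sup>2) - ((int c)\<^sup>2 - (int d)\<^sup>2))" by simp
  hence d2: "int p dvd ((int a)\<^sup>2 - (int b)\<^sup>2) - ((int c)\<^sup>2 - (int d)\<^sup>2)" using pd D by blast
  have ab: "\<not> int p dvd int a - int b"
  proof
    assume *: "int p dvd int a - int b"
    have "int (fc u) - int (fc w) = D * (int a - int b) + int p * (k1 - k2)"
      using k1 k2 by (simp add: algebra_simps)
    hence 1: "int p dvd int (fc u) - int (fc w)" using * by simp
    have "int (sc u) - int (sc w) = D * (int a + int b) * (int a - int b) + int p * (l1 - l2)"
      using l1 l2 by (simp add: algebra_simps power2_eq_square)
    hence 2: "int p dvd int (sc u) - int (sc w)" using * by simp
    show False using vertex_eqI[OF assms(1) 1 2] jd assms(2) by blast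
  qed
  have "((int a)\<^sup>2 - (int b)\<^sup>2) - ((int c)\<^sup>2 - (int d)\<^sup>2) =
     (int a - int b) * ((int a + int b) - (int c + int d)) + (int c + int d) * ((int a - int b) - (int c - int d))"
    by (simp add: algebra_simps power2_eq_square)
  hence "int p dvd (int a - int b) * ((int a + int b) - (int c + int d))"
    using d1 d2 by (metis dvd_add_left_iff dvd_mult)
  hence d3: "int p dvd (int a + int b) - (int c + int d)" using pd ab by blast
  have "2 * (int a - int c) = ((int a + int b) - (int c + int d)) + ((int a - int b) - (int c - int d))" by simp
  hence "int p dvd 2 * (int a - int c)" using d1 d3 by (metis dvd_add)
  moreover have "\<not> int p dvd 2"
    using odd_p prime_p by (metis dvd_imp_le_int even_of_nat int_dvd_int_iff of_nat_numeral prime_nat_iff two_is_prime_nat primes_dvd_imp_eq)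
  ultimately have ac: "int p dvd int a - int c" using pd by blast
  have "int (fc v) - int (fc v') = int p * (k3 - k1) - D * (int a - int c)"
    using k1 k3 by (simp add: algebra_simps)
  hence 1: "int p dvd int (fc v) - int (fc v')" using ac by simp
  have "int (sc v) - int (sc v') = int p * (l3 - l1) - D * (int a + int c) * (int a - int c)"
    using l1 l3 by (simp add: algebra_simps power2_eq_square)
  hence 2: "int p dvd int (sc v) - int (sc v')" using ac by simp
  show ?thesis using vertex_eqI[OF assms(3) 1 2] jd by blast
qed

text \<open>Subtracting the equations and cancelling x - y and x - z leaves two linear relations,
  whose difference is A (y - z).\<close>

lemma quadratic_roots:
  fixes A B C x y z q :: int
  assumes q: "prime q" and "\<not> q dvd A"
    and "q dvd A * x\<^sup>2 + B * x + C" "q dvd A * y\<^sup>2 + B * y + C" "q dvd A * z\<^sup>2 + B * z + C"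
  shows "q dvd x - y \<or> q dvd x - z \<or> q dvd y - z"
proof -
  have "q dvd (x - y) * (A * (x + y) + B)"
    using dvd_diff[OF assms(3,4)] by (simp add: algebra_simps power2_eq_square)
  moreover have "q dvd (x - z) * (A * (x + z) + B)"
    using dvd_diff[OF assms(3,5)] by (simp add: algebra_simps power2_eq_square)
  moreover have "q dvd y - z" if "q dvd A * (x + y) + B" "q dvd A * (x + z) + B"
  proof -
    have "q dvd A * (y - z)" using dvd_diff[OF that] by (simp add: algebra_simps)
    thus ?thesis using assms(1,2) prime_dvd_multD by blast
  qed
  ultimately show ?thesis using prime_dvd_multD[OF q] by blast
qed

text \<open>Part and parameter locate v relative to u, so distinct common neighbours in one part
  belong to distinct roots modulo p.\<close>

lemma joined_same_parameter:
  assumes "part v = part v'" "joined u v a" "joined u v' a'" "int p dvd int a - int a'"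
  shows "v = v'"
proof -
  define D where "D = int (part u) - int (part v)"
  have D': "int (part u) - int (part v') = D" using assms by (auto simp: D_def)
  note jd = assms(2,3)[unfolded joined_def D' D_def[symmetric]]
  have e1: "int (fc v) - int (fc v') = ((int (fc u) - int (fc v')) - D * int a') - ((int (fc u) - int (fc v)) - D * int a) - D * (int a - int a')"
    by (simp add: algebra_simps)
  have 1: "int p dvd int (fc v) - int (fc v')"
    unfolding e1 using jd by (intro dvd_diff[OF dvd_diff dvd_mult[OF assms(4)]]) blast+
  have e2: "int (sc v) - int (sc v') = ((int (sc u) - int (sc v')) - D * (int a')\<^sup>2) - ((int (sc u) - int (sc v)) - D * (int a)\<^sup>2) - D * (int a + int a') * (int a - int a')"
    by (simp add: algebra_simps power2_eq_square)
  have 2: "int p dvd int (sc v) - int (sc v')"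
    unfolding e2 using jd by (intro dvd_diff[OF dvd_diff dvd_mult[OF assms(4)]]) blast+
  show ?thesis using vertex_eqI[OF assms(1) 1 2] jd by blast
qed

text \<open>Eliminating the parameter of the edge through \<open>w\<close> leaves a quadratic equation for the
  parameter of the edge through \<open>u\<close>.\<close>

lemma different_part_quadratic:
  assumes "part u \<noteq> part w" "joined u v a" "joined w v b"
  defines "k \<equiv> int (part v)"
  defines "A \<equiv> (int (part u) - k) * (int (part w) - int (part u))"
    and "B \<equiv> 2 * (int (part u) - k) * (int (fc u) - int (fc w))"
    and "C \<equiv> - ((int (part w) - k) * (int (sc u) - int (sc w)) + (int (fc u) - int (fc w))\<^sup>2)"
  shows "int p dvd A * (int a)\<^sup>2 + B * int a + C" "\<not> int p dvd A"
proof -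
  define i j where "i = int (part u) - k" and "j = int (part w) - k"
  obtain k1 where k1: "int (fc u) - int (fc v) = i * int a + int p * k1"
    using assms(2) unfolding joined_def i_def k_def by (metis dvdE diff_eq_eq add.commute)
  obtain k2 where k2: "int (fc w) - int (fc v) = j * int b + int p * k2"
    using assms(3) unfolding joined_def j_def k_def by (metis dvdE diff_eq_eq add.commute)
  obtain l1 where l1: "int (sc u) - int (sc v) = i * (int a)\<^sup>2 + int p * l1"
    using assms(2) unfolding joined_def i_def k_def by (metis dvdE diff_eq_eq add.commute)
  obtain l2 where l2: "int (sc w) - int (sc v) = j * (int b)\<^sup>2 + int p * l2"
    using assms(3) unfolding joined_def j_def k_def by (metis dvdE diff_eq_eq add.commute)
  have s: "int (fc u) - int (fc w) = i * int a - j * int b + int p * (k1 - k2)"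
    using k1 k2 by (simp add: algebra_simps)
  have t: "int (sc u) - int (sc w) = i * (int a)\<^sup>2 - j * (int b)\<^sup>2 + int p * (l1 - l2)"
    using l1 l2 by (simp add: algebra_simps)
  have A: "A = i * (j - i)" by (simp add: A_def i_def j_def)
  \<comment> \<open>The terms free of the error multiples of p cancel identically; stating this for
    arbitrary integers exhibits the cofactor.\<close>
  have "i * (j - i) * a\<^sup>2 + 2 * i * (i * a - j * b + q * m) * a - (j * (i * a\<^sup>2 - j * b\<^sup>2 + q * n) + (i * a - j * b + q * m)\<^sup>2)
      = q * (- j * n - q * m\<^sup>2 + 2 * j * b * m)" for i j a b m n q :: int
    by (simp add: algebra_simps power2_eq_square)
  hence "A * (int a)\<^sup>2 + B * int a + C = int p * (- j * (l1 - l2) - int p * (k1 - k2)\<^sup>2 + 2 * j * int b * (k1 - k2))"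
    unfolding A B_def C_def s t i_def[symmetric] j_def[symmetric] diff_conv_add_uminus[symmetric] by simp
  thus "int p dvd A * (int a)\<^sup>2 + B * int a + C" by simp
  show "\<not> int p dvd A"
    unfolding A_def k_def using not_dvd_part_diff[of u v] not_dvd_part_diff[of w u] assms(1-3)
    by (auto simp: joined_def dest!: prime_dvd_multD[OF prime_int])
qed

text \<open>Common neighbours of u and w lie outside the parts of u and w. If these parts agree,
  each of the r - 1 others contains at most one, and r - 1 < 2 r - 3; if not, each of the r - 2
  others contains at most two, and 2 r - 4 < 2 r - 3.\<close>

lemma K2t_free: "\<not> contains_Berge hyp (K2t_V (2 * r - 3)) (K2t_E (2 * r - 3)) K2t_ends"
proof
  let ?t = "2 * r - 3"
  assume "contains_Berge hyp (K2t_V ?t) (K2t_E ?t) K2t_ends"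
  then obtain phi f where pf: "inj_on phi (K2t_V ?t)" "f ` K2t_E ?t \<subseteq> hyp"
    "\<forall>e\<in>K2t_E ?t. phi ` K2t_ends e \<subseteq> f e" unfolding contains_Berge_def by blast
  define W where "W = phi ` {2..<?t+2}"
  define u w where "u = phi 0" and "w = phi 1"
  have uw: "u \<noteq> w" using pf(1) by (auto simp: inj_on_def K2t_V_def u_def w_def)
  have "inj_on phi {2..<?t+2}" using pf(1) by (rule inj_on_subset) (auto simp: K2t_V_def)
  hence cardW: "card W = ?t" by (simp add: W_def card_image)
  have finW: "finite W" by (simp add: W_def)
  have ex: "\<exists>a b. joined u v a \<and> joined w v b" if v: "v \<in> W" for v
  proof -
    obtain l where l: "l \<in> {2..<?t+2}" "v = phi l" using v by (auto simp: W_def)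
    have ne: "u \<noteq> v" "w \<noteq> v" using pf(1) l by (auto simp: inj_on_def K2t_V_def u_def w_def)
    have "(0, l) \<in> K2t_E ?t" "(1, l) \<in> K2t_E ?t" using l by (auto simp: K2t_E_def)
    hence "f (0, l) \<in> hyp" "f (1, l) \<in> hyp" "u \<in> f (0, l)" "v \<in> f (0, l)" "w \<in> f (1, l)" "v \<in> f (1, l)"
      using pf(2,3) l by (force simp: K2t_ends_def u_def w_def)+
    thus ?thesis using hyp_joined[of "f (0, l)" u v] hyp_joined[of "f (1, l)" w v] ne by metis
  qed
  then obtain a b where ab: "\<And>v. v \<in> W \<Longrightarrow> joined u v (a v)" "\<And>v. v \<in> W \<Longrightarrow> joined w v (b v)" by metis
  show False
  proof (cases "part u = part w")
    case True
    have "inj_on part W"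
      by (rule inj_onI) (rule same_part_unique[OF True uw _ ab(1) ab(2) ab(1) ab(2)])
    moreover have "part ` W \<subseteq> {..<r} - {part u}"
      using ab(1) unfolding joined_def image_subset_iff by (metis DiffI lessThan_iff singletonD)
    ultimately have "card W \<le> card ({..<r} - {part u})" by (intro card_inj_on_le) auto
    moreover have "card W > 0" using cardW r_ge by simp
    then obtain v where "v \<in> W" by (auto simp: card_gt_0_iff)
    hence "part u < r" using ab(1) by (auto simp: joined_def)
    ultimately show False using cardW r_ge by simp
  next
    case False
    have fiber: "card {v \<in> W. part v = k} \<le> 2" for k
    proof (rule ccontr)
      assume "\<not> ?thesis"
      hence "3 \<le> card {v \<in> W. part v = k}" by simp
      then obtain S where S: "S \<subseteq> {v \<in> W. part v = k}" "card S = 3" by (rule obtain_subset_with_card_n)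
      then obtain x y z where xyz: "S = {x, y, z}" "x \<noteq> y" "y \<noteq> z" "x \<noteq> z" by (auto simp: card_3_iff)
      have *: "x \<in> W" "y \<in> W" "z \<in> W" "part x = k" "part y = k" "part z = k" using S xyz by auto
      \<comment> \<open>The coefficients depend on the common neighbour only through its part, so x,
        y and z yield roots of one and the same polynomial.\<close>
      note qd = different_part_quadratic[OF False ab(1) ab(2)]
      have "int p dvd int (a x) - int (a y) \<or> int p dvd int (a x) - int (a z) \<or> int p dvd int (a y) - int (a z)"
        by (rule quadratic_roots[OF prime_int qd(2)[OF *(1,1)] qd(1)[OF *(1,1)]])
           (use qd(1)[OF *(2,2)] qd(1)[OF *(3,3)] * in auto)
      thus False
        using joined_same_parameter[OF _ ab(1) ab(1)] * xyz(2-4) by metis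
    qed
    have "part ` W \<subseteq> {..<r} - {part u, part w}"
      using ab unfolding joined_def image_subset_iff
      by (metis DiffI lessThan_iff insertE singletonD)
    hence "(\<Sum>k\<in>{..<r} - {part u, part w}. \<Sum>v | v \<in> W \<and> part v = k. 1) = (\<Sum>v\<in>W. 1 :: nat)"
      by (intro sum.group finW) auto
    hence "card W = (\<Sum>k\<in>{..<r} - {part u, part w}. card {v \<in> W. part v = k})" by simp
    also have "\<dots> \<le> (\<Sum>k\<in>{..<r} - {part u, part w}. 2)" by (intro sum_mono fiber)
    also have "\<dots> = 2 * card ({..<r} - {part u, part w})" by simp
    also have "card ({..<r} - {part u, part w}) = r - 2"
    proof -
      have "card W > 0" using cardW r_ge by simp
      then obtain v where "v \<in> W" by (auto simp: card_gt_0_iff)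
      hence "part u < r" "part w < r" using ab by (auto simp: joined_def)
      thus ?thesis using False by (subst card_Diff_subset) auto
    qed
    finally show False using cardW r_ge by simp
  qed
qed

lemma free: "free_C2_C3_K2t (2 * r - 3) hyp"
  using C2_free C3_free K2t_free by (simp add: free_C2_C3_K2t_def)

end

section \<open>Asymptotics\<close>

lemma finite_ex_set: "finite {card H | H. uniform_hg r n H \<and> free_C2_C3_K2t t H}"
proof (rule finite_subset)
  show "{card H | H. uniform_hg r n H \<and> free_C2_C3_K2t t H} \<subseteq> card ` Pow (Pow {..<n})"
    by (auto simp: uniform_hg_def)
qed simp

lemma card_le_ex_C2_C3_K2t:
  assumes "uniform_hg r n H" "free_C2_C3_K2t t H"
  shows "card H \<le> ex_C2_C3_K2t r t n"
  unfolding ex_C2_C3_K2t_def by (rule Max_ge[OF finite_ex_set]) (use assms in blast)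

text \<open>The maximum is over a non-empty set, as the empty hypergraph is free. Here t > 0 enters:
  K_{2,0} has no edges and would be contained even in the empty hypergraph.\<close>

lemma ex_C2_C3_K2t_attained:
  assumes "t > 0"
  obtains H where "uniform_hg r n H" "free_C2_C3_K2t t H" "card H = ex_C2_C3_K2t r t n"
proof -
  have "uniform_hg r n {} \<and> free_C2_C3_K2t t {}"
    using assms by (auto simp: uniform_hg_def free_C2_C3_K2t_def contains_Berge_def C2_E_def C3_E_def K2t_E_def)
  hence "{card H | H. uniform_hg r n H \<and> free_C2_C3_K2t t H} \<noteq> {}" by blast
  from Max_in[OF finite_ex_set this] show ?thesis
    using that unfolding ex_C2_C3_K2t_def by auto
qed

text \<open>The ideal size of the prime is s = sqrt(n / r). A prime between (1 - \<delta>) s and (1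
  + \<delta>) (1 - \<delta>) s \<le> s satisfies r p^2 \<le> n and still gives at least ((1 -
  \<delta>) s)^3 edges.\<close>

lemma ex_C2_C3_K2t_lower:
  assumes r: "r \<ge> 3" and \<delta>: "0 < \<delta>" "\<delta> < 1"
  shows "\<forall>\<^sub>F n in sequentially.
    (1 - \<delta>) ^ 3 * (real n powr (3/2) / real r powr (3/2)) \<le> real (ex_C2_C3_K2t r (2 * r - 3) n)"
proof -
  obtain x0 where x0: "\<And>x. x \<ge> x0 \<Longrightarrow> \<exists>p. prime p \<and> x < real p \<and> real p \<le> (1 + \<delta>) * x"
    using prime_in_short_interval[OF \<delta>(1)] by blast
  have "filterlim (\<lambda>n. (1 - \<delta>) * sqrt (real n / real r)) at_top sequentially"
    using r \<delta> by real_asymp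
  \<comment> \<open>The bound r forces p > r \<ge> 3, so that p is odd and the r parts have
    different residues.\<close>
  hence "\<forall>\<^sub>F n in sequentially. (1 - \<delta>) * sqrt (real n / real r) \<ge> max x0 (real r)"
    unfolding filterlim_at_top by blast
  thus ?thesis
  proof eventually_elim
    case (elim n)
    define s where "s = sqrt (real n / real r)"
    define x where "x = (1 - \<delta>) * s"
    have s0: "s \<ge> 0" by (simp add: s_def)
    have x: "x \<ge> x0" "x \<ge> real r" using elim by (auto simp: x_def s_def)
    obtain p where p: "prime p" "x < real p" "real p \<le> (1 + \<delta>) * x" using x0[OF x(1)] by blast
    have "real p \<le> (1 - \<delta>\<^sup>2) * s" using p(3) by (simp add: x_def algebra_simps power2_eq_square)
    also have "\<dots> \<le> 1 * s" using s0 by (intro mult_right_mono) auto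
    finally have "(real p)\<^sup>2 \<le> s\<^sup>2" by (intro power_mono) auto
    also have "s\<^sup>2 = real n / real r" by (simp add: s_def)
    finally have "real (r * p\<^sup>2) \<le> real n" using r by (simp add: field_simps)
    hence rp: "r * p\<^sup>2 \<le> n" by (simp only: of_nat_le_iff)
    have "p > r" using p x by simp
    interpret parabola_hypergraph r p
      using p(1) prime_odd_nat[of p] r \<open>p > r\<close> by unfold_locales auto
    have "(1 - \<delta>) ^ 3 * (real n powr (3/2) / real r powr (3/2)) = (1 - \<delta>) ^ 3 * (real n / real r) powr (3/2)"
      using r by (simp add: powr_divide)
    also have "(real n / real r) powr (3/2) = s ^ 3"
    proof -
      have "s ^ 3 = ((real n / real r) powr (1/2)) powr 3"
        unfolding s_def by (simp add: powr_half_sqrt powr_numeral)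
      thus ?thesis by (simp add: powr_powr)
    qed
    also have "(1 - \<delta>) ^ 3 * s ^ 3 = x ^ 3" by (simp add: x_def power_mult_distrib)
    also have "x ^ 3 \<le> real p ^ 3" using p(2) x(2) by (intro power_mono) auto
    also have "\<dots> = real (card hyp)" by (simp add: card_hyp)
    also have "\<dots> \<le> real (ex_C2_C3_K2t r (2 * r - 3) n)"
      using card_le_ex_C2_C3_K2t[OF uniform_hyp[OF rp] free] by simp
    finally show ?case .
  qed
qed

theorem theorem1p2:
  fixes r :: nat
  assumes "r \<ge> 3"
  shows "(\<exists>g :: nat \<Rightarrow> real. g \<in> o(\<lambda>n. real n powr (3/2)) \<and>
            (\<forall>n. real n powr (3/2) / real r powr (3/2) - g n
                   \<le> real (ex_C2_C3_K2t r (2*r-3) n)))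
       \<and> (\<forall>n. real (ex_C2_C3_K2t r (2*r-3) n)
               \<le> sqrt (2 * real r - 4) / (real r * (real r - 1)) * real n powr (3/2)
                 + real n / real r)"
proof (intro conjI allI)
  \<comment> \<open>The positive part of the deficit: the lower bound then holds for every n, and
    \<open>g\<close> has to be estimated only for large n.\<close>
  define g where "g n = max 0 (real n powr (3/2) / real r powr (3/2) - real (ex_C2_C3_K2t r (2*r-3) n))" for n
  have "g \<in> o(\<lambda>n. real n powr (3/2))"
  proof (rule landau_o.smallI)
    fix c :: real assume c: "c > 0"
    \<comment> \<open>1 - (1 - \<delta>)^3 \<le> 3 \<delta> \<le> c, and 1/2 keeps \<delta> below
      1.\<close>
    define \<delta> where "\<delta> = min (c / 3) (1 / 2)"
    have \<delta>: "0 < \<delta>" "\<delta> < 1" "3 * \<delta> \<le> c" using c by (auto simp: \<delta>_def min_def)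
    show "\<forall>\<^sub>F n in sequentially. norm (g n) \<le> c * norm (real n powr (3/2))"
      using ex_C2_C3_K2t_lower[OF assms \<delta>(1,2)]
    proof eventually_elim
      case (elim n)
      define y where "y = real n powr (3/2) / real r powr (3/2)"
      have y: "0 \<le> y" "y \<le> real n powr (3/2)"
      proof -
        have "real r powr (3/2) \<ge> 1" using assms by (intro ge_one_powr_ge_zero) auto
        thus "y \<le> real n powr (3/2)" unfolding y_def by (simp add: divide_le_eq mult_le_cancel_left1)
      qed (simp add: y_def)
      have "(1 - \<delta>) ^ 3 = 1 - 3 * \<delta> + \<delta>\<^sup>2 * (3 - \<delta>)"
        by (simp add: power3_eq_cube power2_eq_square algebra_simps)
      moreover have "0 \<le> \<delta>\<^sup>2 * (3 - \<delta>)" using \<delta> by simp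
      ultimately have "1 - (1 - \<delta>) ^ 3 \<le> c" using \<delta>(3) by linarith
      hence "(1 - (1 - \<delta>) ^ 3) * y \<le> c * y" using y by (intro mult_right_mono)
      also have "\<dots> \<le> c * real n powr (3/2)" using c y by simp
      finally have "y - (1 - \<delta>) ^ 3 * y \<le> c * real n powr (3/2)" by (simp add: algebra_simps)
      moreover have "0 \<le> c * real n powr (3/2)" using c by simp
      ultimately show ?case using elim unfolding g_def y_def[symmetric] by simp
    qed
  qed
  moreover have "\<forall>n. real n powr (3/2) / real r powr (3/2) - g n \<le> real (ex_C2_C3_K2t r (2*r-3) n)"
    unfolding g_def max_def by auto
  ultimately show "\<exists>g :: nat \<Rightarrow> real. g \<in> o(\<lambda>n. real n powr (3/2)) \<and>
            (\<forall>n. real n powr (3/2) / real r powr (3/2) - g n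
                   \<le> real (ex_C2_C3_K2t r (2*r-3) n))" by blast
next
  fix n
  obtain H where H: "uniform_hg r n H" "free_C2_C3_K2t (2 * r - 3) H" "card H = ex_C2_C3_K2t r (2 * r - 3) n"
    using ex_C2_C3_K2t_attained[of "2 * r - 3" r n] assms by auto
  have "real (2 * r - 3 - 1) = 2 * real r - 4" using assms by (simp add: of_nat_diff)
  thus "real (ex_C2_C3_K2t r (2*r-3) n)
               \<le> sqrt (2 * real r - 4) / (real r * (real r - 1)) * real n powr (3/2) + real n / real r"
    using card_C2_C3_K2t_free_le[OF H(1,2)] assms unfolding H(3) by simp
qed

end
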